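(* Let $G$ be an LCA(2) group and let $h$ be a non-degenerate quadratic character of $G$ satisfying $h(x)=h(-x)$ for all $x\in G$, with associated isomorphism $\rho:G\to G^*$, i.e. $h(x+y)h(x)^{-1}h(y)^{-1}=(x,y\rho)$ for all $x,y\in G$. Then there is a group homomorphism $SL_2(\mathbb Z)\to B_0(G)$ given by $$\begin{pmatrix}1&1\\0&1\end{pmatrix}\mapsto t_0(h),\qquad \begin{pmatrix}0&-1\\1&0\end{pmatrix}\mapsto d_0'(\rho^{-1}).$$
   Context: **LCA(2).** LCA is the category of locally compact Hausdorff abelian groups and continuous homomorphisms; an exact triple $A\to B\to C$ in LCA is a short exact sequence with $A\to B$ a closed embedding and $B/A\to C$ a topological isomorphism. An LCA(2) group is an abelian group $G$ with a nonempty class $\mathcal U(G)$ of subgroups such that for $S_1\subset S_2$ in $\mathcal U(G)$ the quotient $S_2/S_1$ is given an LCA structure, and: (1) $\bigcup_{S\in\mathcal U(G)}S=G$, $\bigcap_{S\in\mathcal U(G)}S=\{0\}$; (2) any $S_1,S_2\in\mathcal U(G)$ admit $S,S'\in\mathcal U(G)$ with $S\subset S_i\subset S'$; (3) for $S_1\subset S_2\subset S_3$ in $\mathcal U(G)$, $S_2/S_1\to S_3/S_1\to S_3/S_2$ is an exact triple in LCA; (4) for $S_1\subset S_2$ in $\mathcal U(G)$, the preimage in $S_2$ of any closed subgroup of $S_2/S_1$ lies in $\mathcal U(G)$. A morphism $f:G\to G'$ is a group homomorphism such that for every $S'\in\mathcal U(G')$ there is $S\in\mathcal U(G)$ with $f(S)\subset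 S'$; for every $S\in\mathcal U(G)$ there is $S'\in\mathcal U(G')$ with $f(S)\subset S'$; and whenever $S_1\subset S_2$ in $\mathcal U(G)$, $S_1'\subset S_2'$ in $\mathcal U(G')$, $f(S_i)\subset S_i'$, the induced map $S_2/S_1\to S_2'/S_1'$ is continuous. An LCA group $A$ is viewed as an LCA(2) group with $\mathcal U(A)$ the set of all closed subgroups. The product $G\times H$ has the unique LCA(2) structure for which the subgroups $U\times V$ ($U\in\mathcal U(G)$, $V\in\mathcal U(H)$), with product topologies on quotients, are cofinal in both directions (every member of $\mathcal U(G\times H)$ contains one and is contained in one). **Dual.** $\mathbb T$ is the circle group. $G^*$ is the group of LCA(2) morphisms $G\to\mathbb T$ (characters), written additively, with pairing $(x,x^* )\in\mathbb T$. For $S\in\mathcal U(G)$, $S^\perp=\{\chi\in G^*:\chi|_S=1\}$; $\mathcal U(G^* )=\{S^\perp: S\in\mathcal U(G)\}$, with $S_1^\perp/S_2^\perp\cong (S_2/S_1)^*$ (Pontryagin dual) for $S_1\subset S_2$. This makes $G^*$ an LCA(2) group. **Quadratic characters.** A bicharacter on $G\times H$ is a map $f:G\times H\to\mathbb T$ that is a character in each variable and such that for each $V\in\mathcal U(H)$ there is $U\in\mathcal U(G)$ with $f(U\times V)=1$, and for each $U\in\mathcal U(G)$ there is $V\in\mathcal U(H)$ with $f(U\times V)=1$. A quadratic character of $G$ is a map $h:G\to\mathbb T$ such that for every $U\in\mathcal U(G)$ there is $V\in\mathcal U(G)$ with $h(u+v)=h(u)$ for all $u\in U$, $v\in V$;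 $(x,y)\mapsto h(x+y)h(x)^{-1}h(y)^{-1}$ is a bicharacter on $G\times G$; and $h$ is continuous in the sense that whenever $V\subset U$ in $\mathcal U(G)$ and $h(u+v)=h(u)$ for all $u\in U,v\in V$, the induced function on $U/V$ is continuous. There is then an LCA(2) morphism $\rho:G\to G^*$ (written on the right) with $h(x+y)h(x)^{-1}h(y)^{-1}=(x,y\rho)$; $h$ is non-degenerate if $\rho$ is an isomorphism in LCA(2). **Heisenberg group.** $A(G)=G\times G^*\times\mathbb T$ with $(w_1,t_1)(w_2,t_2)=(w_1+w_2,F(w_1,w_2)t_1t_2)$, where $F((x_1,x_1^* ),(x_2,x_2^* ))=(x_1,x_2^* )$. Automorphisms act from the right. $B_0(G)$ is the group of automorphisms of $A(G)$ of the form $(w,t)\mapsto(w\sigma,f(w)t)$, denoted $(\sigma,f)$, with $\sigma$ an automorphism of $G\times G^*$ as an LCA(2) group and $f$ a quadratic character of $G\times G^*$; the group law is $(\sigma,f)(\sigma',f')=(\sigma\sigma',f'')$ with $f''(w)=f(w)f'(w\sigma)$. Matrix notation: $(x,x^* )\begin{pmatrix}\alpha&\beta\\\gamma&\delta\end{pmatrix}=(x\alpha+x^*\gamma,\,x\beta+x^*\delta)$. The elements in the claim are $$t_0(h)=\left(\begin{pmatrix}1&\rho\\0&1\end{pmatrix},\ (x,x^* )\mapsto h(x)\right),\qquad d_0'(\rho^{-1})=\left(\begin{pmatrix}0&-\rho\\\rho^{-1}&0\end{pmatrix},\ (x,x^* )\mapsto (x,-x^* )\right).$$ *)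

theory Defs
  imports "HOL-Analysis.Analysis" "HOL-Algebra.Coset" "HOL-Algebra.Bij"
begin

text \<open>
  Abelian groups are written multiplicatively, as in HOL-Algebra: \<open>x \<otimes> y\<close> is the \<open>x + y\<close> of the
  source and \<open>inv x\<close> is \<open>- x\<close>.  Groups have explicit carriers because the dual group is a set of
  functions.  The points of a quotient group \<open>A Mod N\<close> are the cosets of \<open>N\<close>.
\<close>

section \<open>Locally compact abelian groups\<close>

definition lca_group :: "('a, 'm) monoid_scheme \<Rightarrow> 'a topology \<Rightarrow> bool" where
  "lca_group A T \<longleftrightarrow>
     comm_group A \<and> topspace T = carrier A \<and>
     continuous_map (prod_topology T T) T (\<lambda>(x, y). x \<otimes>\<^bsub>A\<^esub> y) \<and>
     continuous_map T T (\<lambda>x. inv\<^bsub>A\<^esub> x) \<and>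
     Hausdorff_space T \<and> locally_compact_space T"

definition coset_topology ::
    "('a, 'm) monoid_scheme \<Rightarrow> 'a topology \<Rightarrow> 'a set \<Rightarrow> 'a set topology" where
  "coset_topology A T N =
     topology (\<lambda>W. W \<subseteq> carrier (A Mod N) \<and> openin T {x \<in> topspace T. N #>\<^bsub>A\<^esub> x \<in> W})"

lemma istopology_coset_topology:
  "istopology (\<lambda>W. W \<subseteq> carrier (A Mod N) \<and> openin T {x \<in> topspace T. N #>\<^bsub>A\<^esub> x \<in> W})"
proof -
  have "openin T {x \<in> topspace T. N #>\<^bsub>A\<^esub> x \<in> V \<inter> W}"
    if "openin T {x \<in> topspace T. N #>\<^bsub>A\<^esub> x \<in> V}" "openin T {x \<in> topspace T. N #>\<^bsub>A\<^esub> x \<in> W}" for V W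
  proof -
    have "{x \<in> topspace T. N #>\<^bsub>A\<^esub> x \<in> V \<inter> W} =
          {x \<in> topspace T. N #>\<^bsub>A\<^esub> x \<in> V} \<inter> {x \<in> topspace T. N #>\<^bsub>A\<^esub> x \<in> W}" by auto
    then show ?thesis using that by (simp add: openin_Int)
  qed
  moreover have "openin T {x \<in> topspace T. N #>\<^bsub>A\<^esub> x \<in> \<Union>\<W>}"
    if "\<forall>W\<in>\<W>. openin T {x \<in> topspace T. N #>\<^bsub>A\<^esub> x \<in> W}" for \<W>
  proof -
    have "{x \<in> topspace T. N #>\<^bsub>A\<^esub> x \<in> \<Union>\<W>} =
          (\<Union>W\<in>\<W>. {x \<in> topspace T. N #>\<^bsub>A\<^esub> x \<in> W})" by auto
    then show ?thesis using that by auto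
  qed
  ultimately show ?thesis unfolding istopology_def by blast
qed

lemma openin_coset_topology:
  "openin (coset_topology A T N) W \<longleftrightarrow>
     W \<subseteq> carrier (A Mod N) \<and> openin T {x \<in> topspace T. N #>\<^bsub>A\<^esub> x \<in> W}"
  unfolding coset_topology_def by (simp only: topology_inverse'[OF istopology_coset_topology])

definition lca_exact_triple ::
    "('a, 'm) monoid_scheme \<Rightarrow> 'a topology \<Rightarrow> ('a \<Rightarrow> 'b) \<Rightarrow>
     ('b, 'n) monoid_scheme \<Rightarrow> 'b topology \<Rightarrow> ('b \<Rightarrow> 'c) \<Rightarrow>
     ('c, 'k) monoid_scheme \<Rightarrow> 'c topology \<Rightarrow> bool" where
  "lca_exact_triple A TA i B TB p C TC \<longleftrightarrow>
     lca_group A TA \<and> lca_group B TB \<and> lca_group C TC \<and>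
     i \<in> hom A B \<and> p \<in> hom B C \<and>
     inj_on i (carrier A) \<and> kernel B C p = i ` carrier A \<and> p ` carrier B = carrier C \<and>
     embedding_map TA TB i \<and> closedin TB (i ` carrier A) \<and>
     homeomorphic_map (coset_topology B TB (i ` carrier A)) TC (\<lambda>X. the_elem (p ` X))"

definition circle_group :: "complex monoid" where
  "circle_group = \<lparr>carrier = sphere 0 1, mult = (*), one = 1\<rparr>"

definition circle_top :: "complex topology" where
  "circle_top = top_of_set (sphere 0 1)"

definition pontryagin_dual :: "('a, 'm) monoid_scheme \<Rightarrow> 'a topology \<Rightarrow> ('a \<Rightarrow> complex) set" where
  "pontryagin_dual A T =
     {\<xi> \<in> hom A circle_group. continuous_map T circle_top \<xi>} \<inter> extensional (carrier A)"

text \<open>The compact-open topology.\<close>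
definition pontryagin_top ::
    "('a, 'm) monoid_scheme \<Rightarrow> 'a topology \<Rightarrow> ('a \<Rightarrow> complex) topology" where
  "pontryagin_top A T =
     topology_generated_by
       {{\<xi> \<in> pontryagin_dual A T. \<xi> ` K \<subseteq> W} | K W. compactin T K \<and> openin circle_top W}"


section \<open>LCA(2) groups\<close>

text \<open>
  \<open>subs G\<close> is the class \<open>\<U>(G)\<close>, and \<open>qtop G S2 S1\<close> is the topology of \<open>S2 / S1\<close>; it is meaningful
  only for \<open>S1 \<subseteq> S2\<close> in \<open>subs G\<close>, and nothing below looks at its other values.
\<close>
record 'a lca2 = "'a monoid" +
  subs :: "'a set set"
  qtop :: "'a set \<Rightarrow> 'a set \<Rightarrow> 'a set topology"

definition subquot :: "('a, 'm) monoid_scheme \<Rightarrow> 'a set \<Rightarrow> 'a set \<Rightarrow> 'a set monoid" where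
  "subquot G S2 S1 = (G\<lparr>carrier := S2\<rparr>) Mod S1"

text \<open>
  Cosets of \<open>S1\<close> in \<open>S2\<close> are cosets of \<open>S1\<close> in \<open>S3\<close>, so \<open>S2/S1 \<rightarrow> S3/S1\<close> is \<open>X \<mapsto> X\<close>;
  the projection \<open>S3/S1 \<rightarrow> S3/S2\<close> is \<open>X \<mapsto> S2 X\<close>.
\<close>
definition lca2_group :: "'a lca2 \<Rightarrow> bool" where
  "lca2_group G \<longleftrightarrow>
     comm_group G \<and> subs G \<noteq> {} \<and> (\<forall>S\<in>subs G. subgroup S G) \<and>
     (\<forall>S1\<in>subs G. \<forall>S2\<in>subs G. S1 \<subseteq> S2 \<longrightarrow> lca_group (subquot G S2 S1) (qtop G S2 S1)) \<and>
     \<Union>(subs G) = carrier G \<and> \<Inter>(subs G) = {\<one>\<^bsub>G\<^esub>} \<and>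
     (\<forall>S1\<in>subs G. \<forall>S2\<in>subs G. \<exists>S\<in>subs G. \<exists>S'\<in>subs G. S \<subseteq> S1 \<inter> S2 \<and> S1 \<union> S2 \<subseteq> S') \<and>
     (\<forall>S1\<in>subs G. \<forall>S2\<in>subs G. \<forall>S3\<in>subs G. S1 \<subseteq> S2 \<longrightarrow> S2 \<subseteq> S3 \<longrightarrow>
        lca_exact_triple
          (subquot G S2 S1) (qtop G S2 S1) (\<lambda>X. X)
          (subquot G S3 S1) (qtop G S3 S1) (\<lambda>X. S2 <#>\<^bsub>G\<^esub> X)
          (subquot G S3 S2) (qtop G S3 S2)) \<and>
     (\<forall>S1\<in>subs G. \<forall>S2\<in>subs G. S1 \<subseteq> S2 \<longrightarrow>
        (\<forall>K. subgroup K (subquot G S2 S1) \<longrightarrow> closedin (qtop G S2 S1) K \<longrightarrow>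
           {x \<in> S2. S1 #>\<^bsub>G\<^esub> x \<in> K} \<in> subs G))"

definition lca2_mor :: "'a lca2 \<Rightarrow> 'b lca2 \<Rightarrow> ('a \<Rightarrow> 'b) \<Rightarrow> bool" where
  "lca2_mor G H f \<longleftrightarrow>
     f \<in> hom G H \<and>
     (\<forall>S'\<in>subs H. \<exists>S\<in>subs G. f ` S \<subseteq> S') \<and>
     (\<forall>S\<in>subs G. \<exists>S'\<in>subs H. f ` S \<subseteq> S') \<and>
     (\<forall>S1\<in>subs G. \<forall>S2\<in>subs G. \<forall>S1'\<in>subs H. \<forall>S2'\<in>subs H.
        S1 \<subseteq> S2 \<longrightarrow> S1' \<subseteq> S2' \<longrightarrow> f ` S1 \<subseteq> S1' \<longrightarrow> f ` S2 \<subseteq> S2' \<longrightarrow>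
        continuous_map (qtop G S2 S1) (qtop H S2' S1') (\<lambda>X. S1' <#>\<^bsub>H\<^esub> (f ` X)))"

definition lca2_iso :: "'a lca2 \<Rightarrow> 'b lca2 \<Rightarrow> ('a \<Rightarrow> 'b) \<Rightarrow> bool" where
  "lca2_iso G H f \<longleftrightarrow>
     lca2_mor G H f \<and>
     (\<exists>g. lca2_mor H G g \<and> (\<forall>x\<in>carrier G. g (f x) = x) \<and> (\<forall>y\<in>carrier H. f (g y) = y))"

definition lca2_of_lca :: "'a monoid \<Rightarrow> 'a topology \<Rightarrow> 'a lca2" where
  "lca2_of_lca A T =
     \<lparr>carrier = carrier A, mult = mult A, one = one A,
      subs = {S. subgroup S A \<and> closedin T S},
      qtop = (\<lambda>S2 S1. coset_topology (A\<lparr>carrier := S2\<rparr>) (subtopology T S2) S1)\<rparr>"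

definition lca2_circle :: "complex lca2" where
  "lca2_circle = lca2_of_lca circle_group circle_top"


subsection \<open>Products\<close>

text \<open>
  The characterization of the product structure: the rectangles \<open>U \<times> V\<close> with the product topologies
  on their quotients are cofinal in both directions.
\<close>
definition is_lca2_prod :: "'a lca2 \<Rightarrow> 'b lca2 \<Rightarrow> ('a \<times> 'b) lca2 \<Rightarrow> bool" where
  "is_lca2_prod G H P \<longleftrightarrow>
     lca2_group P \<and>
     carrier P = carrier (G \<times>\<times> H) \<and> mult P = mult (G \<times>\<times> H) \<and> one P = one (G \<times>\<times> H) \<and>
     (\<forall>U\<in>subs G. \<forall>V\<in>subs H. U \<times> V \<in> subs P) \<and>
     (\<forall>U1\<in>subs G. \<forall>U2\<in>subs G. \<forall>V1\<in>subs H. \<forall>V2\<in>subs H. U1 \<subseteq> U2 \<longrightarrow> V1 \<subseteq> V2 \<longrightarrow>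
        homeomorphic_map (qtop P (U2 \<times> V2) (U1 \<times> V1))
          (prod_topology (qtop G U2 U1) (qtop H V2 V1)) (\<lambda>X. (fst ` X, snd ` X))) \<and>
     (\<forall>W\<in>subs P. \<exists>U\<in>subs G. \<exists>V\<in>subs H. U \<times> V \<subseteq> W) \<and>
     (\<forall>W\<in>subs P. \<exists>U\<in>subs G. \<exists>V\<in>subs H. W \<subseteq> U \<times> V)"

text \<open>
  The structure itself.  With a rectangle \<open>U1 \<times> V1\<close> below and a rectangle \<open>U2 \<times> V2\<close> above, the
  members are the subgroups that are closed modulo \<open>U1 \<times> V1\<close>, and \<open>W2 / W1\<close> is topologized as a
  quotient of the subspace \<open>W2 / (U1 \<times> V1)\<close> of \<open>U2/U1 \<times> V2/V1\<close>.  All choices of rectangles give the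
  same topology when the product structure exists; the definition takes the topology generated by
  all of them.  Theorem \<open>lca2_prod_unique\<close> below
  shows that any structure satisfying \<open>is_lca2_prod\<close> is this one.
\<close>
definition lca2_prod :: "'a lca2 \<Rightarrow> 'b lca2 \<Rightarrow> ('a \<times> 'b) lca2" where
  "lca2_prod G H =
     \<lparr>carrier = carrier (G \<times>\<times> H), mult = mult (G \<times>\<times> H), one = one (G \<times>\<times> H),
      subs = {W. subgroup W (G \<times>\<times> H) \<and>
        (\<exists>U1\<in>subs G. \<exists>U2\<in>subs G. \<exists>V1\<in>subs H. \<exists>V2\<in>subs H.
           U1 \<subseteq> U2 \<and> V1 \<subseteq> V2 \<and> U1 \<times> V1 \<subseteq> W \<and> W \<subseteq> U2 \<times> V2 \<and>
           closedin (prod_topology (qtop G U2 U1) (qtop H V2 V1))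
             ((\<lambda>(x, y). (U1 #>\<^bsub>G\<^esub> x, V1 #>\<^bsub>H\<^esub> y)) ` W))},
      qtop = (\<lambda>W2 W1. topology_generated_by
        {Q. Q \<subseteq> carrier (subquot (G \<times>\<times> H) W2 W1) \<and>
          (\<exists>U1\<in>subs G. \<exists>U2\<in>subs G. \<exists>V1\<in>subs H. \<exists>V2\<in>subs H. \<exists>E.
             U1 \<subseteq> U2 \<and> V1 \<subseteq> V2 \<and> U1 \<times> V1 \<subseteq> W1 \<and> W2 \<subseteq> U2 \<times> V2 \<and>
             openin (prod_topology (qtop G U2 U1) (qtop H V2 V1)) E \<and>
             {w \<in> W2. W1 #>\<^bsub>G \<times>\<times> H\<^esub> w \<in> Q} =
             {w \<in> W2. (U1 #>\<^bsub>G\<^esub> fst w, V1 #>\<^bsub>H\<^esub> snd w) \<in> E})})\<rparr>"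


subsection \<open>The dual\<close>

text \<open>
  Characters are extensional, so that equality of functions is equality of characters; the pairing
  \<open>(x, \<xi>)\<close> is \<open>\<xi> x\<close>.
\<close>
definition characters :: "'a lca2 \<Rightarrow> ('a \<Rightarrow> complex) set" where
  "characters G = {\<xi>. lca2_mor G lca2_circle \<xi>} \<inter> extensional (carrier G)"

definition dual_group :: "'a lca2 \<Rightarrow> ('a \<Rightarrow> complex) monoid" where
  "dual_group G =
     \<lparr>carrier = characters G,
      mult = (\<lambda>\<xi> \<psi>. \<lambda>x\<in>carrier G. \<xi> x * \<psi> x),
      one = (\<lambda>x\<in>carrier G. 1)\<rparr>"

definition perp :: "'a lca2 \<Rightarrow> 'a set \<Rightarrow> ('a \<Rightarrow> complex) set" where
  "perp G S = {\<xi> \<in> characters G. \<forall>x\<in>S. \<xi> x = 1}"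

definition coperp :: "'a lca2 \<Rightarrow> ('a \<Rightarrow> complex) set \<Rightarrow> 'a set" where
  "coperp G A = {x \<in> carrier G. \<forall>\<xi>\<in>A. \<xi> x = 1}"

definition dual_quot_map ::
    "'a lca2 \<Rightarrow> 'a set \<Rightarrow> 'a set \<Rightarrow> ('a \<Rightarrow> complex) set \<Rightarrow> 'a set \<Rightarrow> complex" where
  "dual_quot_map G S1 S2 X =
     (\<lambda>Y\<in>carrier (subquot G S2 S1). the_elem (\<Union>\<xi>\<in>X. \<xi> ` Y))"

text \<open>
  The topology of \<open>S1\<^sup>\<bottom> / S2\<^sup>\<bottom>\<close> is that of the Pontryagin dual of \<open>S2 / S1\<close>, carried over along the
  bijection \<open>dual_quot_map G S1 S2\<close>.  The members \<open>S1\<close>, \<open>S2\<close> are recovered from \<open>A = S1\<^sup>\<bottom>\<close>,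
  \<open>B = S2\<^sup>\<bottom>\<close> as their common kernels: \<open>S = coperp G (perp G S)\<close> by Pontryagin duality.
\<close>
definition lca2_dual :: "'a lca2 \<Rightarrow> ('a \<Rightarrow> complex) lca2" where
  "lca2_dual G =
     \<lparr>carrier = carrier (dual_group G), mult = mult (dual_group G), one = one (dual_group G),
      subs = perp G ` subs G,
      qtop = (\<lambda>A B. let S1 = coperp G A; S2 = coperp G B in
        pullback_topology (carrier (subquot (dual_group G) A B)) (dual_quot_map G S1 S2)
          (pontryagin_top (subquot G S2 S1) (qtop G S2 S1)))\<rparr>"


section \<open>Quadratic characters\<close>

definition bicharacter :: "'a lca2 \<Rightarrow> 'b lca2 \<Rightarrow> ('a \<Rightarrow> 'b \<Rightarrow> complex) \<Rightarrow> bool" where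
  "bicharacter G H f \<longleftrightarrow>
     (\<forall>y\<in>carrier H. lca2_mor G lca2_circle (\<lambda>x. f x y)) \<and>
     (\<forall>x\<in>carrier G. lca2_mor H lca2_circle (\<lambda>y. f x y)) \<and>
     (\<forall>V\<in>subs H. \<exists>U\<in>subs G. \<forall>u\<in>U. \<forall>v\<in>V. f u v = 1) \<and>
     (\<forall>U\<in>subs G. \<exists>V\<in>subs H. \<forall>u\<in>U. \<forall>v\<in>V. f u v = 1)"

definition polarization :: "'a lca2 \<Rightarrow> ('a \<Rightarrow> complex) \<Rightarrow> 'a \<Rightarrow> 'a \<Rightarrow> complex" where
  "polarization G h x y = h (x \<otimes>\<^bsub>G\<^esub> y) * inverse (h x) * inverse (h y)"

definition quadratic_character :: "'a lca2 \<Rightarrow> ('a \<Rightarrow> complex) \<Rightarrow> bool" where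
  "quadratic_character G h \<longleftrightarrow>
     h \<in> carrier G \<rightarrow> carrier lca2_circle \<and>
     (\<forall>U\<in>subs G. \<exists>V\<in>subs G. \<forall>u\<in>U. \<forall>v\<in>V. h (u \<otimes>\<^bsub>G\<^esub> v) = h u) \<and>
     bicharacter G G (polarization G h) \<and>
     (\<forall>U\<in>subs G. \<forall>V\<in>subs G. V \<subseteq> U \<longrightarrow> (\<forall>u\<in>U. \<forall>v\<in>V. h (u \<otimes>\<^bsub>G\<^esub> v) = h u) \<longrightarrow>
        continuous_map (qtop G U V) circle_top (\<lambda>X. the_elem (h ` X)))"

text \<open>The map \<open>\<rho>\<close>, determined by \<open>h (x + y) h(x)\<^sup>-\<^sup>1 h(y)\<^sup>-\<^sup>1 = (x, y \<rho>)\<close>.\<close>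
definition quad_rho :: "'a lca2 \<Rightarrow> ('a \<Rightarrow> complex) \<Rightarrow> 'a \<Rightarrow> ('a \<Rightarrow> complex)" where
  "quad_rho G h y = (\<lambda>x\<in>carrier G. polarization G h x y)"

definition nondegenerate_quadratic_character :: "'a lca2 \<Rightarrow> ('a \<Rightarrow> complex) \<Rightarrow> bool" where
  "nondegenerate_quadratic_character G h \<longleftrightarrow>
     quadratic_character G h \<and> lca2_iso G (lca2_dual G) (quad_rho G h)"


section \<open>The Heisenberg group and its automorphisms\<close>

text \<open>The underlying LCA(2) group \<open>G \<times> G\<^sup>*\<close>.\<close>
abbreviation phase_space :: "'a lca2 \<Rightarrow> ('a \<times> ('a \<Rightarrow> complex)) lca2" where
  "phase_space G \<equiv> lca2_prod G (lca2_dual G)"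

definition heisenberg :: "'a lca2 \<Rightarrow> (('a \<times> ('a \<Rightarrow> complex)) \<times> complex) monoid" where
  "heisenberg G =
     \<lparr>carrier = carrier (phase_space G) \<times> carrier circle_group,
      mult = (\<lambda>(w1, t1) (w2, t2). (w1 \<otimes>\<^bsub>phase_space G\<^esub> w2, snd w2 (fst w1) * t1 * t2)),
      one = (\<one>\<^bsub>phase_space G\<^esub>, 1)\<rparr>"

text \<open>The map denoted \<open>(\<sigma>, f)\<close>.\<close>
definition heis_map ::
    "'a lca2 \<Rightarrow> ('a \<times> ('a \<Rightarrow> complex) \<Rightarrow> 'a \<times> ('a \<Rightarrow> complex)) \<Rightarrow>
     ('a \<times> ('a \<Rightarrow> complex) \<Rightarrow> complex) \<Rightarrow>
     ('a \<times> ('a \<Rightarrow> complex)) \<times> complex \<Rightarrow> ('a \<times> ('a \<Rightarrow> complex)) \<times> complex" where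
  "heis_map G \<sigma> f = (\<lambda>(w, t)\<in>carrier (heisenberg G). (\<sigma> w, f w * t))"

text \<open>Automorphisms act from the right: the product \<open>\<phi> \<psi>\<close> means first \<open>\<phi>\<close>, then \<open>\<psi>\<close>.\<close>
definition B0 ::
    "'a lca2 \<Rightarrow>
     (('a \<times> ('a \<Rightarrow> complex)) \<times> complex \<Rightarrow> ('a \<times> ('a \<Rightarrow> complex)) \<times> complex) monoid" where
  "B0 G =
     \<lparr>carrier = {\<phi> \<in> auto (heisenberg G).
        \<exists>\<sigma> f. lca2_iso (phase_space G) (phase_space G) \<sigma> \<and>
              quadratic_character (phase_space G) f \<and> \<phi> = heis_map G \<sigma> f},
      mult = (\<lambda>\<phi> \<psi>. compose (carrier (heisenberg G)) \<psi> \<phi>),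
      one = (\<lambda>z\<in>carrier (heisenberg G). z)\<rparr>"

text \<open>The matrix with rows \<open>\<alpha> \<beta>\<close> and \<open>\<gamma> \<delta>\<close>, acting on row vectors \<open>(x, \<xi>)\<close> from the right.\<close>
definition matrix_map ::
    "'a lca2 \<Rightarrow> ('a \<Rightarrow> 'a) \<Rightarrow> ('a \<Rightarrow> ('a \<Rightarrow> complex)) \<Rightarrow> (('a \<Rightarrow> complex) \<Rightarrow> 'a) \<Rightarrow>
     (('a \<Rightarrow> complex) \<Rightarrow> ('a \<Rightarrow> complex)) \<Rightarrow>
     'a \<times> ('a \<Rightarrow> complex) \<Rightarrow> 'a \<times> ('a \<Rightarrow> complex)" where
  "matrix_map G \<alpha> \<beta> \<gamma> \<delta> =
     (\<lambda>(x, \<xi>). (\<alpha> x \<otimes>\<^bsub>G\<^esub> \<gamma> \<xi>, \<beta> x \<otimes>\<^bsub>lca2_dual G\<^esub> \<delta> \<xi>))"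

definition t0 ::
    "'a lca2 \<Rightarrow> ('a \<Rightarrow> complex) \<Rightarrow>
     ('a \<times> ('a \<Rightarrow> complex)) \<times> complex \<Rightarrow> ('a \<times> ('a \<Rightarrow> complex)) \<times> complex" where
  "t0 G h =
     heis_map G
       (matrix_map G (\<lambda>x. x) (quad_rho G h) (\<lambda>\<xi>. \<one>\<^bsub>G\<^esub>) (\<lambda>\<xi>. \<xi>))
       (\<lambda>(x, \<xi>). h x)"

text \<open>The element \<open>d\<^sub>0'(\<rho>\<^sup>-\<^sup>1)\<close>: the matrix with rows \<open>0, -\<rho>\<close> and \<open>\<rho>\<^sup>-\<^sup>1, 0\<close>, and \<open>(x, \<xi>) \<mapsto> (x, -\<xi>)\<close>.\<close>
definition d0'_inv ::
    "'a lca2 \<Rightarrow> ('a \<Rightarrow> ('a \<Rightarrow> complex)) \<Rightarrow>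
     ('a \<times> ('a \<Rightarrow> complex)) \<times> complex \<Rightarrow> ('a \<times> ('a \<Rightarrow> complex)) \<times> complex" where
  "d0'_inv G \<rho> =
     heis_map G
       (matrix_map G (\<lambda>x. \<one>\<^bsub>G\<^esub>) (\<lambda>x. inv\<^bsub>lca2_dual G\<^esub> (\<rho> x))
          (inv_into (carrier G) \<rho>) (\<lambda>\<xi>. \<one>\<^bsub>lca2_dual G\<^esub>))
       (\<lambda>(x, \<xi>). (inv\<^bsub>lca2_dual G\<^esub> \<xi>) x)"


section \<open>The modular group\<close>

definition SL2Z :: "(int ^ 2 ^ 2) monoid" where
  "SL2Z = \<lparr>carrier = {A. det A = 1}, mult = (**), one = mat 1\<rparr>"


section \<open>The group law of \<open>B0\<close>\<close>

lemma B0_mult_heis_map: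
  assumes "\<sigma> \<in> carrier (phase_space G) \<rightarrow> carrier (phase_space G)"
    and "f \<in> carrier (phase_space G) \<rightarrow> carrier circle_group"
  shows "heis_map G \<sigma> f \<otimes>\<^bsub>B0 G\<^esub> heis_map G \<sigma>' f' =
    heis_map G (\<lambda>w. \<sigma>' (\<sigma> w)) (\<lambda>w. f w * f' (\<sigma> w))"
proof -
  have "(\<sigma> w, f w * t) \<in> carrier (heisenberg G)" if "(w, t) \<in> carrier (heisenberg G)" for w t
    using that assms by (auto simp: heisenberg_def circle_group_def norm_mult Pi_iff)
  then show ?thesis
    by (auto simp: B0_def heis_map_def compose_def restrict_def fun_eq_iff mult_ac)
qed


section \<open>Uniqueness of the product structure\<close>

lemma quotient_map_coset_topology:
  assumes "topspace T = carrier A"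
  shows "quotient_map T (coset_topology A T N) (\<lambda>x. N #>\<^bsub>A\<^esub> x)"
proof -
  have c: "carrier (A Mod N) = (\<lambda>x. N #>\<^bsub>A\<^esub> x) ` topspace T"
    using assms by (auto simp: FactGroup_def RCOSETS_def)
  have "openin (coset_topology A T N) (carrier (A Mod N))"
  proof -
    have "{x \<in> topspace T. N #>\<^bsub>A\<^esub> x \<in> carrier (A Mod N)} = topspace T" using c by auto
    then show ?thesis by (simp add: openin_coset_topology)
  qed
  then have "topspace (coset_topology A T N) = carrier (A Mod N)"
    by (metis openin_coset_topology openin_subset openin_topspace subset_antisym)
  then show ?thesis using c by (auto simp: quotient_map_def openin_coset_topology)
qed

lemma lca_exact_triple_quotient_map:
  assumes "lca_exact_triple A TA i B TB p C TC"
  shows "quotient_map TB TC p"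
proof -
  let ?N = "i ` carrier A"
  have B: "group B" "topspace TB = carrier B" and C: "group C"
    using assms by (auto simp: lca_exact_triple_def lca_group_def comm_group_def)
  have p: "p \<in> hom B C" and ker: "kernel B C p = ?N"
    and hm: "homeomorphic_map (coset_topology B TB ?N) TC (\<lambda>X. the_elem (p ` X))"
    using assms by (auto simp: lca_exact_triple_def)
  interpret group_hom B C p using B C p by (simp add: group_hom_def group_hom_axioms_def)
  have el: "the_elem (p ` (?N #>\<^bsub>B\<^esub> x)) = p x" if "x \<in> carrier B" for x
  proof -
    have "p ` (?N #>\<^bsub>B\<^esub> x) = {p x}"
    proof -
      have "\<one>\<^bsub>B\<^esub> \<in> ?N" using ker by (auto simp: kernel_def)
      moreover have "p (n \<otimes>\<^bsub>B\<^esub> x) = p x" if "n \<in> ?N" for n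
        using that \<open>x \<in> carrier B\<close> unfolding ker[symmetric] by (auto simp: kernel_def)
      ultimately have "p ` (?N #>\<^bsub>B\<^esub> x) = (\<Union>n\<in>?N. {p x})" "?N \<noteq> {}"
        unfolding r_coset_def image_UN by auto
      then show ?thesis by auto
    qed
    then show ?thesis by simp
  qed
  have "quotient_map TB TC ((\<lambda>X. the_elem (p ` X)) \<circ> (\<lambda>x. ?N #>\<^bsub>B\<^esub> x))"
    using quotient_map_compose quotient_map_coset_topology[OF B(2)] hm[unfolded homeomorphic_map_def, THEN conjunct1]
    by blast
  then show ?thesis by (rule quotient_map_eq) (simp add: el B)
qed

lemma prod_cosets:
  "(U \<times> V) #>\<^bsub>G \<times>\<times> H\<^esub> w = (U #>\<^bsub>G\<^esub> fst w) \<times> (V #>\<^bsub>H\<^esub> snd w)"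
  by (cases w) (fastforce simp: r_coset_def)

lemma is_lca2_prod_group:
  assumes "is_lca2_prod G H P"
  shows "group P" "W #>\<^bsub>P\<^esub> w = W #>\<^bsub>G \<times>\<times> H\<^esub> w" "subgroup W P \<longleftrightarrow> subgroup W (G \<times>\<times> H)"
    "subquot P W2 W1 = subquot (G \<times>\<times> H) W2 W1"
proof -
  have c: "carrier P = carrier (G \<times>\<times> H)" "mult P = mult (G \<times>\<times> H)" "one P = one (G \<times>\<times> H)"
    using assms unfolding is_lca2_prod_def by auto
  show "group P" using assms by (auto simp: is_lca2_prod_def lca2_group_def comm_group_def)
  show rc: "W #>\<^bsub>P\<^esub> w = W #>\<^bsub>G \<times>\<times> H\<^esub> w" for W w by (simp add: r_coset_def c)
  show "subgroup W P \<longleftrightarrow> subgroup W (G \<times>\<times> H)" using c by (simp add: subgroup_def m_inv_def)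
  have "W1 #>\<^bsub>P\<lparr>carrier := W2\<rparr>\<^esub> w = W1 #>\<^bsub>(G \<times>\<times> H)\<lparr>carrier := W2\<rparr>\<^esub> w" for w
    using c by (simp add: r_coset_def)
  then show "subquot P W2 W1 = subquot (G \<times>\<times> H) W2 W1"
    by (simp add: subquot_def FactGroup_def RCOSETS_def set_mult_def c fun_eq_iff)
qed

lemma carrier_subquot: "carrier (subquot G S2 S1) = (\<lambda>x. S1 #>\<^bsub>G\<^esub> x) ` S2"
  by (auto simp: subquot_def FactGroup_def RCOSETS_def r_coset_def)

lemma lca2_groupD:
  assumes "lca2_group G"
  shows "S \<in> subs G \<Longrightarrow> subgroup S G"
    and "\<lbrakk>S1 \<in> subs G; S2 \<in> subs G; S1 \<subseteq> S2\<rbrakk> \<Longrightarrow> lca_group (subquot G S2 S1) (qtop G S2 S1)"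
    and "\<lbrakk>S1 \<in> subs G; S2 \<in> subs G; S3 \<in> subs G; S1 \<subseteq> S2; S2 \<subseteq> S3\<rbrakk> \<Longrightarrow>
      lca_exact_triple (subquot G S2 S1) (qtop G S2 S1) (\<lambda>X. X)
        (subquot G S3 S1) (qtop G S3 S1) (\<lambda>X. S2 <#>\<^bsub>G\<^esub> X) (subquot G S3 S2) (qtop G S3 S2)"
    and "\<lbrakk>S1 \<in> subs G; S2 \<in> subs G; S1 \<subseteq> S2; subgroup K (subquot G S2 S1);
        closedin (qtop G S2 S1) K\<rbrakk> \<Longrightarrow> {x \<in> S2. S1 #>\<^bsub>G\<^esub> x \<in> K} \<in> subs G"
  using assms unfolding lca2_group_def by simp_all

lemma topspace_qtop:
  assumes "lca2_group G" "S1 \<in> subs G" "S2 \<in> subs G" "S1 \<subseteq> S2"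
  shows "topspace (qtop G S2 S1) = (\<lambda>x. S1 #>\<^bsub>G\<^esub> x) ` S2"
  using assms by (auto simp: lca2_group_def lca_group_def simp flip: carrier_subquot)

lemma subgroup_set_mult_coset:
  assumes "group G" "subgroup R G" "subgroup W G" "R \<subseteq> W" "w \<in> carrier G"
  shows "W <#>\<^bsub>G\<^esub> (R #>\<^bsub>G\<^esub> w) = W #>\<^bsub>G\<^esub> w"
proof -
  interpret group G by fact
  have "W <#>\<^bsub>G\<^esub> R = W"
  proof (intro equalityI subsetI)
    fix x assume "x \<in> W <#>\<^bsub>G\<^esub> R"
    then obtain a b where "a \<in> W" "b \<in> R" "x = a \<otimes>\<^bsub>G\<^esub> b" by (auto simp: set_mult_def)
    then show "x \<in> W" using assms(4) subgroup.m_closed[OF assms(3)] by blast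
  next
    fix x assume x: "x \<in> W"
    then have "x = x \<otimes>\<^bsub>G\<^esub> \<one>\<^bsub>G\<^esub>" using subgroup.mem_carrier[OF assms(3)] by simp
    then show "x \<in> W <#>\<^bsub>G\<^esub> R" using x subgroup.one_closed[OF assms(2)] unfolding set_mult_def by blast
  qed
  then show ?thesis
    using setmult_rcos_assoc[OF subgroup.subset[OF assms(3)] subgroup.subset[OF assms(2)] assms(5)] by simp
qed

lemma lca2_group_subquot_open:
  assumes P: "lca2_group P" "group P"
    and mem: "R1 \<in> subs P" "W1 \<in> subs P" "W2 \<in> subs P" "R2 \<in> subs P"
    and sub: "R1 \<subseteq> W1" "W1 \<subseteq> W2" "W2 \<subseteq> R2"
    and Q: "Q \<subseteq> carrier (subquot P W2 W1)"
  shows "openin (qtop P W2 W1) Q \<longleftrightarrow>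
    (\<exists>E. openin (qtop P R2 R1) E \<and> {w \<in> W2. W1 #>\<^bsub>P\<^esub> w \<in> Q} = {w \<in> W2. R1 #>\<^bsub>P\<^esub> w \<in> E})"
proof -
  have sg: "subgroup S P" if "S \<in> subs P" for S using that P by (auto simp: lca2_group_def)
  have ex: "lca_exact_triple (subquot P S2 S1) (qtop P S2 S1) (\<lambda>X. X)
      (subquot P S3 S1) (qtop P S3 S1) (\<lambda>X. S2 <#>\<^bsub>P\<^esub> X) (subquot P S3 S2) (qtop P S3 S2)"
    if "S1 \<in> subs P" "S2 \<in> subs P" "S3 \<in> subs P" "S1 \<subseteq> S2" "S2 \<subseteq> S3" for S1 S2 S3
    using that P by (simp add: lca2_group_def)
  have s12: "R1 \<subseteq> W2" using sub by auto
  let ?T = "qtop P W2 R1"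
  have tT: "topspace ?T = (\<lambda>x. R1 #>\<^bsub>P\<^esub> x) ` W2" using topspace_qtop P mem s12 by blast
  have tW: "topspace (qtop P W2 W1) = carrier (subquot P W2 W1)"
    using topspace_qtop[OF P(1) mem(2,3) sub(2)] by (simp add: carrier_subquot)
  have pr: "W1 <#>\<^bsub>P\<^esub> (R1 #>\<^bsub>P\<^esub> w) = W1 #>\<^bsub>P\<^esub> w" if "w \<in> W2" for w
    using subgroup_set_mult_coset[OF P(2) sg sg sub(1)] mem that sg[OF mem(3)] subgroup.subset by blast
  have "quotient_map ?T (qtop P W2 W1) (\<lambda>X. W1 <#>\<^bsub>P\<^esub> X)"
    using lca_exact_triple_quotient_map[OF ex[OF mem(1-3) sub(1,2)]] .
  then have 1: "openin (qtop P W2 W1) Q \<longleftrightarrow> openin ?T {X \<in> topspace ?T. W1 <#>\<^bsub>P\<^esub> X \<in> Q}"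
    using Q tW by (simp add: quotient_map_def)
  have "embedding_map ?T (qtop P R2 R1) (\<lambda>X. X)"
    using ex[OF mem(1,3,4) s12 sub(3)] by (simp add: lca_exact_triple_def)
  then have "homeomorphic_map ?T (subtopology (qtop P R2 R1) (topspace ?T)) (\<lambda>X. X)"
    by (simp add: embedding_map_def)
  then have 2: "openin ?T E \<longleftrightarrow> openin (subtopology (qtop P R2 R1) (topspace ?T)) E" for E
    using homeomorphic_map_id[of ?T "subtopology (qtop P R2 R1) (topspace ?T)"] by (simp add: id_def)
  have 3: "{X \<in> topspace ?T. W1 <#>\<^bsub>P\<^esub> X \<in> Q} = E \<inter> topspace ?T \<longleftrightarrow>
      {w \<in> W2. W1 #>\<^bsub>P\<^esub> w \<in> Q} = {w \<in> W2. R1 #>\<^bsub>P\<^esub> w \<in> E}" for E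
  proof -
    have "{X \<in> topspace ?T. W1 <#>\<^bsub>P\<^esub> X \<in> Q} = E \<inter> topspace ?T \<longleftrightarrow>
        (\<forall>w\<in>W2. W1 <#>\<^bsub>P\<^esub> (R1 #>\<^bsub>P\<^esub> w) \<in> Q \<longleftrightarrow> R1 #>\<^bsub>P\<^esub> w \<in> E)"
      unfolding tT by blast
    then show ?thesis using pr by auto
  qed
  show ?thesis unfolding 1 2 openin_subtopology 3 by blast
qed

lemma is_lca2_prod_rectangle:
  assumes "lca2_group G" "lca2_group H" "is_lca2_prod G H P"
    and mem: "U1 \<in> subs G" "U2 \<in> subs G" "V1 \<in> subs H" "V2 \<in> subs H" "U1 \<subseteq> U2" "V1 \<subseteq> V2"
  shows "bij_betw (\<lambda>X. (fst ` X, snd ` X)) (topspace (qtop P (U2 \<times> V2) (U1 \<times> V1)))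
      (topspace (prod_topology (qtop G U2 U1) (qtop H V2 V1)))"
    and "E \<subseteq> topspace (qtop P (U2 \<times> V2) (U1 \<times> V1)) \<Longrightarrow>
      openin (qtop P (U2 \<times> V2) (U1 \<times> V1)) E \<longleftrightarrow>
      openin (prod_topology (qtop G U2 U1) (qtop H V2 V1)) ((\<lambda>X. (fst ` X, snd ` X)) ` E)"
    and "E \<subseteq> topspace (qtop P (U2 \<times> V2) (U1 \<times> V1)) \<Longrightarrow>
      closedin (qtop P (U2 \<times> V2) (U1 \<times> V1)) E \<longleftrightarrow>
      closedin (prod_topology (qtop G U2 U1) (qtop H V2 V1)) ((\<lambda>X. (fst ` X, snd ` X)) ` E)"
    and "fst ` ((U1 \<times> V1) #>\<^bsub>P\<^esub> w) = U1 #>\<^bsub>G\<^esub> fst w" "snd ` ((U1 \<times> V1) #>\<^bsub>P\<^esub> w) = V1 #>\<^bsub>H\<^esub> snd w"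
proof -
  have hm: "homeomorphic_map (qtop P (U2 \<times> V2) (U1 \<times> V1))
          (prod_topology (qtop G U2 U1) (qtop H V2 V1)) (\<lambda>X. (fst ` X, snd ` X))"
    using assms(3) mem unfolding is_lca2_prod_def by simp
  show "bij_betw (\<lambda>X. (fst ` X, snd ` X)) (topspace (qtop P (U2 \<times> V2) (U1 \<times> V1)))
      (topspace (prod_topology (qtop G U2 U1) (qtop H V2 V1)))"
    using hm unfolding homeomorphic_eq_everything_map bij_betw_def by (elim conjE, intro conjI)
  show "openin (qtop P (U2 \<times> V2) (U1 \<times> V1)) E \<longleftrightarrow>
      openin (prod_topology (qtop G U2 U1) (qtop H V2 V1)) ((\<lambda>X. (fst ` X, snd ` X)) ` E)"
    if "E \<subseteq> topspace (qtop P (U2 \<times> V2) (U1 \<times> V1))"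
    using homeomorphic_map_openness[OF hm that] by simp
  show "closedin (qtop P (U2 \<times> V2) (U1 \<times> V1)) E \<longleftrightarrow>
      closedin (prod_topology (qtop G U2 U1) (qtop H V2 V1)) ((\<lambda>X. (fst ` X, snd ` X)) ` E)"
    if "E \<subseteq> topspace (qtop P (U2 \<times> V2) (U1 \<times> V1))"
    using homeomorphic_map_closedness[OF hm that] by simp
  have "U1 #>\<^bsub>G\<^esub> x \<noteq> {}" "V1 #>\<^bsub>H\<^esub> y \<noteq> {}" for x y
    using assms(1,2) mem by (auto simp: lca2_group_def r_coset_def dest: subgroup.one_closed)
  then show "fst ` ((U1 \<times> V1) #>\<^bsub>P\<^esub> w) = U1 #>\<^bsub>G\<^esub> fst w" "snd ` ((U1 \<times> V1) #>\<^bsub>P\<^esub> w) = V1 #>\<^bsub>H\<^esub> snd w"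
    unfolding is_lca2_prod_group(2)[OF assms(3)] prod_cosets by auto
qed

theorem lca2_prod_unique:
  assumes G: "lca2_group G" and H: "lca2_group H" and P: "is_lca2_prod G H P"
  shows "subs P = subs (lca2_prod G H)"
    and "\<lbrakk>W1 \<in> subs P; W2 \<in> subs P; W1 \<subseteq> W2\<rbrakk> \<Longrightarrow> qtop P W2 W1 = qtop (lca2_prod G H) W2 W1"
proof -
  let ?c = "\<lambda>X. (fst ` X, snd ` X)"
  have P': "lca2_group P" "group P" using P is_lca2_prod_group by (auto simp: is_lca2_prod_def)
  note gr = is_lca2_prod_group[OF P]
  have ne: "U \<noteq> {}" if "U \<in> subs G" for U using that G by (auto simp: lca2_group_def dest: subgroup.one_closed)
  have ne': "U \<noteq> {}" if "U \<in> subs H" for U using that H by (auto simp: lca2_group_def dest: subgroup.one_closed)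
  have rect: "U \<times> V \<in> subs P" if "U \<in> subs G" "V \<in> subs H" for U V
    using that P by (simp add: is_lca2_prod_def)
  have sandwich: "\<exists>U1\<in>subs G. \<exists>U2\<in>subs G. \<exists>V1\<in>subs H. \<exists>V2\<in>subs H.
      U1 \<subseteq> U2 \<and> V1 \<subseteq> V2 \<and> U1 \<times> V1 \<subseteq> W1 \<and> W2 \<subseteq> U2 \<times> V2"
    if "W1 \<in> subs P" "W2 \<in> subs P" "W1 \<subseteq> W2" for W1 W2
  proof -
    have "\<exists>U\<in>subs G. \<exists>V\<in>subs H. U \<times> V \<subseteq> W1" "\<exists>U\<in>subs G. \<exists>V\<in>subs H. W2 \<subseteq> U \<times> V"
      using that(1,2) P unfolding is_lca2_prod_def by simp_all
    then obtain U1 V1 U2 V2 where *: "U1 \<in> subs G" "V1 \<in> subs H" "U1 \<times> V1 \<subseteq> W1"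
        "U2 \<in> subs G" "V2 \<in> subs H" "W2 \<subseteq> U2 \<times> V2"
      by blast
    then have "U1 \<times> V1 \<subseteq> U2 \<times> V2" using that by blast
    then have "U1 \<subseteq> U2" "V1 \<subseteq> V2" using ne[OF *(1)] ne'[OF *(2)] by (auto simp: times_subset_iff)
    then show ?thesis using * by blast
  qed
  have im: "?c ` ((\<lambda>x. (U1 \<times> V1) #>\<^bsub>P\<^esub> x) ` W) = (\<lambda>(x, y). (U1 #>\<^bsub>G\<^esub> x, V1 #>\<^bsub>H\<^esub> y)) ` W"
    if "U1 \<in> subs G" "V1 \<in> subs H" for U1 V1 W
    unfolding image_image using is_lca2_prod_rectangle(4,5)[OF G H P that(1) that(1) that(2) that(2)]
    by (auto simp: case_prod_unfold image_def)
  show "subs P = subs (lca2_prod G H)"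
  proof (intro equalityI subsetI)
    fix W assume W: "W \<in> subs P"
    then obtain U1 U2 V1 V2 where *: "U1\<in>subs G" "U2\<in>subs G" "V1\<in>subs H" "V2\<in>subs H"
      "U1 \<subseteq> U2" "V1 \<subseteq> V2" "U1 \<times> V1 \<subseteq> W" "W \<subseteq> U2 \<times> V2" using sandwich[OF W W] by blast
    have "closedin (qtop P (U2 \<times> V2) (U1 \<times> V1)) ((\<lambda>X. X) ` carrier (subquot P W (U1 \<times> V1)))"
      using lca2_groupD(3)[OF P'(1) rect[OF *(1,3)] W rect[OF *(2,4)] *(7,8)] by (simp add: lca_exact_triple_def)
    then have cl: "closedin (qtop P (U2 \<times> V2) (U1 \<times> V1)) ((\<lambda>x. (U1 \<times> V1) #>\<^bsub>P\<^esub> x) ` W)"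
      by (simp add: carrier_subquot)
    then have "closedin (prod_topology (qtop G U2 U1) (qtop H V2 V1))
             ((\<lambda>(x, y). (U1 #>\<^bsub>G\<^esub> x, V1 #>\<^bsub>H\<^esub> y)) ` W)"
      using is_lca2_prod_rectangle(3)[OF G H P *(1-6) closedin_subset[OF cl]] im[OF *(1,3)] by simp
    moreover have "subgroup W (G \<times>\<times> H)" using W P'(1) gr(3) by (auto simp: lca2_group_def)
    ultimately show "W \<in> subs (lca2_prod G H)" using * unfolding lca2_prod_def by simp blast
  next
    fix W assume W: "W \<in> subs (lca2_prod G H)"
    then obtain U1 U2 V1 V2 where *: "U1\<in>subs G" "U2\<in>subs G" "V1\<in>subs H" "V2\<in>subs H"
      "U1 \<subseteq> U2" "V1 \<subseteq> V2" and R: "U1 \<times> V1 \<subseteq> W" "W \<subseteq> U2 \<times> V2"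
      and cl: "closedin (prod_topology (qtop G U2 U1) (qtop H V2 V1))
             ((\<lambda>(x, y). (U1 #>\<^bsub>G\<^esub> x, V1 #>\<^bsub>H\<^esub> y)) ` W)"
      and sg: "subgroup W P" unfolding lca2_prod_def by (auto simp: gr)
    let ?R1 = "U1 \<times> V1" and ?R2 = "U2 \<times> V2"
    let ?K = "(\<lambda>x. ?R1 #>\<^bsub>P\<^esub> x) ` W"
    have R12: "?R1 \<subseteq> ?R2" using R by blast
    have rs: "?R1 \<in> subs P" "?R2 \<in> subs P" using rect * by auto
    then have sgR: "subgroup ?R1 P" "subgroup ?R2 P" using P'(1) by (auto simp: lca2_group_def)
    have "?K \<subseteq> topspace (qtop P ?R2 ?R1)" using topspace_qtop[OF P'(1) rs R12] R by auto
    then have clK: "closedin (qtop P ?R2 ?R1) ?K"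
      using is_lca2_prod_rectangle(3)[OF G H P *] cl im[OF *(1,3)] by simp
    have cg: "comm_group P" using P'(1) by (simp add: lca2_group_def)
    interpret P: comm_group P by fact
    have rc: "(?R1 #>\<^bsub>P\<^esub> x) <#>\<^bsub>P\<^esub> (?R1 #>\<^bsub>P\<^esub> y) = ?R1 #>\<^bsub>P\<^esub> (x \<otimes>\<^bsub>P\<^esub> y)"
      if "x \<in> carrier P" "y \<in> carrier P" for x y
      using normal.rcos_sum[OF P.subgroup_imp_normal[OF sgR(1)]] that by simp
    have gq: "group (subquot P ?R2 ?R1)"
      using lca2_groupD(2)[OF P'(1) rs R12] by (simp add: lca_group_def comm_group_def)
    have Wc: "W \<subseteq> carrier P" using sg subgroup.subset by blast
    have m: "mult (subquot P ?R2 ?R1) = (<#>\<^bsub>P\<^esub>)"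
      by (simp add: subquot_def FactGroup_def set_mult_def fun_eq_iff)
    have o1: "\<one>\<^bsub>subquot P ?R2 ?R1\<^esub> = ?R1" by (simp add: subquot_def FactGroup_def)
    have R1o: "?R1 #>\<^bsub>P\<^esub> \<one>\<^bsub>P\<^esub> = ?R1" using P.coset_mult_one[OF subgroup.subset[OF sgR(1)]] .
    have sgK: "subgroup ?K (subquot P ?R2 ?R1)"
    proof (rule group.subgroupI[OF gq])
      show "?K \<subseteq> carrier (subquot P ?R2 ?R1)" using R by (auto simp: carrier_subquot)
      show "?K \<noteq> {}" using sg subgroup.one_closed by blast
      show "a \<otimes>\<^bsub>subquot P ?R2 ?R1\<^esub> b \<in> ?K" if ab: "a \<in> ?K" "b \<in> ?K" for a b
      proof -
        obtain x y where xy: "x \<in> W" "y \<in> W" "a = ?R1 #>\<^bsub>P\<^esub> x" "b = ?R1 #>\<^bsub>P\<^esub> y" using ab by blast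
        then have "a \<otimes>\<^bsub>subquot P ?R2 ?R1\<^esub> b = ?R1 #>\<^bsub>P\<^esub> (x \<otimes>\<^bsub>P\<^esub> y)"
          unfolding m using rc[of x y] Wc by (simp add: subsetD)
        then show ?thesis using subgroup.m_closed[OF sg xy(1,2)] by blast
      qed
      show "inv\<^bsub>subquot P ?R2 ?R1\<^esub> a \<in> ?K" if a: "a \<in> ?K" for a
      proof -
        obtain x where x: "x \<in> W" "a = ?R1 #>\<^bsub>P\<^esub> x" using a by blast
        let ?b = "?R1 #>\<^bsub>P\<^esub> (inv\<^bsub>P\<^esub> x)"
        have ix: "inv\<^bsub>P\<^esub> x \<in> W" using subgroup.m_inv_closed[OF sg x(1)] .
        have "?b \<otimes>\<^bsub>subquot P ?R2 ?R1\<^esub> a = \<one>\<^bsub>subquot P ?R2 ?R1\<^esub>"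
          unfolding m o1 x(2) using rc x ix Wc R1o by (auto simp: subsetD)
        then have "inv\<^bsub>subquot P ?R2 ?R1\<^esub> a = ?b"
          by (rule group.inv_equality[OF gq]) (use x ix R in \<open>auto simp: carrier_subquot\<close>)
        then show ?thesis using ix by blast
      qed
    qed
    have "{x \<in> ?R2. ?R1 #>\<^bsub>P\<^esub> x \<in> ?K} = W"
    proof (intro equalityI subsetI)
      fix x assume "x \<in> {x \<in> ?R2. ?R1 #>\<^bsub>P\<^esub> x \<in> ?K}"
      then obtain w where w: "w \<in> W" "?R1 #>\<^bsub>P\<^esub> x = ?R1 #>\<^bsub>P\<^esub> w" "x \<in> ?R2" by blast
      then have "x \<in> ?R1 #>\<^bsub>P\<^esub> w"
        using P.rcos_self[OF _ sgR(1)] subgroup.subset[OF sgR(2)] by blast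
      then obtain r where "r \<in> ?R1" "x = r \<otimes>\<^bsub>P\<^esub> w" by (auto simp: r_coset_def)
      then show "x \<in> W" using R w subgroup.m_closed[OF sg] by blast
    qed (use R in auto)
    moreover have "{x \<in> ?R2. ?R1 #>\<^bsub>P\<^esub> x \<in> ?K} \<in> subs P"
      using lca2_groupD(4)[OF P'(1) rs R12 sgK clK] .
    ultimately show "W \<in> subs P" by simp
  qed
  show "qtop P W2 W1 = qtop (lca2_prod G H) W2 W1"
    if W: "W1 \<in> subs P" "W2 \<in> subs P" "W1 \<subseteq> W2"
  proof -
    let ?ok = "\<lambda>Q U1 U2 V1 V2. \<exists>E. openin (prod_topology (qtop G U2 U1) (qtop H V2 V1)) E \<and>
             {w \<in> W2. W1 #>\<^bsub>G \<times>\<times> H\<^esub> w \<in> Q} = {w \<in> W2. (U1 #>\<^bsub>G\<^esub> fst w, V1 #>\<^bsub>H\<^esub> snd w) \<in> E}"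
    have key: "openin (qtop P W2 W1) Q \<longleftrightarrow> ?ok Q U1 U2 V1 V2"
      if Q: "Q \<subseteq> carrier (subquot P W2 W1)" and *: "U1\<in>subs G" "U2\<in>subs G" "V1\<in>subs H" "V2\<in>subs H"
      "U1 \<subseteq> U2" "V1 \<subseteq> V2" "U1 \<times> V1 \<subseteq> W1" "W2 \<subseteq> U2 \<times> V2" for Q U1 U2 V1 V2
    proof -
      let ?T = "qtop P (U2 \<times> V2) (U1 \<times> V1)" and ?S = "prod_topology (qtop G U2 U1) (qtop H V2 V1)"
      note rf = is_lca2_prod_rectangle[OF G H P *(1-6)]
      have cw: "?c ((U1 \<times> V1) #>\<^bsub>P\<^esub> w) = (U1 #>\<^bsub>G\<^esub> fst w, V1 #>\<^bsub>H\<^esub> snd w)" for w using rf(4,5) by simp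
      have tT: "topspace ?T = (\<lambda>x. (U1 \<times> V1) #>\<^bsub>P\<^esub> x) ` (U2 \<times> V2)"
        using topspace_qtop[OF P'(1) rect[OF *(1,3)] rect[OF *(2,4)]] *(5,6) by blast
      have "(\<exists>E. openin ?T E \<and> {w \<in> W2. W1 #>\<^bsub>P\<^esub> w \<in> Q} = {w \<in> W2. (U1 \<times> V1) #>\<^bsub>P\<^esub> w \<in> E}) \<longleftrightarrow>
        (\<exists>E. openin ?S E \<and> {w \<in> W2. W1 #>\<^bsub>P\<^esub> w \<in> Q} = {w \<in> W2. ?c ((U1 \<times> V1) #>\<^bsub>P\<^esub> w) \<in> E})" (is "?l \<longleftrightarrow> ?r")
      proof
        assume ?l
        then obtain E where E: "openin ?T E" "{w \<in> W2. W1 #>\<^bsub>P\<^esub> w \<in> Q} = {w \<in> W2. (U1 \<times> V1) #>\<^bsub>P\<^esub> w \<in> E}" by blast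
        have Es: "E \<subseteq> topspace ?T" using E openin_subset by blast
        have "?c ((U1 \<times> V1) #>\<^bsub>P\<^esub> w) \<in> ?c ` E \<longleftrightarrow> (U1 \<times> V1) #>\<^bsub>P\<^esub> w \<in> E" if "w \<in> W2" for w
          by (rule inj_on_image_mem_iff[OF bij_betw_imp_inj_on[OF rf(1)] _ Es]) (use tT that *(8) in auto)
        then have "{w \<in> W2. W1 #>\<^bsub>P\<^esub> w \<in> Q} = {w \<in> W2. ?c ((U1 \<times> V1) #>\<^bsub>P\<^esub> w) \<in> ?c ` E}"
          unfolding E(2) by blast
        then show ?r using rf(2)[OF Es] E(1) by blast
      next
        assume ?r
        then obtain E where E: "openin ?S E" "{w \<in> W2. W1 #>\<^bsub>P\<^esub> w \<in> Q} = {w \<in> W2. ?c ((U1 \<times> V1) #>\<^bsub>P\<^esub> w) \<in> E}"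
          by (elim exE conjE) (rule that)
        let ?F = "{X \<in> topspace ?T. ?c X \<in> E}"
        have "E \<subseteq> ?c ` topspace ?T" using bij_betw_imp_surj_on[OF rf(1)] openin_subset[OF E(1)] by simp
        then have "?c ` ?F = E" by blast
        moreover have "?F \<subseteq> topspace ?T" by (rule Collect_restrict)
        ultimately have "openin ?T ?F" using rf(2)[of ?F] E(1) by simp
        moreover have "{w \<in> W2. ?c ((U1 \<times> V1) #>\<^bsub>P\<^esub> w) \<in> E} = {w \<in> W2. (U1 \<times> V1) #>\<^bsub>P\<^esub> w \<in> ?F}"
          using tT *(8) by auto
        ultimately show ?l using E(2) by (intro exI[of _ ?F] conjI) simp_all
      qed
      note eq = this[unfolded cw]
      show ?thesis
        using eq lca2_group_subquot_open[OF P' rect[OF *(1,3)] W(1,2) rect[OF *(2,4)] *(7) W(3) *(8) Q]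
        unfolding gr(2) by (rule trans[rotated])
    qed
    obtain U1 U2 V1 V2 where *: "U1\<in>subs G" "U2\<in>subs G" "V1\<in>subs H" "V2\<in>subs H"
      "U1 \<subseteq> U2" "V1 \<subseteq> V2" "U1 \<times> V1 \<subseteq> W1" "W2 \<subseteq> U2 \<times> V2" using sandwich[OF W] by blast
    have tq: "topspace (qtop P W2 W1) = carrier (subquot P W2 W1)"
      using topspace_qtop[OF P'(1) W] by (simp add: carrier_subquot)
    have "Q \<subseteq> carrier (subquot (G \<times>\<times> H) W2 W1) \<and>
          (\<exists>U1\<in>subs G. \<exists>U2\<in>subs G. \<exists>V1\<in>subs H. \<exists>V2\<in>subs H. \<exists>E.
             U1 \<subseteq> U2 \<and> V1 \<subseteq> V2 \<and> U1 \<times> V1 \<subseteq> W1 \<and> W2 \<subseteq> U2 \<times> V2 \<and>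
             openin (prod_topology (qtop G U2 U1) (qtop H V2 V1)) E \<and>
             {w \<in> W2. W1 #>\<^bsub>G \<times>\<times> H\<^esub> w \<in> Q} =
             {w \<in> W2. (U1 #>\<^bsub>G\<^esub> fst w, V1 #>\<^bsub>H\<^esub> snd w) \<in> E}) \<longleftrightarrow> openin (qtop P W2 W1) Q" (is "?L Q \<longleftrightarrow> _") for Q
    proof
      assume "?L Q"
      then show "openin (qtop P W2 W1) Q" using key unfolding gr(4) by blast
    next
      assume o: "openin (qtop P W2 W1) Q"
      then have Q: "Q \<subseteq> carrier (subquot P W2 W1)" using openin_subset tq by metis
      then have "?ok Q U1 U2 V1 V2" using key[OF Q *] o by blast
      then show "?L Q" using Q * unfolding gr(4) by blast
    qed
    then have "qtop (lca2_prod G H) W2 W1 = topology_generated_by {Q. openin (qtop P W2 W1) Q}"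
      by (simp add: lca2_prod_def)
    also have "\<dots> = qtop P W2 W1"
    proof -
      have "generate_topology_on {Q. openin (qtop P W2 W1) Q} Q \<longleftrightarrow> openin (qtop P W2 W1) Q" for Q
      proof
        assume "generate_topology_on {Q. openin (qtop P W2 W1) Q} Q"
        then show "openin (qtop P W2 W1) Q" by induction auto
      qed (auto intro: generate_topology_on.Basis)
      then show ?thesis by (simp add: topology_eq openin_topology_generated_by_iff)
    qed
    finally show ?thesis by simp
  qed
qed

end

theory Submission
  imports Defs
begin

text \<open>
  Identify \<open>G \<times> G\<^sup>*\<close> with \<open>G \<times> G\<close> by \<open>(x, \<xi>) \<mapsto> (x, y)\<close> with \<open>\<xi> = y \<rho>\<close>.  As \<open>h\<close> is even,
  \<open>h (n x) = h(x)^(n^2)\<close>, and therefore the functions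
  \<open>f_A (x, y) = h(x)^(a b) h(y)^(c d) (x, y \<rho>)^(b c)\<close>, for \<open>A\<close> with rows \<open>a b\<close> and \<open>c d\<close>, satisfy
  \<open>f_(A A') (w) = f_A (w) f_A' (w A)\<close> whenever the determinants are \<open>1\<close>.  So
  \<open>A \<mapsto> (A, f_A)\<close> is a homomorphism on all of \<open>SL\<^sub>2(\<int>)\<close>, without recourse to a presentation of
  this group, and it has the required values at the two given matrices.

  For the topologies, non-degeneracy makes the preimage \<open>L\<close> under \<open>\<rho>\<close> of each member of \<open>\<U>(G\<^sup>*)\<close> a
  member of \<open>\<U>(G)\<close>.  The squares \<open>L \<times> L \<rho>\<close> are cofinal in both directions in
  \<open>\<U>(G \<times> G\<^sup>*)\<close> and stable under \<open>SL\<^sub>2(\<int>)\<close>, so that every continuity statement reduces to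
  the continuity of addition and of \<open>h\<close> on subquotients of \<open>G\<close>.  In particular Pontryagin
  duality is not used.
\<close>

section \<open>Topologies on the members of an LCA(2) group\<close>

text \<open>In the coordinates \<open>(x, y)\<close> the factor \<open>F(w, w')\<close> is
  \<open>\<beta> x y'\<close>, where \<open>\<beta>\<close> is the polarization of \<open>h\<close>.
  For \<open>(A, f)\<close> to respect the Heisenberg product,
  \<open>f(w + w') / (f(w) f(w'))\<close> must be \<open>F(wA, w'A) / F(w, w')\<close>. Written
  additively, half of \<open>F(wA, wA) - F(w, w)\<close> is such an \<open>f\<close>, because
  \<open>det A = 1\<close> makes the required polarization symmetric. It satisfies the multiplier
  identity formally, being a difference \<open>q(wA) - q(w)\<close>, and it is half of
  \<open>a b x^2 + c d y^2 + 2 b c x y\<close> since \<open>a d - 1 = b c\<close>. The circle has no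
  canonical halves, but \<open>h(x)\<close> is half of \<open>\<beta> x x\<close> exactly when
  \<open>h\<close> is even, and the mixed term is visibly divisible by 2. This is the origin of the
  exponents \<open>a b\<close>, \<open>c d\<close>, \<open>b c\<close>; the identities themselves
  are then verified directly.

  On the topological side the obstacle is that the dual and the phase space are accessible only
  through their explicit definitions: lemmas assuming \<open>lca2_group\<close> are applied to
  \<open>G\<close> alone. Topologies of the dual are compared with those of \<open>G\<close> through
  \<open>\<rho>\<close> and its inverse, and those of the phase space are handled through their
  generators.\<close>

text \<open>
  The topology of \<open>S2 / S1\<close> pulled back to \<open>S2\<close>.  It is not Hausdorff, but it allows continuity
  to be discussed for functions of elements instead of cosets.
\<close>
definition gtop :: "'a lca2 \<Rightarrow> 'a set \<Rightarrow> 'a set \<Rightarrow> 'a topology" where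
  "gtop G S2 S1 = pullback_topology S2 (\<lambda>x. S1 #>\<^bsub>G\<^esub> x) (qtop G S2 S1)"

lemma topspace_gtop_subset: "topspace (gtop G S2 S1) \<subseteq> S2"
  by (auto simp: gtop_def topspace_pullback_topology)

lemma topspace_gtop:
  assumes "lca2_group G" "S1 \<in> subs G" "S2 \<in> subs G" "S1 \<subseteq> S2"
  shows "topspace (gtop G S2 S1) = S2"
  using topspace_qtop[OF assms] by (auto simp: gtop_def topspace_pullback_topology)

lemma continuous_map_gtop_coset:
  "continuous_map (gtop G S2 S1) (qtop G S2 S1) (\<lambda>x. S1 #>\<^bsub>G\<^esub> x)"
proof -
  have "continuous_map (gtop G S2 S1) (qtop G S2 S1) ((\<lambda>X. X) \<circ> (\<lambda>x. S1 #>\<^bsub>G\<^esub> x))"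
    unfolding gtop_def by (rule continuous_map_pullback) simp
  then show ?thesis by (simp add: o_def)
qed

lemma continuous_map_into_gtop:
  assumes "continuous_map T (qtop G S2 S1) (\<lambda>x. S1 #>\<^bsub>G\<^esub> f x)" "f ` topspace T \<subseteq> S2"
  shows "continuous_map T (gtop G S2 S1) f"
  unfolding gtop_def
  by (rule continuous_map_pullback') (use assms in \<open>auto simp: o_def\<close>)

text \<open>In \<open>lca2_mor\<close> the induced map on quotients multiplies the image of a coset
  by \<open>S'\<close>. That image may be only a part of a coset of \<open>S'\<close>; the
  multiplication fills it up.\<close>

lemma hom_image_coset:
  assumes "group G" "group H" "f \<in> hom G H" "subgroup S G" "subgroup S' H" "f ` S \<subseteq> S'"
    and "x \<in> carrier G"
  shows "S' <#>\<^bsub>H\<^esub> f ` (S #>\<^bsub>G\<^esub> x) = S' #>\<^bsub>H\<^esub> f x"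
proof -
  interpret H: group H by fact
  interpret S: subgroup S G by fact
  interpret S': subgroup S' H by fact
  have fx: "f y \<in> carrier H" if "y \<in> carrier G" for y using assms(3) that by (auto simp: hom_def)
  have hm: "f (s \<otimes>\<^bsub>G\<^esub> x) = f s \<otimes>\<^bsub>H\<^esub> f x" if "s \<in> S" for s
    using assms(3,7) that by (auto simp: hom_def)
  show ?thesis
  proof (intro equalityI subsetI)
    fix z assume "z \<in> S' <#>\<^bsub>H\<^esub> f ` (S #>\<^bsub>G\<^esub> x)"
    then obtain a s where "a \<in> S'" "s \<in> S" "z = a \<otimes>\<^bsub>H\<^esub> f (s \<otimes>\<^bsub>G\<^esub> x)"
      by (auto simp: set_mult_def r_coset_def)
    moreover have "f s \<in> S'" using \<open>s \<in> S\<close> assms(6) by auto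
    ultimately have "a \<otimes>\<^bsub>H\<^esub> f s \<in> S'" "z = (a \<otimes>\<^bsub>H\<^esub> f s) \<otimes>\<^bsub>H\<^esub> f x"
      using assms(7) by (auto simp: hm H.m_assoc fx)
    then show "z \<in> S' #>\<^bsub>H\<^esub> f x" by (auto simp: r_coset_def)
  next
    fix z assume "z \<in> S' #>\<^bsub>H\<^esub> f x"
    then obtain a where "a \<in> S'" "z = a \<otimes>\<^bsub>H\<^esub> f x" by (auto simp: r_coset_def)
    moreover have "x \<in> S #>\<^bsub>G\<^esub> x" using group.rcos_self[OF assms(1,7,4)] .
    ultimately show "z \<in> S' <#>\<^bsub>H\<^esub> f ` (S #>\<^bsub>G\<^esub> x)" by (auto simp: set_mult_def)
  qed
qed

text \<open>The subgroup conditions are separate hypotheses because the dual group and the circle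
  also occur as source or target, and there these conditions do not come from
  \<open>lca2_group\<close>.\<close>

lemma lca2_mor_continuous_gtop:
  assumes "lca2_mor G H f" "group G" "group H"
    and "S1 \<in> subs G" "S2 \<in> subs G" "S1' \<in> subs H" "S2' \<in> subs H" "S1 \<subseteq> S2" "S1' \<subseteq> S2'"
    and "f ` S1 \<subseteq> S1'" "f ` S2 \<subseteq> S2'"
    and "subgroup S1 G" "subgroup S2 G" "subgroup S1' H"
  shows "continuous_map (gtop G S2 S1) (gtop H S2' S1') f"
proof (rule continuous_map_into_gtop)
  have f: "f \<in> hom G H" using assms(1) by (simp add: lca2_mor_def)
  have "continuous_map (qtop G S2 S1) (qtop H S2' S1') (\<lambda>X. S1' <#>\<^bsub>H\<^esub> (f ` X))"
    using assms(1,4-11) unfolding lca2_mor_def by blast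
  then have "continuous_map (gtop G S2 S1) (qtop H S2' S1')
      ((\<lambda>X. S1' <#>\<^bsub>H\<^esub> (f ` X)) \<circ> (\<lambda>x. S1 #>\<^bsub>G\<^esub> x))"
    using continuous_map_gtop_coset continuous_map_compose by blast
  then show "continuous_map (gtop G S2 S1) (qtop H S2' S1') (\<lambda>x. S1' #>\<^bsub>H\<^esub> f x)"
  proof (rule continuous_map_eq)
    fix x assume "x \<in> topspace (gtop G S2 S1)"
    then have "x \<in> carrier G" using topspace_gtop_subset[of G S2 S1] assms(13) subgroup.subset by blast
    then show "((\<lambda>X. S1' <#>\<^bsub>H\<^esub> f ` X) \<circ> (#>\<^bsub>G\<^esub>) S1) x = S1' #>\<^bsub>H\<^esub> f x"
      using hom_image_coset[OF assms(2,3) f assms(12,14,10)] by simp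
  qed
  show "f ` topspace (gtop G S2 S1) \<subseteq> S2'" using topspace_gtop_subset[of G S2 S1] assms(11) by blast
qed

text \<open>Two exact triples are used in turn: the quotient map for \<open>L1\<close>,
  \<open>U1\<close>, \<open>L2\<close> enlarges the lower subgroup, and the embedding for
  \<open>U1\<close>, \<open>U2\<close>, \<open>L2\<close> shrinks the upper one.\<close>

lemma gtop_restrict:
  assumes G: "lca2_group G"
    and mem: "L1 \<in> subs G" "U1 \<in> subs G" "U2 \<in> subs G" "L2 \<in> subs G"
    and sub: "L1 \<subseteq> U1" "U1 \<subseteq> U2" "U2 \<subseteq> L2"
  shows "continuous_map (subtopology (gtop G L2 L1) U2) (gtop G U2 U1) (\<lambda>x. x)"
proof (rule continuous_map_into_gtop)
  have gr: "group G" and sg: "subgroup S G" if "S \<in> subs G" for S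
    using G lca2_groupD(1)[OF G that] by (auto simp: lca2_group_def comm_group_def)
  have "quotient_map (qtop G L2 L1) (qtop G L2 U1) (\<lambda>X. U1 <#>\<^bsub>G\<^esub> X)"
    using lca_exact_triple_quotient_map[OF lca2_groupD(3)[OF G mem(1,2,4)]] sub by blast
  then have "continuous_map (gtop G L2 L1) (qtop G L2 U1) ((\<lambda>X. U1 <#>\<^bsub>G\<^esub> X) \<circ> (\<lambda>x. L1 #>\<^bsub>G\<^esub> x))"
    using continuous_map_gtop_coset continuous_map_compose quotient_imp_continuous_map by blast
  then have "continuous_map (gtop G L2 L1) (qtop G L2 U1) (\<lambda>x. U1 #>\<^bsub>G\<^esub> x)"
  proof (rule continuous_map_eq)
    fix x assume "x \<in> topspace (gtop G L2 L1)"
    then have "x \<in> carrier G"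
      using topspace_gtop_subset[of G L2 L1] subgroup.subset[OF sg[OF mem(4)]] by blast
    then show "((<#>\<^bsub>G\<^esub>) U1 \<circ> (#>\<^bsub>G\<^esub>) L1) x = U1 #>\<^bsub>G\<^esub> x"
      using subgroup_set_mult_coset[OF gr[OF mem(1)] sg[OF mem(1)] sg[OF mem(2)] sub(1)] by simp
  qed
  then have 1: "continuous_map (subtopology (gtop G L2 L1) U2) (qtop G L2 U1) (\<lambda>x. U1 #>\<^bsub>G\<^esub> x)"
    by (rule continuous_map_from_subtopology)
  let ?T = "qtop G U2 U1"
  have tT: "topspace ?T = (\<lambda>x. U1 #>\<^bsub>G\<^esub> x) ` U2" using topspace_qtop G mem sub by blast
  have "embedding_map ?T (qtop G L2 U1) (\<lambda>X. X)"
    using lca2_groupD(3)[OF G mem(2-4) sub(2,3)] by (simp add: lca_exact_triple_def)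
  then have "homeomorphic_map ?T (subtopology (qtop G L2 U1) (topspace ?T)) (\<lambda>X. X)"
    by (simp add: embedding_map_def)
  then have 2: "?T = subtopology (qtop G L2 U1) (topspace ?T)"
    using homeomorphic_map_id[of ?T "subtopology (qtop G L2 U1) (topspace ?T)"] by (simp add: id_def)
  have "continuous_map (subtopology (gtop G L2 L1) U2) (subtopology (qtop G L2 U1) (topspace ?T)) (\<lambda>x. U1 #>\<^bsub>G\<^esub> x)"
    unfolding continuous_map_in_subtopology using 1 tT by auto
  then show "continuous_map (subtopology (gtop G L2 L1) U2) (qtop G U2 U1) (\<lambda>x. U1 #>\<^bsub>G\<^esub> x)"
    using 2 by simp
qed auto

lemma mult_subquot: "X \<otimes>\<^bsub>subquot G S2 S1\<^esub> Y = X <#>\<^bsub>G\<^esub> Y"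
  by (simp add: subquot_def FactGroup_def set_mult_def)

lemma coset_hom_subquot:
  assumes "comm_group G" "subgroup S1 G" "subgroup S2 G"
  shows "(\<lambda>x. S1 #>\<^bsub>G\<^esub> x) \<in> hom (G\<lparr>carrier := S2\<rparr>) (subquot G S2 S1)"
proof -
  interpret G: comm_group G by fact
  have "(S1 #>\<^bsub>G\<^esub> x) <#>\<^bsub>G\<^esub> (S1 #>\<^bsub>G\<^esub> y) = S1 #>\<^bsub>G\<^esub> (x \<otimes>\<^bsub>G\<^esub> y)"
    if "x \<in> carrier G" "y \<in> carrier G" for x y
    using normal.rcos_sum[OF G.subgroup_imp_normal[OF assms(2)] that] .
  then show ?thesis
    using subgroup.subset[OF assms(3)]
    by (auto simp: hom_def mult_subquot carrier_subquot subset_iff)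
qed

lemma gtop_mult:
  assumes G: "lca2_group G" and mem: "S1 \<in> subs G" "S2 \<in> subs G" "S1 \<subseteq> S2"
  shows "continuous_map (prod_topology (gtop G S2 S1) (gtop G S2 S1)) (gtop G S2 S1) (\<lambda>(x, y). x \<otimes>\<^bsub>G\<^esub> y)"
proof (rule continuous_map_into_gtop)
  have cg: "comm_group G" and sg: "subgroup S1 G" "subgroup S2 G"
    using G lca2_groupD(1)[OF G] mem by (auto simp: lca2_group_def)
  let ?q = "qtop G S2 S1" and ?g = "gtop G S2 S1" and ?c = "\<lambda>x. S1 #>\<^bsub>G\<^esub> x"
  have "continuous_map (prod_topology ?q ?q) ?q (\<lambda>(x, y). x \<otimes>\<^bsub>subquot G S2 S1\<^esub> y)"
    using lca2_groupD(2)[OF G mem] by (simp add: lca_group_def)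
  moreover have "continuous_map (prod_topology ?g ?g) (prod_topology ?q ?q) (\<lambda>(x, y). (?c x, ?c y))"
    by (simp add: continuous_map_prod_top continuous_map_gtop_coset)
  ultimately have "continuous_map (prod_topology ?g ?g) ?q
      ((\<lambda>(x, y). x \<otimes>\<^bsub>subquot G S2 S1\<^esub> y) \<circ> (\<lambda>(x, y). (?c x, ?c y)))"
    by (rule continuous_map_compose[rotated])
  then show "continuous_map (prod_topology ?g ?g) ?q (\<lambda>p. ?c (case p of (x, y) \<Rightarrow> x \<otimes>\<^bsub>G\<^esub> y))"
    by (rule continuous_map_eq)
       (use coset_hom_subquot[OF cg sg] topspace_gtop_subset[of G S2 S1] in \<open>auto simp: hom_def subset_iff\<close>)
  show "(\<lambda>(x, y). x \<otimes>\<^bsub>G\<^esub> y) ` topspace (prod_topology ?g ?g) \<subseteq> S2"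
    using topspace_gtop_subset[of G S2 S1] subgroup.m_closed[OF sg(2)] by auto
qed

lemma gtop_inv:
  assumes G: "lca2_group G" and mem: "S1 \<in> subs G" "S2 \<in> subs G" "S1 \<subseteq> S2"
  shows "continuous_map (gtop G S2 S1) (gtop G S2 S1) (\<lambda>x. inv\<^bsub>G\<^esub> x)"
proof (rule continuous_map_into_gtop)
  have cg: "comm_group G" "group G" and sg: "subgroup S1 G" "subgroup S2 G"
    using G lca2_groupD(1)[OF G] mem by (auto simp: lca2_group_def comm_group_def)
  let ?q = "qtop G S2 S1" and ?g = "gtop G S2 S1" and ?c = "\<lambda>x. S1 #>\<^bsub>G\<^esub> x"
  have q: "continuous_map ?q ?q (\<lambda>x. inv\<^bsub>subquot G S2 S1\<^esub> x)" "group (subquot G S2 S1)"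
    using lca2_groupD(2)[OF G mem] by (simp_all add: lca_group_def comm_group_def)
  interpret group_hom "G\<lparr>carrier := S2\<rparr>" "subquot G S2 S1" ?c
    using coset_hom_subquot[OF cg(1) sg] q(2) subgroup.subgroup_is_group[OF sg(2) cg(2)]
    by (simp add: group_hom_def group_hom_axioms_def)
  have "continuous_map ?g ?q ((\<lambda>x. inv\<^bsub>subquot G S2 S1\<^esub> x) \<circ> ?c)"
    using q continuous_map_gtop_coset continuous_map_compose by blast
  then show "continuous_map ?g ?q (\<lambda>x. ?c (inv\<^bsub>G\<^esub> x))"
  proof (rule continuous_map_eq)
    fix x assume "x \<in> topspace ?g"
    then have x: "x \<in> S2" using topspace_gtop_subset[of G S2 S1] by blast
    then show "((\<lambda>x. inv\<^bsub>subquot G S2 S1\<^esub> x) \<circ> ?c) x = ?c (inv\<^bsub>G\<^esub> x)"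
      using hom_inv[of x] group.m_inv_consistent[OF cg(2) sg(2) x] by simp
  qed
  show "(\<lambda>x. inv\<^bsub>G\<^esub> x) ` topspace ?g \<subseteq> S2"
    using topspace_gtop_subset[of G S2 S1] subgroup.m_inv_closed[OF sg(2)] by auto
qed

lemma gtop_int_pow:
  assumes G: "lca2_group G" and mem: "S1 \<in> subs G" "S2 \<in> subs G" "S1 \<subseteq> S2"
  shows "continuous_map (gtop G S2 S1) (gtop G S2 S1) (\<lambda>x. x [^]\<^bsub>G\<^esub> (n::int))"
proof -
  let ?g = "gtop G S2 S1"
  have one: "\<one>\<^bsub>G\<^esub> \<in> S2" using lca2_groupD(1)[OF G mem(2)] by (rule subgroup.one_closed)
  have nat: "continuous_map ?g ?g (\<lambda>x. x [^]\<^bsub>G\<^esub> (k::nat))" for k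
  proof (induction k)
    case 0
    then show ?case using one topspace_gtop[OF G mem] by simp
  next
    case (Suc k)
    have "continuous_map ?g ?g ((\<lambda>(x, y). x \<otimes>\<^bsub>G\<^esub> y) \<circ> (\<lambda>x. (x [^]\<^bsub>G\<^esub> k, x)))"
      using Suc gtop_mult[OF G mem] by (intro continuous_map_compose[of _ "prod_topology ?g ?g"] continuous_map_pairedI) auto
    then show ?case by (simp add: o_def)
  qed
  show ?thesis
  proof (cases "n < 0")
    case True
    then have eq: "x [^]\<^bsub>G\<^esub> n = inv\<^bsub>G\<^esub> (x [^]\<^bsub>G\<^esub> nat (- n))" for x
      using int_pow_def2[of G x n] by metis
    have "continuous_map ?g ?g ((\<lambda>x. inv\<^bsub>G\<^esub> x) \<circ> (\<lambda>x. x [^]\<^bsub>G\<^esub> nat (- n)))"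
      by (rule continuous_map_compose[OF nat gtop_inv[OF G mem]])
    then show ?thesis unfolding eq comp_def .
  next
    case False
    then have eq: "x [^]\<^bsub>G\<^esub> n = x [^]\<^bsub>G\<^esub> nat n" for x
      using int_pow_def2[of G x n] by metis
    show ?thesis unfolding eq by (rule nat)
  qed
qed

text \<open>Turns an open set of pairs of elements into the preimage of an open set of pairs of
  cosets, the form in which the product structure asks for it.\<close>

lemma continuous_map_prod_pullback:
  "continuous_map (pullback_topology (A \<times> B) (\<lambda>(x, y). (f x, g y)) (prod_topology S T))
     (prod_topology (pullback_topology A f S) (pullback_topology B g T)) (\<lambda>p. p)"
proof -
  let ?P = "pullback_topology (A \<times> B) (\<lambda>(x, y). (f x, g y)) (prod_topology S T)"
  have "continuous_map ?P S (fst \<circ> (\<lambda>(x, y). (f x, g y)))" "continuous_map ?P T (snd \<circ> (\<lambda>(x, y). (f x, g y)))"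
    by (intro continuous_map_pullback continuous_map_fst continuous_map_snd)+
  then have "continuous_map ?P (pullback_topology A f S) fst" "continuous_map ?P (pullback_topology B g T) snd"
    by (intro continuous_map_pullback'; force simp: topspace_pullback_topology o_def case_prod_unfold)+
  then show ?thesis by (simp add: continuous_map_pairwise o_def)
qed

text \<open>A subgroup containing \<open>S1\<close> is the full preimage of its image in
  \<open>S2 / S1\<close>, so the axiom on preimages of closed subgroups applies to it.\<close>

lemma subs_member_if_closed:
  assumes G: "lca2_group G" and mem: "S1 \<in> subs G" "S2 \<in> subs G"
    and S: "subgroup S G" "S1 \<subseteq> S" "S \<subseteq> S2"
    and cl: "closedin (qtop G S2 S1) ((\<lambda>x. S1 #>\<^bsub>G\<^esub> x) ` S)"
  shows "S \<in> subs G"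
proof -
  let ?c = "\<lambda>x. S1 #>\<^bsub>G\<^esub> x"
  have sub: "S1 \<subseteq> S2" using S by blast
  have cg: "comm_group G" "group G" and sg: "subgroup S1 G" "subgroup S2 G"
    using G lca2_groupD(1)[OF G] mem by (auto simp: lca2_group_def comm_group_def)
  have "group (subquot G S2 S1)"
    using lca2_groupD(2)[OF G mem sub] by (simp add: lca_group_def comm_group_def)
  then interpret group_hom "G\<lparr>carrier := S2\<rparr>" "subquot G S2 S1" ?c
    using coset_hom_subquot[OF cg(1) sg] subgroup.subgroup_is_group[OF sg(2) cg(2)]
    by (simp add: group_hom_def group_hom_axioms_def)
  have "subgroup S (G\<lparr>carrier := S2\<rparr>)" using group.subgroup_incl[OF cg(2) S(1) sg(2) S(3)] .
  then have "subgroup (?c ` S) (subquot G S2 S1)" by (rule subgroup_img_is_subgroup)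
  then have "{x \<in> S2. ?c x \<in> ?c ` S} \<in> subs G"
    using lca2_groupD(4)[OF G mem sub _ cl] by blast
  moreover have "{x \<in> S2. ?c x \<in> ?c ` S} = S"
  proof (intro equalityI subsetI)
    fix x assume "x \<in> {x \<in> S2. ?c x \<in> ?c ` S}"
    then obtain s where s: "s \<in> S" "?c x = ?c s" "x \<in> S2" by blast
    then have "x \<in> ?c s" using group.rcos_self[OF cg(2) _ sg(1)] subgroup.subset[OF sg(2)] by blast
    then obtain r where "r \<in> S1" "x = r \<otimes>\<^bsub>G\<^esub> s" by (auto simp: r_coset_def)
    then show "x \<in> S" using S(2) s(1) subgroup.m_closed[OF S(1)] by blast
  qed (use S in auto)
  ultimately show ?thesis by simp
qed

section \<open>The action of the modular group\<close>

lemma cis_Arg_unit: "norm z = 1 \<Longrightarrow> z = cis (Arg z)"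
  by (metis cis_Arg norm_zero sgn_div_norm div_by_1 inverse_1 scaleR_one zero_neq_one)

lemma (in group) int_pow_character:
  fixes k :: "'a \<Rightarrow> complex"
  assumes "\<And>x y. x \<in> carrier G \<Longrightarrow> y \<in> carrier G \<Longrightarrow> k (x \<otimes> y) = k x * k y"
    and "\<And>x. x \<in> carrier G \<Longrightarrow> k x \<noteq> 0" and x: "x \<in> carrier G"
  shows "k (x [^] (n::int)) = k x powi n"
proof -
  have "k \<one> * k \<one> = k \<one>" "k \<one> \<noteq> 0" using assms(1)[of \<one> \<one>] assms(2)[of \<one>] by auto
  then have one: "k \<one> = 1" by simp
  have nat: "k (x [^] (m::nat)) = k x ^ m" for m
    by (induction m) (simp_all add: one assms x)
  show ?thesis
  proof (cases n rule: int_cases2)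
    case (nonneg m)
    then show ?thesis using nat by (simp add: int_pow_int)
  next
    case (nonpos m)
    have "k (inv (x [^] m)) * k (x [^] m) = 1"
      using assms(1)[of "inv (x [^] m)" "x [^] m"] one x by simp
    then have "k (inv (x [^] m)) = inverse (k (x [^] m))"
      by (metis inverse_unique mult.commute)
    then show ?thesis using nonpos nat x by (simp add: int_pow_neg int_pow_int power_int_minus)
  qed
qed

lemma SL2_inverse:
  fixes A :: "int ^ 2 ^ 2"
  assumes "det A = 1"
  obtains B where "A ** B = mat 1" "B ** A = mat 1" "det B = 1"
proof
  let ?B = "vector [vector [A$2$2, - (A$1$2)], vector [- (A$2$1), A$1$1]] :: int ^ 2 ^ 2"
  have d: "A$1$1 * A$2$2 - A$1$2 * A$2$1 = 1" using assms by (simp add: det_2)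
  show "A ** ?B = mat 1" "?B ** A = mat 1" "det ?B = 1"
    using d by (simp_all add: vec_eq_iff forall_2 matrix_matrix_mult_def sum_2 mat_def det_2 algebra_simps)
qed

lemma circle_simps [simp]:
  "carrier lca2_circle = sphere 0 1" "mult lca2_circle = (*)" "one lca2_circle = 1"
  "carrier circle_group = sphere 0 1" "mult circle_group = (*)" "one circle_group = 1"
  by (simp_all add: lca2_circle_def lca2_of_lca_def circle_group_def)

section \<open>Calculus of an even quadratic character and its polarization\<close>

locale even_quadratic = comm_group G for G :: "'a lca2" (structure) +
  fixes h :: "'a \<Rightarrow> complex"
  assumes G: "lca2_group G"
    and nondeg: "nondegenerate_quadratic_character G h"
    and even: "\<And>x. x \<in> carrier G \<Longrightarrow> h x = h (inv x)"
begin

abbreviation \<beta> :: "'a \<Rightarrow> 'a \<Rightarrow> complex" where "\<beta> \<equiv> polarization G h"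

lemma quad: "quadratic_character G h"
  using nondeg by (simp add: nondegenerate_quadratic_character_def)

lemma norm_h: "x \<in> carrier G \<Longrightarrow> norm (h x) = 1"
  using quad by (auto simp: quadratic_character_def)

lemma h_nonzero: "x \<in> carrier G \<Longrightarrow> h x \<noteq> 0"
  using norm_h by fastforce

lemma h_mult: "x \<in> carrier G \<Longrightarrow> y \<in> carrier G \<Longrightarrow> h (x \<otimes> y) = h x * h y * \<beta> x y"
  using h_nonzero[of x] h_nonzero[of y] by (simp add: polarization_def field_simps)

lemma \<beta>_bicharacter: "bicharacter G G \<beta>"
  using quad by (simp add: quadratic_character_def)

lemma \<beta>_mor: "y \<in> carrier G \<Longrightarrow> lca2_mor G lca2_circle (\<lambda>x. \<beta> x y)"
    "x \<in> carrier G \<Longrightarrow> lca2_mor G lca2_circle (\<lambda>y. \<beta> x y)"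
  using \<beta>_bicharacter by (simp_all add: bicharacter_def)

lemma \<beta>_norm: "x \<in> carrier G \<Longrightarrow> y \<in> carrier G \<Longrightarrow> norm (\<beta> x y) = 1"
  using \<beta>_mor(1)[of y] by (auto simp: lca2_mor_def hom_def)

lemma \<beta>_nonzero: "x \<in> carrier G \<Longrightarrow> y \<in> carrier G \<Longrightarrow> \<beta> x y \<noteq> 0"
  using \<beta>_norm by fastforce

lemma \<beta>_mult_left: "x \<in> carrier G \<Longrightarrow> x' \<in> carrier G \<Longrightarrow> y \<in> carrier G \<Longrightarrow> \<beta> (x \<otimes> x') y = \<beta> x y * \<beta> x' y"
  using \<beta>_mor(1)[of y] by (auto simp: lca2_mor_def hom_def)

lemma \<beta>_mult_right: "x \<in> carrier G \<Longrightarrow> y \<in> carrier G \<Longrightarrow> y' \<in> carrier G \<Longrightarrow> \<beta> x (y \<otimes> y') = \<beta> x y * \<beta> x y'"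
  using \<beta>_mor(2)[of x] by (auto simp: lca2_mor_def hom_def)

lemma \<beta>_sym: "x \<in> carrier G \<Longrightarrow> y \<in> carrier G \<Longrightarrow> \<beta> x y = \<beta> y x"
  by (simp add: polarization_def m_comm mult_ac)

lemma \<beta>_int_pow_left: "x \<in> carrier G \<Longrightarrow> y \<in> carrier G \<Longrightarrow> \<beta> (x [^] (n::int)) y = \<beta> x y powi n"
  by (rule int_pow_character) (simp_all add: \<beta>_mult_left \<beta>_nonzero)

lemma \<beta>_int_pow_right: "x \<in> carrier G \<Longrightarrow> y \<in> carrier G \<Longrightarrow> \<beta> x (y [^] (n::int)) = \<beta> x y powi n"
  by (rule int_pow_character) (simp_all add: \<beta>_mult_right \<beta>_nonzero)

lemma \<beta>_one: "x \<in> carrier G \<Longrightarrow> \<beta> x \<one> = 1" "x \<in> carrier G \<Longrightarrow> \<beta> \<one> x = 1"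
  using \<beta>_int_pow_right[of x \<one> 0] \<beta>_int_pow_left[of \<one> x 0] by simp_all

lemma h_one: "h \<one> = 1"
  using h_mult[of \<one> \<one>] h_nonzero[of \<one>] \<beta>_one[of \<one>] by simp

text \<open>Expanding \<open>h\<close> at \<open>x - x = 0\<close> gives
  \<open>\<beta> x x = h x * h (inv x)\<close>, and evenness makes this a square.\<close>

lemma \<beta>_diag: assumes x: "x \<in> carrier G" shows "\<beta> x x = h x powi 2"
proof -
  have "1 = h x * h (inv x) * \<beta> x (inv x)" using h_mult[of x "inv x"] x h_one by simp
  also have "\<beta> x (inv x) = \<beta> x x powi (-1)" using \<beta>_int_pow_right[OF x x, of "-1"] x by (simp add: int_pow_neg)
  finally have "1 = h x * h x * inverse (\<beta> x x)" using even[OF x] by simp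
  then show ?thesis using \<beta>_nonzero[OF x x] by (simp add: field_simps power2_eq_square)
qed

lemma h_int_pow: assumes x: "x \<in> carrier G" shows "h (x [^] (n::int)) = h x powi (n * n)"
proof -
  have nat: "h (x [^] int k) = h x powi (int k * int k)" for k
  proof (induction k)
    case (Suc k)
    have "x [^] int (Suc k) = x [^] int k \<otimes> x" using x by (simp add: int_pow_mult add.commute m_comm)
    then have "h (x [^] int (Suc k)) = h x powi (int k * int k) * h x * \<beta> x x powi (int k)"
      using h_mult[of "x [^] int k" x] x Suc \<beta>_int_pow_left[OF x x] by simp
    \<comment> \<open>By \<open>\<beta>_diag\<close> the mixed term contributes the exponent
      \<open>2 k\<close>, so that the total is \<open>k^2 + 1 + 2 k = (k + 1)^2\<close>.\<close>
    also have "\<dots> = h x powi (int k * int k) * h x powi 1 * h x powi (2 * int k)"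
      by (simp only: \<beta>_diag[OF x] power_int_mult power_int_1_right)
    also have "\<dots> = h x powi (int k * int k + 1 + 2 * int k)"
      using h_nonzero[OF x] by (simp only: power_int_add simp_thms)
    also have "int k * int k + 1 + 2 * int k = int (Suc k) * int (Suc k)" by (simp add: algebra_simps)
    finally show ?case .
  qed (simp add: h_one)
  show ?thesis
  proof (cases n rule: int_cases2)
    case (nonpos k)
    then have "h (x [^] n) = h (x [^] int k)" using even[of "x [^] int k"] x by (simp add: int_pow_neg)
    then show ?thesis using nat nonpos by simp
  qed (use nat in simp)
qed

section \<open>The matrix action on pairs of elements and its multiplier\<close>

definition mat_act :: "int ^ 2 ^ 2 \<Rightarrow> 'a \<times> 'a \<Rightarrow> 'a \<times> 'a" where
  "mat_act A = (\<lambda>(x, y). (x [^] (A$1$1) \<otimes> y [^] (A$2$1), x [^] (A$1$2) \<otimes> y [^] (A$2$2)))"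

definition cocycle :: "int ^ 2 ^ 2 \<Rightarrow> 'a \<times> 'a \<Rightarrow> complex" where
  "cocycle A = (\<lambda>(x, y). h x powi (A$1$1 * A$1$2) * h y powi (A$2$1 * A$2$2) * \<beta> x y powi (A$1$2 * A$2$1))"

lemma mat_act_closed: "p \<in> carrier G \<times> carrier G \<Longrightarrow> mat_act A p \<in> carrier G \<times> carrier G"
  by (auto simp: mat_act_def)

lemma cocycle_norm: "p \<in> carrier G \<times> carrier G \<Longrightarrow> norm (cocycle A p) = 1"
  by (auto simp: cocycle_def norm_mult norm_power_int norm_h \<beta>_norm)

lemma mat_act_mult:
  assumes "x \<in> carrier G" "y \<in> carrier G" "x' \<in> carrier G" "y' \<in> carrier G"
  shows "mat_act A (x \<otimes> x', y \<otimes> y') =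
    (fst (mat_act A (x, y)) \<otimes> fst (mat_act A (x', y')), snd (mat_act A (x, y)) \<otimes> snd (mat_act A (x', y')))"
  using assms by (simp add: mat_act_def int_pow_distrib m_ac)

text \<open>Vectors are rows, so the matrix that acts first stands on the left, in agreement with
  the order of composition in \<open>B0\<close>.\<close>

lemma mat_act_comp:
  assumes "p \<in> carrier G \<times> carrier G"
  shows "mat_act B (mat_act A p) = mat_act (A ** B) p"
proof -
  have "(x [^] a \<otimes> y [^] c) [^] a' \<otimes> (x [^] b \<otimes> y [^] d) [^] c' =
      x [^] (a * a' + b * c') \<otimes> y [^] (c * a' + d * c')"
    if "x \<in> carrier G" "y \<in> carrier G" for x y and a b c d a' c' :: int
    using that by (simp add: int_pow_distrib int_pow_pow int_pow_mult m_ac)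
  then show ?thesis using assms by (auto simp: mat_act_def matrix_matrix_mult_def sum_2)
qed

lemma mat_act_one: "p \<in> carrier G \<times> carrier G \<Longrightarrow> mat_act (mat 1) p = p"
  by (auto simp: mat_act_def mat_def)

lemma cocycle_one: "cocycle (mat 1) p = 1"
  by (auto simp: cocycle_def mat_def case_prod_unfold)

lemma h_comb:
  assumes "x \<in> carrier G" "y \<in> carrier G"
  shows "h (x [^] (a::int) \<otimes> y [^] (c::int)) = h x powi (a * a) * h y powi (c * c) * \<beta> x y powi (a * c)"
  using assms
  by (simp add: h_mult h_int_pow \<beta>_int_pow_left \<beta>_int_pow_right flip: power_int_mult)

lemma \<beta>_comb:
  assumes "x \<in> carrier G" "y \<in> carrier G" "x' \<in> carrier G" "y' \<in> carrier G"
  shows "\<beta> (x [^] (a::int) \<otimes> y [^] (c::int)) (x' [^] (b::int) \<otimes> y' [^] (d::int)) =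
    \<beta> x x' powi (a * b) * \<beta> y x' powi (c * b) * (\<beta> x y' powi (a * d) * \<beta> y y' powi (c * d))"
  using assms
  by (simp add: \<beta>_mult_left \<beta>_mult_right \<beta>_int_pow_left \<beta>_int_pow_right power_int_mult_distrib flip: power_int_mult)

text \<open>All values lie on the circle. Written as \<open>cis\<close> of angles, both sides become
  integer combinations of the angles of \<open>h x\<close>, \<open>h y\<close> and
  \<open>\<beta> x y\<close>, and only coefficients have to be compared. The diagonal values of
  \<open>\<beta>\<close> are expressed by \<open>h\<close> through
  \<open>\<beta>_diag\<close>.\<close>

lemma cocycle_mult:
  assumes p: "p \<in> carrier G \<times> carrier G" and B: "det B = 1"
  shows "cocycle A p * cocycle B (mat_act A p) = cocycle (A ** B) p"
proof -
  obtain x y where xy: "p = (x, y)" "x \<in> carrier G" "y \<in> carrier G" using p by auto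
  obtain s t r where s: "h x = cis s" and t: "h y = cis t" and r: "\<beta> x y = cis r"
    using cis_Arg_unit norm_h \<beta>_norm xy by metis
  define a b c d a' b' c' d' where
    ABdefs: "a = A$1$1" "b = A$1$2" "c = A$2$1" "d = A$2$2" "a' = B$1$1" "b' = B$1$2" "c' = B$2$1" "d' = B$2$2"
  have det: "a' * d' = 1 + b' * c'" using B by (simp add: det_2 ABdefs algebra_simps)
  have "\<beta> y x = cis r" using r \<beta>_sym xy by simp
  note simps = s t r this \<beta>_diag[OF xy(2)] \<beta>_diag[OF xy(3)]
  \<comment> \<open>On the left are the exponents belonging to \<open>A ** B\<close>; on the right
    they are expanded by means of \<open>a' d' = 1 + b' c'\<close>, so that the exponents of
    \<open>A\<close> split off as the first summands.\<close>
  have E: "real_of_int ((a*a' + b*c') * (a*b' + b*d')) = real_of_int (a*b + a*a*a'*b' + b*b*c'*d' + 2*a*b*b'*c')"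
    "real_of_int ((c*a' + d*c') * (c*b' + d*d')) = real_of_int (c*d + c*c*a'*b' + d*d*c'*d' + 2*c*d*b'*c')"
    "real_of_int ((a*b' + b*d') * (c*a' + d*c')) = real_of_int (b*c + a*c*a'*b' + b*d*c'*d' + (a*d+b*c)*b'*c')"
    using det by (simp_all only: of_int_eq_iff, algebra+)
  have "cocycle A p * cocycle B (mat_act A p) =
      cis (real_of_int (a*b + a*a*a'*b' + b*b*c'*d' + 2*a*b*b'*c') * s
        + real_of_int (c*d + c*c*a'*b' + d*d*c'*d' + 2*c*d*b'*c') * t
        + real_of_int (b*c + a*c*a'*b' + b*d*c'*d' + (a*d+b*c)*b'*c') * r)"
    unfolding xy(1) cocycle_def mat_act_def case_prod_conv h_comb[OF xy(2,3)] \<beta>_comb[OF xy(2,3,2,3)] simps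
      cis_power_int cis_mult power_int_mult_distrib ABdefs[symmetric]
    by (rule arg_cong[where f = cis]) (simp add: algebra_simps)
  also have "\<dots> = cocycle (A ** B) p"
    unfolding E[symmetric] xy(1) cocycle_def case_prod_conv simps cis_power_int cis_mult
      matrix_matrix_mult_def sum_2 vec_lambda_beta ABdefs[symmetric] ..
  finally show ?thesis .
qed

text \<open>This is the condition for \<open>(A, f_A)\<close> to respect the Heisenberg product. On
  the left the exponent of \<open>\<beta> x y'\<close> is \<open>1 + b c\<close>, on the right it is
  \<open>a d\<close>; the determinant makes them equal, and the other cross terms agree by symmetry
  of \<open>\<beta>\<close>.\<close>

lemma cocycle_polarization:
  assumes "x \<in> carrier G" "y \<in> carrier G" "x' \<in> carrier G" "y' \<in> carrier G" and A: "det A = 1"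
  shows "cocycle A (x \<otimes> x', y \<otimes> y') * \<beta> x y' =
    \<beta> (fst (mat_act A (x, y))) (snd (mat_act A (x', y'))) * cocycle A (x, y) * cocycle A (x', y')"
proof -
  obtain s t s' t' where s: "h x = cis s" "h y = cis t" "h x' = cis s'" "h y' = cis t'"
    using cis_Arg_unit norm_h assms by metis
  obtain q r u v w z where q: "\<beta> x y = cis q" "\<beta> x' y' = cis r" "\<beta> x x' = cis u" "\<beta> y y' = cis v" 
      "\<beta> x y' = cis w" "\<beta> y x' = cis z"
    using cis_Arg_unit \<beta>_norm assms by metis
  have z': "\<beta> x' y = cis z" using q \<beta>_sym assms by simp
  define a b c d where ABdefs: "a = A$1$1" "b = A$1$2" "c = A$2$1" "d = A$2$2"
  have "a * d = 1 + b * c" using A by (simp add: det_2 ABdefs algebra_simps)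
  then have det: "real_of_int (a * d) = 1 + real_of_int (b * c)" by simp
  show ?thesis
    unfolding cocycle_def mat_act_def case_prod_conv fst_conv snd_conv \<beta>_comb[OF assms(1-4)] h_mult[OF assms(1,3)] h_mult[OF assms(2,4)]
      \<beta>_mult_left[OF assms(1,3) m_closed[OF assms(2,4)]] \<beta>_mult_right[OF assms(1,2,4)] \<beta>_mult_right[OF assms(3,2,4)]
      s q z' cis_power_int cis_mult power_int_mult_distrib ABdefs[symmetric] det
    by (rule arg_cong[where f = cis]) (simp add: algebra_simps)
qed

end

section \<open>Transfer of the dual group to the original group\<close>

text \<open>Open sets of a pullback topology are saturated, hence so is \<open>C\<close>, and the
  image of \<open>C\<close> is the complement of an open set of cosets.\<close>

lemma closedin_gtop_image:
  assumes G: "lca2_group G" and mem: "S1 \<in> subs G" "S2 \<in> subs G" "S1 \<subseteq> S2"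
    and C: "closedin (gtop G S2 S1) C"
  shows "closedin (qtop G S2 S1) ((\<lambda>x. S1 #>\<^bsub>G\<^esub> x) ` C)"
proof -
  let ?c = "\<lambda>x. S1 #>\<^bsub>G\<^esub> x" and ?q = "qtop G S2 S1"
  have ts: "topspace ?q = ?c ` S2" using topspace_qtop[OF G mem] .
  have C2: "C \<subseteq> S2" "openin (gtop G S2 S1) (S2 - C)"
    using C topspace_gtop[OF G mem] by (auto simp: closedin_def)
  then obtain U where U: "openin ?q U" "S2 - C = ?c -` U \<inter> S2"
    unfolding gtop_def openin_pullback_topology by blast
  have "?c ` C = topspace ?q - U"
  proof (intro equalityI subsetI)
    fix X assume "X \<in> ?c ` C"
    then obtain x where "x \<in> C" "X = ?c x" by blast
    then show "X \<in> topspace ?q - U" using C2(1) U(2) ts by blast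
  next
    fix X assume "X \<in> topspace ?q - U"
    then obtain x where "x \<in> S2" "X = ?c x" "X \<notin> U" using ts by blast
    then show "X \<in> ?c ` C" using U(2) by blast
  qed
  then show ?thesis using U(1) by auto
qed

section \<open>The circle as an LCA(2) group, and characters as continuous functions\<close>

lemma group_circle: "group circle_group" "group lca2_circle"
proof -
  show "group circle_group"
  proof (rule groupI)
    fix z assume z: "z \<in> carrier circle_group"
    then have "inverse z \<in> carrier circle_group" "inverse z * z = 1"
      using norm_zero by (auto simp: norm_inverse intro!: left_inverse)
    then show "\<exists>y\<in>carrier circle_group. y \<otimes>\<^bsub>circle_group\<^esub> z = \<one>\<^bsub>circle_group\<^esub>" by auto
  qed (auto simp: norm_mult)
  then show "group lca2_circle"
    unfolding lca2_circle_def lca2_of_lca_def Group.group_def monoid_def group_axioms_def Units_def by auto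
qed

lemma topspace_circle_top [simp]: "topspace circle_top = sphere 0 1"
  by (simp add: circle_top_def)

lemma subs_circle: "{1} \<in> subs lca2_circle" "sphere 0 1 \<in> subs lca2_circle"
proof -
  interpret group circle_group by (rule group_circle)
  have "closedin circle_top {1}" by (simp add: circle_top_def closedin_closed_eq)
  then show "{1} \<in> subs lca2_circle"
    using triv_subgroup by (simp add: lca2_circle_def lca2_of_lca_def)
  show "sphere 0 1 \<in> subs lca2_circle"
    using subgroup_self closedin_topspace[of circle_top] by (simp add: lca2_circle_def lca2_of_lca_def)
qed

lemma subgroup_circle: "S \<in> subs lca2_circle \<Longrightarrow> subgroup S lca2_circle"
proof -
  assume "S \<in> subs lca2_circle"
  then have "subgroup S circle_group" by (simp add: lca2_circle_def lca2_of_lca_def)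
  moreover have "inv\<^bsub>lca2_circle\<^esub> x = inv\<^bsub>circle_group\<^esub> x" for x
    by (simp add: m_inv_def)
  ultimately show ?thesis by (simp add: subgroup_def)
qed

text \<open>Cosets of the trivial subgroup are single points, so passing to
  \<open>sphere 0 1\<close> modulo \<open>{1}\<close> loses nothing of the circle topology.\<close>

lemma continuous_map_gtop_circle:
  "continuous_map (gtop lca2_circle (sphere 0 1) {1}) circle_top (\<lambda>z. z)"
  unfolding continuous_map
proof (intro conjI allI impI)
  show "(\<lambda>z. z) ` topspace (gtop lca2_circle (sphere 0 1) {1}) \<subseteq> topspace circle_top"
    using topspace_gtop_subset by simp
  fix W assume W: "openin circle_top W"
  then have Ws: "W \<subseteq> sphere 0 1" using openin_subset by fastforce
  let ?A = "circle_group\<lparr>carrier := sphere 0 1\<rparr>"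
  have c: "{1} #>\<^bsub>?A\<^esub> z = {z}" "{1} #>\<^bsub>circle_group\<^esub> z = {z}" "{1} #>\<^bsub>lca2_circle\<^esub> z = {z}" for z by (simp_all add: r_coset_def)
  let ?U = "(\<lambda>z. {z}) ` W"
  have "?U \<subseteq> carrier (?A Mod {1})" using Ws c by (auto simp: FactGroup_def RCOSETS_def)
  moreover have "{x \<in> topspace (subtopology circle_top (sphere 0 1)). {1} #>\<^bsub>?A\<^esub> x \<in> ?U} = W"
    using Ws by (auto simp: c)
  moreover have "subtopology circle_top (sphere 0 1) = circle_top" by (simp add: circle_top_def subtopology_subtopology)
  ultimately have "openin (qtop lca2_circle (sphere 0 1) {1}) ?U"
    using W by (simp add: lca2_circle_def lca2_of_lca_def openin_coset_topology)
  moreover have "W = (\<lambda>x. {1} #>\<^bsub>lca2_circle\<^esub> x) -` ?U \<inter> sphere 0 1" using Ws by (auto simp: c)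
  ultimately have "openin (gtop lca2_circle (sphere 0 1) {1}) W"
    unfolding gtop_def openin_pullback_topology by blast
  moreover have "{x \<in> topspace (gtop lca2_circle (sphere 0 1) {1}). x \<in> W} = W"
    using openin_subset[OF calculation] by auto
  ultimately show "openin (gtop lca2_circle (sphere 0 1) {1}) {x \<in> topspace (gtop lca2_circle (sphere 0 1) {1}). x \<in> W}"
    by simp
qed

text \<open>Triviality on \<open>S1\<close> permits \<open>{1}\<close> as the lower subgroup of the
  circle. This yields continuity of the values of \<open>k\<close> themselves, not only of their
  classes modulo a closed subgroup.\<close>

lemma character_continuous_gtop:
  assumes "lca2_group G" "lca2_mor G lca2_circle k" "S1 \<in> subs G" "S2 \<in> subs G" "S1 \<subseteq> S2" "k ` S1 \<subseteq> {1}"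
  shows "continuous_map (gtop G S2 S1) circle_top k"
proof -
  have g: "group G" and sg: "subgroup S1 G" "subgroup S2 G"
    using assms lca2_groupD(1) by (auto simp: lca2_group_def comm_group_def)
  have "k ` S2 \<subseteq> sphere 0 1"
    using assms(2) subgroup.subset[OF sg(2)] by (auto simp: lca2_mor_def hom_def)
  then have "continuous_map (gtop G S2 S1) (gtop lca2_circle (sphere 0 1) {1}) k"
    using lca2_mor_continuous_gtop[OF assms(2) g group_circle(2) assms(3,4) subs_circle assms(5) _ assms(6) _ sg]
      subgroup_circle subs_circle by simp
  then show ?thesis
    using continuous_map_compose[OF _ continuous_map_gtop_circle] by (force simp: o_def)
qed

lemma lca2_dual_simps:
  "carrier (lca2_dual G) = characters G"
  "mult (lca2_dual G) = (\<lambda>k l. \<lambda>x\<in>carrier G. k x * l x)"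
  "one (lca2_dual G) = (\<lambda>x\<in>carrier G. 1)"
  "subs (lca2_dual G) = perp G ` subs G"
  by (simp_all add: lca2_dual_def dual_group_def)

context even_quadratic
begin

abbreviation H :: "('a \<Rightarrow> complex) lca2" where "H \<equiv> lca2_dual G"
abbreviation \<rho> :: "'a \<Rightarrow> 'a \<Rightarrow> complex" where "\<rho> \<equiv> quad_rho G h"
abbreviation g :: "('a \<Rightarrow> complex) \<Rightarrow> 'a" where "g \<equiv> inv_into (carrier G) \<rho>"

lemma subgroup_subs: "S \<in> subs G \<Longrightarrow> subgroup S G"
  using lca2_groupD(1)[OF G] .

lemma subs_subset: "S \<in> subs G \<Longrightarrow> S \<subseteq> carrier G"
  using subgroup.subset[OF subgroup_subs] .

lemma \<rho>_apply: "x \<in> carrier G \<Longrightarrow> \<rho> y x = \<beta> x y"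
  by (simp add: quad_rho_def)

lemma \<rho>_mor: "lca2_mor G H \<rho>"
  using nondeg by (simp add: nondegenerate_quadratic_character_def lca2_iso_def)

lemma \<rho>_hom: "\<rho> \<in> hom G H"
  using \<rho>_mor by (simp add: lca2_mor_def)

lemma \<rho>_closed: "x \<in> carrier G \<Longrightarrow> \<rho> x \<in> carrier H"
  using \<rho>_hom by (auto simp: hom_def)

lemma \<rho>_mult: "x \<in> carrier G \<Longrightarrow> y \<in> carrier G \<Longrightarrow> \<rho> (x \<otimes> y) = \<rho> x \<otimes>\<^bsub>H\<^esub> \<rho> y"
  using \<rho>_hom by (auto simp: hom_def)

lemma \<rho>_bij: "bij_betw \<rho> (carrier G) (carrier H)"
proof -
  obtain g' where g': "lca2_mor H G g'" "\<forall>x\<in>carrier G. g' (\<rho> x) = x" "\<forall>y\<in>carrier H. \<rho> (g' y) = y"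
    using nondeg by (auto simp: nondegenerate_quadratic_character_def lca2_iso_def)
  then show ?thesis
    by (intro bij_betw_byWitness[where f' = g']) (use \<rho>_closed in \<open>auto simp: lca2_mor_def hom_def\<close>)
qed

text \<open>The inverse supplied by \<open>lca2_iso\<close> is determined on the carrier only, while
  \<open>d0'_inv\<close> is built with \<open>inv_into\<close>; agreement on the carrier links the
  two.\<close>

lemma \<rho>_inverse_mor:
  "\<exists>g'. lca2_mor H G g' \<and> (\<forall>\<xi>\<in>carrier H. g' \<xi> = g \<xi>)"
proof -
  obtain g' where g': "lca2_mor H G g'" "\<forall>x\<in>carrier G. g' (\<rho> x) = x" "\<forall>y\<in>carrier H. \<rho> (g' y) = y"
    using nondeg by (auto simp: nondegenerate_quadratic_character_def lca2_iso_def)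
  have cl: "g' y \<in> carrier G" if "y \<in> carrier H" for y using g'(1) that by (auto simp: lca2_mor_def hom_def)
  have "g' \<xi> = g \<xi>" if "\<xi> \<in> carrier H" for \<xi>
    using inv_into_f_eq[OF bij_betw_imp_inj_on[OF \<rho>_bij] cl[OF that]] g'(3) that by simp
  then show ?thesis using g'(1) by blast
qed

lemma g_\<rho> [simp]: "x \<in> carrier G \<Longrightarrow> g (\<rho> x) = x"
  using bij_betw_inv_into_left[OF \<rho>_bij] .

lemma \<rho>_g [simp]: "\<xi> \<in> carrier H \<Longrightarrow> \<rho> (g \<xi>) = \<xi>"
  using bij_betw_inv_into_right[OF \<rho>_bij] .

lemma g_closed: "\<xi> \<in> carrier H \<Longrightarrow> g \<xi> \<in> carrier G"
  using bij_betw_inv_into[OF \<rho>_bij] bij_betwE by blast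

lemma \<rho>_one: "\<rho> \<one> = \<one>\<^bsub>H\<^esub>"
  by (auto simp: quad_rho_def lca2_dual_simps \<beta>_one)

text \<open>The group axioms are carried over from \<open>G\<close> along the bijective homomorphism
  \<open>\<rho>\<close>.\<close>

lemma group_H: "group H"
proof -
  have "\<rho> \<in> iso G H" using \<rho>_hom \<rho>_bij by (simp add: iso_def)
  then have "group (H\<lparr>one := \<rho> \<one>\<rparr>)" by (rule iso_imp_img_group)
  then show ?thesis by (simp add: \<rho>_one)
qed

sublocale \<rho>: group_hom G H \<rho>
  using group_H \<rho>_hom by (simp add: group_hom_def group_hom_axioms_def)

lemma subs_H_subset: "V \<in> subs H \<Longrightarrow> V \<subseteq> carrier H"
  by (auto simp: lca2_dual_simps perp_def)

lemma g_mult: "\<xi> \<in> carrier H \<Longrightarrow> \<eta> \<in> carrier H \<Longrightarrow> g (\<xi> \<otimes>\<^bsub>H\<^esub> \<eta>) = g \<xi> \<otimes> g \<eta>"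
  by (metis g_\<rho> \<rho>_g \<rho>_mult g_closed m_closed)

section \<open>Annihilators with respect to the polarization\<close>

lemma g_perp:
  assumes "S \<in> subs G"
  shows "g ` perp G S = {y \<in> carrier G. \<forall>s\<in>S. \<beta> s y = 1}"
proof (intro equalityI subsetI)
  fix y assume "y \<in> g ` perp G S"
  then obtain \<xi> where \<xi>: "\<xi> \<in> carrier H" "\<forall>s\<in>S. \<xi> s = 1" "y = g \<xi>"
    by (auto simp: perp_def lca2_dual_simps)
  have "\<beta> s y = 1" if "s \<in> S" for s
    using \<rho>_apply[of s y] subs_subset[OF assms] \<xi> that by auto
  then show "y \<in> {y \<in> carrier G. \<forall>s\<in>S. \<beta> s y = 1}" using g_closed \<xi> by blast
next
  fix y assume y: "y \<in> {y \<in> carrier G. \<forall>s\<in>S. \<beta> s y = 1}"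
  then have "\<rho> y \<in> perp G S"
    using \<rho>_closed[of y] subs_subset[OF assms] by (auto simp: perp_def lca2_dual_simps \<rho>_apply)
  then show "y \<in> g ` perp G S" using y by force
qed

lemma subgroup_annihilator:
  assumes "S \<subseteq> carrier G"
  shows "subgroup {y \<in> carrier G. \<forall>s\<in>S. \<beta> s y = 1} G"
proof (rule subgroupI)
  show "{y \<in> carrier G. \<forall>s\<in>S. \<beta> s y = 1} \<noteq> {}" using \<beta>_one(1) assms by blast
  fix a assume a: "a \<in> {y \<in> carrier G. \<forall>s\<in>S. \<beta> s y = 1}"
  have "\<beta> s (inv a) = 1" if "s \<in> S" for s
    using \<beta>_int_pow_right[of s a "-1"] a that assms by (auto simp: int_pow_neg)
  then show "inv a \<in> {y \<in> carrier G. \<forall>s\<in>S. \<beta> s y = 1}" using a by simp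
next
  fix a b assume "a \<in> {y \<in> carrier G. \<forall>s\<in>S. \<beta> s y = 1}" "b \<in> {y \<in> carrier G. \<forall>s\<in>S. \<beta> s y = 1}"
  then show "a \<otimes> b \<in> {y \<in> carrier G. \<forall>s\<in>S. \<beta> s y = 1}" using assms by (auto simp: \<beta>_mult_right subset_iff)
qed auto

text \<open>
  Non-degeneracy sandwiches \<open>S\<^sup>\<bottom>\<close>, seen in \<open>G\<close>, between two members, and \<open>S\<^sup>\<bottom>\<close> is
  cut out by continuous characters.
\<close>
lemma g_image_subs:
  assumes "V \<in> subs H"
  shows "g ` V \<in> subs G"
proof -
  obtain S where S: "S \<in> subs G" "V = perp G S" using assms by (auto simp: lca2_dual_simps)
  let ?A = "{y \<in> carrier G. \<forall>s\<in>S. \<beta> s y = 1}"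
  have A: "g ` V = ?A" using g_perp S by simp
  obtain g' where g': "lca2_mor H G g'" "\<forall>\<xi>\<in>carrier H. g' \<xi> = g \<xi>"
    using \<rho>_inverse_mor by blast
  obtain T where T: "T \<in> subs G" "g' ` V \<subseteq> T" using g'(1) assms by (auto simp: lca2_mor_def)
  then have AT: "?A \<subseteq> T" using g'(2) subs_H_subset[OF assms] unfolding A[symmetric] by (auto simp: subset_iff image_subset_iff)
  obtain T' where T': "T' \<in> subs G" "\<forall>s\<in>S. \<forall>v\<in>T'. \<beta> s v = 1"
    using \<beta>_bicharacter S(1) unfolding bicharacter_def by blast
  then have T'A: "T' \<subseteq> ?A" using subs_subset by blast
  have "closedin (gtop G T T') {y \<in> T. \<beta> s y = 1}" if "s \<in> S" for s
  proof -
    have "s \<in> carrier G" using subs_subset[OF S(1)] that by blast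
    then have "continuous_map (gtop G T T') circle_top (\<lambda>y. \<beta> s y)"
      using character_continuous_gtop[OF G \<beta>_mor(2) T'(1) T(1)] T'(2) that AT T'A by blast
    moreover have "closedin circle_top {1}" by (simp add: circle_top_def closedin_closed_eq)
    ultimately have "closedin (gtop G T T') {y \<in> topspace (gtop G T T'). \<beta> s y \<in> {1}}"
      by (rule closedin_continuous_map_preimage)
    then show ?thesis using topspace_gtop[OF G T'(1) T(1)] AT T'A by simp
  qed
  moreover have "\<one> \<in> S" using subgroup.one_closed[OF subgroup_subs[OF S(1)]] .
  ultimately have "closedin (gtop G T T') (\<Inter>s\<in>S. {y \<in> T. \<beta> s y = 1})" by blast
  also have "(\<Inter>s\<in>S. {y \<in> T. \<beta> s y = 1}) = ?A"
    using AT subs_subset[OF T(1)] \<open>\<one> \<in> S\<close> by blast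
  finally have "closedin (qtop G T T') ((\<lambda>x. T' #> x) ` ?A)"
    using closedin_gtop_image[OF G T'(1) T(1)] AT T'A by blast
  then show ?thesis
    unfolding A
    using subs_member_if_closed[OF G T'(1) T(1) subgroup_annihilator T'A AT] subs_subset[OF S(1)] by blast
qed

lemma \<rho>_g_image [simp]: "V \<in> subs H \<Longrightarrow> \<rho> ` g ` V = V"
  using subs_H_subset by (force simp: image_image)

lemma subgroup_subs_H: "V \<in> subs H \<Longrightarrow> subgroup V H"
  using \<rho>.subgroup_img_is_subgroup[OF subgroup_subs[OF g_image_subs]] by simp

lemma \<rho>_continuous:
  assumes "S1 \<in> subs G" "S2 \<in> subs G" "V1 \<in> subs H" "V2 \<in> subs H" "S1 \<subseteq> S2" "V1 \<subseteq> V2"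
    "\<rho> ` S1 \<subseteq> V1" "\<rho> ` S2 \<subseteq> V2"
  shows "continuous_map (gtop G S2 S1) (gtop H V2 V1) \<rho>"
  using lca2_mor_continuous_gtop[OF \<rho>_mor is_group group_H assms] assms subgroup_subs subgroup_subs_H by blast

lemma g_continuous:
  assumes "S1 \<in> subs G" "S2 \<in> subs G" "V1 \<in> subs H" "V2 \<in> subs H" "S1 \<subseteq> S2" "V1 \<subseteq> V2"
    "g ` V1 \<subseteq> S1" "g ` V2 \<subseteq> S2"
  shows "continuous_map (gtop H V2 V1) (gtop G S2 S1) g"
proof -
  obtain g' where g': "lca2_mor H G g'" "\<forall>\<xi>\<in>carrier H. g' \<xi> = g \<xi>"
    using \<rho>_inverse_mor by blast
  have "g' ` V1 = g ` V1" "g' ` V2 = g ` V2" using g'(2) subs_H_subset assms by (auto intro!: image_cong)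
  then have "continuous_map (gtop H V2 V1) (gtop G S2 S1) g'"
    using lca2_mor_continuous_gtop[OF g'(1) group_H is_group assms(3,4,1,2,6,5)] assms subgroup_subs subgroup_subs_H by simp
  then show ?thesis
    by (rule continuous_map_eq) (use g'(2) topspace_gtop_subset[of H V2 V1] subs_H_subset[OF assms(4)] in blast)
qed

text \<open>The restriction to these members of \<open>subs G\<close> guarantees that the image
  under \<open>\<rho>\<close> is again of the form \<open>perp G S\<close>, so that both sides of a
  square are members.\<close>

definition duals :: "'a set set" where "duals = (\<lambda>V. g ` V) ` subs H"

lemma duals_subs: "L \<in> duals \<Longrightarrow> L \<in> subs G"
  using g_image_subs by (auto simp: duals_def)

lemma duals_\<rho>: "L \<in> duals \<Longrightarrow> \<rho> ` L \<in> subs H"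
  by (auto simp: duals_def)

text \<open>The first morphism condition for the inverse of \<open>\<rho>\<close> produces a member
  of the dual that is mapped into a given member of \<open>G\<close>.\<close>

lemma duals_below: assumes "S \<in> subs G" "S' \<in> subs G" obtains L where "L \<in> duals" "L \<subseteq> S" "L \<subseteq> S'"
proof -
  obtain S0 where S0: "S0 \<in> subs G" "S0 \<subseteq> S \<inter> S'" using G assms unfolding lca2_group_def by meson
  obtain g' where g': "lca2_mor H G g'" "\<forall>\<xi>\<in>carrier H. g' \<xi> = g \<xi>"
    using \<rho>_inverse_mor by blast
  obtain V where V: "V \<in> subs H" "g' ` V \<subseteq> S0" using g'(1) S0(1) by (auto simp: lca2_mor_def)
  then have "g ` V \<subseteq> S0" using g'(2) subs_H_subset[OF V(1)] by force
  then show thesis using that[of "g ` V"] V(1) S0(2) by (auto simp: duals_def)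
qed

text \<open>The second morphism condition for \<open>\<rho>\<close> produces a member of the dual
  that contains the image of a given member of \<open>G\<close>.\<close>

lemma duals_above: assumes "S \<in> subs G" "S' \<in> subs G" obtains L where "L \<in> duals" "S \<subseteq> L" "S' \<subseteq> L"
proof -
  obtain S0 where S0: "S0 \<in> subs G" "S \<union> S' \<subseteq> S0" using G assms unfolding lca2_group_def by meson
  obtain V where V: "V \<in> subs H" "\<rho> ` S0 \<subseteq> V" using \<rho>_mor S0(1) by (auto simp: lca2_mor_def)
  have "x \<in> g ` V" if "x \<in> S0" for x
    using V(2) that g_\<rho>[of x] subs_subset[OF S0(1)] by (metis image_eqI image_subset_iff subsetD)
  then show thesis using that[of "g ` V"] V(1) S0(2) by (auto simp: duals_def)
qed

end

section \<open>The phase space\<close>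

lemma lca2_prod_simps:
  "carrier (lca2_prod G H) = carrier G \<times> carrier H"
  "mult (lca2_prod G H) = mult (G \<times>\<times> H)"
  "one (lca2_prod G H) = (\<one>\<^bsub>G\<^esub>, \<one>\<^bsub>H\<^esub>)"
  by (simp_all add: lca2_prod_def DirProd_def)

lemma mult_lca2_prod [simp]:
  "(x, \<xi>) \<otimes>\<^bsub>lca2_prod G H\<^esub> (y, \<eta>) = (x \<otimes>\<^bsub>G\<^esub> y, \<xi> \<otimes>\<^bsub>H\<^esub> \<eta>)"
  by (simp add: lca2_prod_simps)

lemma group_lca2_prod:
  assumes "group G" "group H" shows "group (lca2_prod G H)"
proof -
  interpret G: group G by fact
  interpret H: group H by fact
  show ?thesis
  proof (rule groupI)
    fix z assume "z \<in> carrier (lca2_prod G H)"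
    then show "\<exists>w\<in>carrier (lca2_prod G H). w \<otimes>\<^bsub>lca2_prod G H\<^esub> z = \<one>\<^bsub>lca2_prod G H\<^esub>"
      by (intro bexI[of _ "(inv\<^bsub>G\<^esub> fst z, inv\<^bsub>H\<^esub> snd z)"]) (auto simp: lca2_prod_simps)
  qed (auto simp: lca2_prod_simps G.m_assoc H.m_assoc)
qed

lemma lca2_prod_cosets: "r_coset (lca2_prod G H) = r_coset (G \<times>\<times> H)"
  by (simp add: r_coset_def lca2_prod_simps fun_eq_iff)

lemma subgroup_lca2_prod: "subgroup W (lca2_prod G H) \<longleftrightarrow> subgroup W (G \<times>\<times> H)"
  by (simp add: subgroup_def m_inv_def lca2_prod_simps DirProd_def)

text \<open>These sets merely generate the topology of the product. Openness is therefore
  established by exhibiting a generator, and continuity into the product is tested on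
  generators.\<close>

definition prod_gens :: "'a lca2 \<Rightarrow> 'b lca2 \<Rightarrow> ('a \<times> 'b) set \<Rightarrow> ('a \<times> 'b) set \<Rightarrow> ('a \<times> 'b) set set set" where
  "prod_gens G H W2 W1 = {Q. Q \<subseteq> (\<lambda>w. W1 #>\<^bsub>lca2_prod G H\<^esub> w) ` W2 \<and>
     (\<exists>U1\<in>subs G. \<exists>U2\<in>subs G. \<exists>V1\<in>subs H. \<exists>V2\<in>subs H. \<exists>E.
        U1 \<subseteq> U2 \<and> V1 \<subseteq> V2 \<and> U1 \<times> V1 \<subseteq> W1 \<and> W2 \<subseteq> U2 \<times> V2 \<and>
        openin (prod_topology (qtop G U2 U1) (qtop H V2 V1)) E \<and>
        {w \<in> W2. W1 #>\<^bsub>lca2_prod G H\<^esub> w \<in> Q} = {w \<in> W2. (U1 #>\<^bsub>G\<^esub> fst w, V1 #>\<^bsub>H\<^esub> snd w) \<in> E})}"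

lemma qtop_lca2_prod: "qtop (lca2_prod G H) W2 W1 = topology_generated_by (prod_gens G H W2 W1)"
  unfolding prod_gens_def lca2_prod_cosets carrier_subquot[symmetric] by (simp only: lca2_prod_def lca2.simps)

lemma subs_lca2_prod:
  "W \<in> subs (lca2_prod G H) \<longleftrightarrow> subgroup W (lca2_prod G H) \<and>
    (\<exists>U1\<in>subs G. \<exists>U2\<in>subs G. \<exists>V1\<in>subs H. \<exists>V2\<in>subs H.
       U1 \<subseteq> U2 \<and> V1 \<subseteq> V2 \<and> U1 \<times> V1 \<subseteq> W \<and> W \<subseteq> U2 \<times> V2 \<and>
       closedin (prod_topology (qtop G U2 U1) (qtop H V2 V1))
         ((\<lambda>(x, y). (U1 #>\<^bsub>G\<^esub> x, V1 #>\<^bsub>H\<^esub> y)) ` W))"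
  unfolding subgroup_lca2_prod by (simp only: lca2_prod_def lca2.simps mem_Collect_eq)

text \<open>Three arguments, because the multiplier is a rational expression in \<open>h x\<close>,
  \<open>h y\<close> and the value of \<open>h\<close> at the product of \<open>x\<close> and
  \<open>y\<close>.\<close>

lemma circle_combine:
  assumes "continuous_map X circle_top f1" "continuous_map X circle_top f2" "continuous_map X circle_top f3"
    and "continuous_on (sphere 0 1 \<times> sphere 0 1 \<times> sphere 0 1) F"
    and "F ` (sphere 0 1 \<times> sphere 0 1 \<times> sphere 0 1) \<subseteq> sphere 0 1"
  shows "continuous_map X circle_top (\<lambda>p. F (f1 p, f2 p, f3 p))"
proof -
  let ?S = "sphere (0::complex) 1"
  have "prod_topology circle_top (prod_topology circle_top circle_top) = top_of_set (?S \<times> ?S \<times> ?S)"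
    unfolding circle_top_def by (simp add: subtopology_Times flip: euclidean_product_topology)
  moreover have "continuous_map X (prod_topology circle_top (prod_topology circle_top circle_top)) (\<lambda>p. (f1 p, f2 p, f3 p))"
    using assms(1-3) by (intro continuous_map_pairedI)
  ultimately have "continuous_map X (top_of_set (?S \<times> ?S \<times> ?S)) (\<lambda>p. (f1 p, f2 p, f3 p))" by simp
  moreover have "continuous_map (top_of_set (?S \<times> ?S \<times> ?S)) circle_top F"
    unfolding circle_top_def using assms(4,5) by (auto simp: continuous_map_in_subtopology)
  ultimately have "continuous_map X circle_top (F \<circ> (\<lambda>p. (f1 p, f2 p, f3 p)))"
    by (rule continuous_map_compose)
  then show ?thesis by (simp add: o_def)
qed

context even_quadratic
begin

abbreviation P :: "('a \<times> ('a \<Rightarrow> complex)) lca2" where "P \<equiv> phase_space G"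

section \<open>Coordinates, squares and generators of the topology of the phase space\<close>

definition coords :: "'a \<times> ('a \<Rightarrow> complex) \<Rightarrow> 'a \<times> 'a" where "coords w = (fst w, g (snd w))"

definition uncoords :: "'a \<times> 'a \<Rightarrow> 'a \<times> ('a \<Rightarrow> complex)" where "uncoords p = (fst p, \<rho> (snd p))"

abbreviation rect :: "'a set \<Rightarrow> ('a \<times> ('a \<Rightarrow> complex)) set" where "rect L \<equiv> L \<times> \<rho> ` L"

abbreviation sqtop :: "'a set \<Rightarrow> 'a set \<Rightarrow> ('a \<times> 'a) topology" where
  "sqtop L2 L1 \<equiv> prod_topology (gtop G L2 L1) (gtop G L2 L1)"

lemma coords_closed: "w \<in> carrier P \<Longrightarrow> coords w \<in> carrier G \<times> carrier G"
  by (auto simp: coords_def lca2_prod_simps g_closed)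

lemma uncoords_closed: "p \<in> carrier G \<times> carrier G \<Longrightarrow> uncoords p \<in> carrier P"
  using \<rho>_closed by (auto simp: uncoords_def lca2_prod_simps)

lemma coords_uncoords [simp]: "p \<in> carrier G \<times> carrier G \<Longrightarrow> coords (uncoords p) = p"
  by (auto simp: coords_def uncoords_def)

lemma uncoords_coords [simp]: "w \<in> carrier P \<Longrightarrow> uncoords (coords w) = w"
  by (auto simp: coords_def uncoords_def lca2_prod_simps)

lemma coords_mult:
  "w \<in> carrier P \<Longrightarrow> w' \<in> carrier P \<Longrightarrow>
    coords (w \<otimes>\<^bsub>P\<^esub> w') = (fst (coords w) \<otimes> fst (coords w'), snd (coords w) \<otimes> snd (coords w'))"
  by (auto simp: coords_def lca2_prod_simps g_mult)

lemma uncoords_mult: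
  "x \<in> carrier G \<Longrightarrow> y \<in> carrier G \<Longrightarrow> x' \<in> carrier G \<Longrightarrow> y' \<in> carrier G \<Longrightarrow>
    uncoords (x \<otimes> x', y \<otimes> y') = uncoords (x, y) \<otimes>\<^bsub>P\<^esub> uncoords (x', y')"
  by (simp add: uncoords_def \<rho>_mult)

lemma coords_rect: "L \<subseteq> carrier G \<Longrightarrow> w \<in> carrier P \<Longrightarrow> w \<in> rect L \<longleftrightarrow> coords w \<in> L \<times> L"
proof -
  assume L: "L \<subseteq> carrier G" and w: "w \<in> carrier P"
  have "snd w \<in> \<rho> ` L \<longleftrightarrow> g (snd w) \<in> L"
  proof
    assume "snd w \<in> \<rho> ` L"
    then show "g (snd w) \<in> L" using L by auto
  next
    assume "g (snd w) \<in> L"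
    moreover have "\<rho> (g (snd w)) = snd w" using w by (intro \<rho>_g) (auto simp: lca2_prod_simps)
    ultimately show "snd w \<in> \<rho> ` L" by (metis imageI)
  qed
  then show ?thesis by (simp add: coords_def mem_Times_iff)
qed

lemma coords_in_square:
  assumes "L \<subseteq> carrier G" "W \<subseteq> carrier P" "W \<subseteq> rect L" "w \<in> W"
  shows "coords w \<in> L \<times> L"
  using coords_rect[OF assms(1), of w] assms by blast

lemma group_P: "group P"
  by (rule group_lca2_prod[OF is_group group_H])

lemma subs_P_subgroup: "W \<in> subs P \<Longrightarrow> subgroup W P"
  by (simp add: subs_lca2_prod)

lemma subs_P_subset: "W \<in> subs P \<Longrightarrow> W \<subseteq> carrier P"
  using subs_P_subgroup subgroup.subset by blast

text \<open>With the square itself as both the lower and the upper rectangle, the quotients are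
  single points and closedness is automatic.\<close>

lemma rect_subs:
  assumes L: "L \<in> duals"
  shows "rect L \<in> subs P"
proof -
  note LG = duals_subs[OF L] and LH = duals_\<rho>[OF L]
  have sgL: "subgroup L G" "subgroup (\<rho> ` L) H" using LG LH subgroup_subs subgroup_subs_H by blast+
  have c1: "L #> x = L" if "x \<in> L" for x
    using coset_join2[OF subgroup.mem_carrier[OF sgL(1) that] sgL(1) that] .
  have c2: "\<rho> ` L #>\<^bsub>H\<^esub> \<xi> = \<rho> ` L" if "\<xi> \<in> \<rho> ` L" for \<xi>
    using group.coset_join2[OF group_H subgroup.mem_carrier[OF sgL(2) that] sgL(2) that] .
  have ne: "L \<noteq> {}" using subgroup.one_closed[OF sgL(1)] by blast
  have tG: "topspace (qtop G L L) = {L}" using topspace_qtop[OF G LG LG] c1 ne by auto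
  \<comment> \<open>The space of \<open>qtop H\<close> comes from a pullback and could a priori miss
    cosets; as the image of \<open>L\<close> under the continuous \<open>\<rho>\<close> it is
    complete.\<close>
  have "topspace (gtop H (\<rho> ` L) (\<rho> ` L)) = \<rho> ` L"
  proof (intro equalityI topspace_gtop_subset)
    show "\<rho> ` L \<subseteq> topspace (gtop H (\<rho> ` L) (\<rho> ` L))"
      using continuous_map_image_subset_topspace[OF \<rho>_continuous[OF LG LG LH LH]]
        topspace_gtop[OF G LG LG] by simp
  qed
  then have "\<rho> ` L #>\<^bsub>H\<^esub> \<rho> x \<in> topspace (qtop H (\<rho> ` L) (\<rho> ` L))" if "x \<in> L" for x
    using that unfolding gtop_def topspace_pullback_topology by blast
  then have "\<rho> ` L \<in> topspace (qtop H (\<rho> ` L) (\<rho> ` L))"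
    using ne c2 by force
  moreover have "X = \<rho> ` L" if "X \<in> topspace (qtop H (\<rho> ` L) (\<rho> ` L))" for X
  proof -
    have "X \<in> carrier (subquot (dual_group G) (\<rho> ` L) (\<rho> ` L))"
      using that by (auto simp: lca2_dual_def Let_def topspace_pullback_topology)
    then obtain \<xi> where "\<xi> \<in> \<rho> ` L" "X = \<rho> ` L #>\<^bsub>dual_group G\<^esub> \<xi>" by (auto simp: carrier_subquot)
    moreover have "\<rho> ` L #>\<^bsub>dual_group G\<^esub> \<xi> = \<rho> ` L #>\<^bsub>H\<^esub> \<xi>" by (simp add: r_coset_def lca2_dual_def)
    ultimately show ?thesis using c2 by simp
  qed
  ultimately have tH: "topspace (qtop H (\<rho> ` L) (\<rho> ` L)) = {\<rho> ` L}" by blast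
  have "(\<lambda>(x, y). (L #> x, \<rho> ` L #>\<^bsub>H\<^esub> y)) ` rect L = (\<lambda>_. (L, \<rho> ` L)) ` rect L"
    by (rule image_cong) (auto simp: c1 c2)
  also have "\<dots> = {(L, \<rho> ` L)}" using ne by (simp add: image_constant_conv)
  finally have "(\<lambda>(x, y). (L #> x, \<rho> ` L #>\<^bsub>H\<^esub> y)) ` rect L =
      topspace (prod_topology (qtop G L L) (qtop H (\<rho> ` L) (\<rho> ` L)))"
    by (simp add: tG tH)
  then have "closedin (prod_topology (qtop G L L) (qtop H (\<rho> ` L) (\<rho> ` L))) ((\<lambda>(x, y). (L #> x, \<rho> ` L #>\<^bsub>H\<^esub> y)) ` rect L)"
    by (simp only: closedin_topspace)
  moreover have "subgroup (rect L) P"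
    unfolding subgroup_lca2_prod by (rule DirProd_subgroups[OF is_group sgL(1) group_H sgL(2)])
  ultimately show ?thesis using LG LH unfolding subs_lca2_prod by blast
qed

text \<open>"Eventually" along \<open>duals\<close>, directed downwards; \<open>large\<close> is the
  upward version. Directedness lets finitely many demands on a single \<open>L\<close> be met
  together.\<close>

definition small :: "('a set \<Rightarrow> bool) \<Rightarrow> bool" where
  "small R \<longleftrightarrow> (\<exists>S\<in>subs G. \<forall>L\<in>duals. L \<subseteq> S \<longrightarrow> R L)"

definition large :: "('a set \<Rightarrow> bool) \<Rightarrow> bool" where
  "large R \<longleftrightarrow> (\<exists>S\<in>subs G. \<forall>L\<in>duals. S \<subseteq> L \<longrightarrow> R L)"

lemma small_conj: "small R \<Longrightarrow> small R' \<Longrightarrow> small (\<lambda>L. R L \<and> R' L)"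
  unfolding small_def by (meson duals_below duals_subs order_trans)

lemma large_conj: "large R \<Longrightarrow> large R' \<Longrightarrow> large (\<lambda>L. R L \<and> R' L)"
  unfolding large_def by (meson duals_above duals_subs order_trans)

lemma small_mono: "small R \<Longrightarrow> (\<And>L. R L \<Longrightarrow> R' L) \<Longrightarrow> small R'"
  unfolding small_def by blast

lemma large_mono: "large R \<Longrightarrow> (\<And>L. R L \<Longrightarrow> R' L) \<Longrightarrow> large R'"
  unfolding large_def by blast

lemma small_ex: "small R \<Longrightarrow> \<exists>L\<in>duals. R L"
  unfolding small_def by (meson duals_below)

lemma large_ex: "large R \<Longrightarrow> \<exists>L\<in>duals. R L"
  unfolding large_def by (meson duals_above)

lemma small_subset: "S \<in> subs G \<Longrightarrow> small (\<lambda>L. L \<subseteq> S)"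
  unfolding small_def by blast

lemma large_superset: "S \<in> subs G \<Longrightarrow> large (\<lambda>L. S \<subseteq> L)"
  unfolding large_def by blast

lemma large_mem: "x \<in> carrier G \<Longrightarrow> large (\<lambda>L. x \<in> L)"
proof -
  assume "x \<in> carrier G"
  moreover have "\<Union>(subs G) = carrier G" using G by (simp add: lca2_group_def)
  ultimately obtain S where "S \<in> subs G" "x \<in> S" by blast
  then show ?thesis unfolding large_def by blast
qed

text \<open>The second side of the square lies in \<open>V\<close> as soon as \<open>L\<close> lies
  in the image of \<open>V\<close> under \<open>g\<close>. That image is a member by
  \<open>g_image_subs\<close>, so this is a smallness condition.\<close>

lemma small_rect:
  assumes "W \<in> subs P" shows "small (\<lambda>L. rect L \<subseteq> W)"
proof -
  obtain U V where UV: "U \<in> subs G" "V \<in> subs H" "U \<times> V \<subseteq> W"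
    using assms unfolding subs_lca2_prod by blast
  have "\<rho> ` L \<subseteq> V" if "L \<subseteq> g ` V" for L
    using image_mono[OF that, of \<rho>] UV(2) by simp
  then have "rect L \<subseteq> U \<times> V" if "L \<subseteq> U \<and> L \<subseteq> g ` V" for L
    using that by (intro Sigma_mono) auto
  from subset_trans[OF this UV(3)] show ?thesis
    by (rule small_mono[OF small_conj[OF small_subset[OF UV(1)] small_subset[OF g_image_subs[OF UV(2)]]]])
qed

lemma large_rect:
  assumes "W \<in> subs P" shows "large (\<lambda>L. W \<subseteq> rect L)"
proof -
  obtain U V where UV: "U \<in> subs G" "V \<in> subs H" "W \<subseteq> U \<times> V"
    using assms unfolding subs_lca2_prod by blast
  have "V \<subseteq> \<rho> ` L" if "g ` V \<subseteq> L" for L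
    using image_mono[OF that, of \<rho>] UV(2) by simp
  then have "U \<times> V \<subseteq> rect L" if "U \<subseteq> L \<and> g ` V \<subseteq> L" for L
    using that by (intro Sigma_mono) auto
  from subset_trans[OF UV(3) this] show ?thesis
    by (rule large_mono[OF large_conj[OF large_superset[OF UV(1)] large_superset[OF g_image_subs[OF UV(2)]]]])
qed

text \<open>The lower and upper squares serve as the rectangles. Continuity of \<open>g\<close> on
  the second factor carries the open set \<open>E\<close> from the coordinates back to pairs of
  cosets.\<close>

lemma prod_gensI:
  assumes L: "L1 \<in> duals" "L2 \<in> duals" "L1 \<subseteq> L2" and W: "rect L1 \<subseteq> W1" "W2 \<subseteq> rect L2"
    and Q: "Q \<subseteq> (\<lambda>w. W1 #>\<^bsub>P\<^esub> w) ` W2" and E: "openin (sqtop L2 L1) E"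
    and eq: "\<And>w. w \<in> W2 \<Longrightarrow> W1 #>\<^bsub>P\<^esub> w \<in> Q \<longleftrightarrow> coords w \<in> E"
  shows "Q \<in> prod_gens G H W2 W1"
proof -
  let ?V1 = "\<rho> ` L1" and ?V2 = "\<rho> ` L2"
  note LG = duals_subs[OF L(1)] duals_subs[OF L(2)] and LH = duals_\<rho>[OF L(1)] duals_\<rho>[OF L(2)]
  have gL: "g ` \<rho> ` L = L" if "L \<in> duals" for L
    using subs_subset[OF duals_subs[OF that]] by (force simp: image_image)
  let ?X = "pullback_topology (L2 \<times> ?V2) (\<lambda>(x, y). (L1 #> x, ?V1 #>\<^bsub>H\<^esub> y)) (prod_topology (qtop G L2 L1) (qtop H ?V2 ?V1))"
  have "continuous_map (prod_topology (gtop G L2 L1) (gtop H ?V2 ?V1)) (sqtop L2 L1) (\<lambda>(x, \<xi>). (x, g \<xi>))"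
    using g_continuous[OF LG LH L(3)] L gL by (simp add: continuous_map_prod_top image_mono)
  moreover have "continuous_map ?X (prod_topology (gtop G L2 L1) (gtop H ?V2 ?V1)) (\<lambda>p. p)"
    unfolding gtop_def by (rule continuous_map_prod_pullback)
  ultimately have "continuous_map ?X (sqtop L2 L1) ((\<lambda>(x, \<xi>). (x, g \<xi>)) \<circ> (\<lambda>p. p))"
    by (rule continuous_map_compose[rotated])
  then have "openin ?X {p \<in> topspace ?X. ((\<lambda>(x, \<xi>). (x, g \<xi>)) \<circ> (\<lambda>p. p)) p \<in> E}"
    using E by (rule openin_continuous_map_preimage)
  then obtain E' where E': "openin (prod_topology (qtop G L2 L1) (qtop H ?V2 ?V1)) E'"
    "{p \<in> topspace ?X. coords p \<in> E} = (\<lambda>(x, y). (L1 #> x, ?V1 #>\<^bsub>H\<^esub> y)) -` E' \<inter> (L2 \<times> ?V2)"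
    unfolding openin_pullback_topology by (auto simp: coords_def case_prod_unfold)
  \<comment> \<open>The preimage \<open>E'\<close> is controlled only inside the space of the
    pulled-back dual topology; continuity of \<open>\<rho>\<close> shows that this space is
    everything.\<close>
  have tX: "w \<in> topspace ?X" if "w \<in> L2 \<times> ?V2" for w
  proof -
    have "\<rho> ` L2 \<subseteq> topspace (gtop H ?V2 ?V1)"
      using continuous_map_image_subset_topspace[OF \<rho>_continuous[OF LG LH L(3) image_mono[OF L(3)]]]
        topspace_gtop[OF G LG L(3)] by simp
    then show ?thesis using that topspace_gtop[OF G LG L(3)]
      by (auto simp: topspace_pullback_topology gtop_def)
  qed
  have "{w \<in> W2. W1 #>\<^bsub>P\<^esub> w \<in> Q} = {w \<in> W2. (L1 #> fst w, ?V1 #>\<^bsub>H\<^esub> snd w) \<in> E'}"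
  proof (rule Collect_cong, rule conj_cong[OF refl])
    fix w assume w: "w \<in> W2"
    then have w2: "w \<in> L2 \<times> ?V2" using W by blast
    have "coords w \<in> E \<longleftrightarrow> w \<in> {p \<in> topspace ?X. coords p \<in> E}" using tX[OF w2] by blast
    also have "\<dots> \<longleftrightarrow> (L1 #> fst w, ?V1 #>\<^bsub>H\<^esub> snd w) \<in> E'" unfolding E'(2) using w2 by (auto simp: case_prod_unfold)
    finally show "W1 #>\<^bsub>P\<^esub> w \<in> Q \<longleftrightarrow> (L1 #> fst w, ?V1 #>\<^bsub>H\<^esub> snd w) \<in> E'" using eq[OF w] by simp
  qed
  then show ?thesis
    using E'(1) Q LG LH L(3) W image_mono[OF L(3), of \<rho>] unfolding prod_gens_def by blast
qed

text \<open>A generator comes with its own rectangles. Stating the conclusion for all sufficiently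
  small \<open>L1\<close> and large \<open>L2\<close> leaves room to impose further demands on the
  pair.\<close>

lemma prod_gensE:
  assumes "Q \<in> prod_gens G H W2 W1" "W2 \<subseteq> carrier P"
  obtains S1 S2 where "S1 \<in> subs G" "S2 \<in> subs G"
    "\<And>L1 L2. L1 \<in> duals \<Longrightarrow> L2 \<in> duals \<Longrightarrow> L1 \<subseteq> S1 \<Longrightarrow> S2 \<subseteq> L2 \<Longrightarrow>
      \<exists>E. openin (sqtop L2 L1) E \<and> (\<forall>w\<in>W2. W1 #>\<^bsub>P\<^esub> w \<in> Q \<longleftrightarrow> coords w \<in> E)"
proof -
  obtain U1 U2 V1 V2 E where UV: "U1\<in>subs G" "U2\<in>subs G" "V1\<in>subs H" "V2\<in>subs H" "U1 \<subseteq> U2" "V1 \<subseteq> V2"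
      "U1 \<times> V1 \<subseteq> W1" "W2 \<subseteq> U2 \<times> V2"
    and E: "openin (prod_topology (qtop G U2 U1) (qtop H V2 V1)) E"
    and Q: "{w \<in> W2. W1 #>\<^bsub>P\<^esub> w \<in> Q} = {w \<in> W2. (U1 #> fst w, V1 #>\<^bsub>H\<^esub> snd w) \<in> E}"
    using assms(1) unfolding prod_gens_def by (elim CollectE conjE bexE exE) (rule that)
  let ?M1 = "g ` V1" and ?M2 = "g ` V2"
  have M: "?M1 \<in> subs G" "?M2 \<in> subs G" "?M1 \<subseteq> ?M2" using g_image_subs UV by auto
  let ?Y = "prod_topology (gtop G U2 U1) (gtop G ?M2 ?M1)"
  let ?f = "\<lambda>(x, y). (U1 #> x, V1 #>\<^bsub>H\<^esub> \<rho> y)"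
  have "continuous_map (gtop G ?M2 ?M1) (qtop H V2 V1) ((\<lambda>\<xi>. V1 #>\<^bsub>H\<^esub> \<xi>) \<circ> \<rho>)"
    using \<rho>_continuous[OF M(1,2) UV(3,4) M(3) UV(6)] UV(3,4)
    by (intro continuous_map_compose[OF _ continuous_map_gtop_coset]) simp
  then have f: "continuous_map ?Y (prod_topology (qtop G U2 U1) (qtop H V2 V1)) ?f"
    by (simp add: continuous_map_prod_top continuous_map_gtop_coset o_def)
  define E0 where "E0 = {p \<in> topspace ?Y. ?f p \<in> E}"
  have E0: "openin ?Y E0" unfolding E0_def by (rule openin_continuous_map_preimage[OF f E])
  obtain S1 where S1: "S1 \<in> duals" "S1 \<subseteq> U1" "S1 \<subseteq> ?M1" using duals_below[OF UV(1) M(1)] by blast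
  obtain S2 where S2: "S2 \<in> duals" "U2 \<subseteq> S2" "?M2 \<subseteq> S2" using duals_above[OF UV(2) M(2)] by blast
  show thesis
  proof (rule that[OF duals_subs[OF S1(1)] duals_subs[OF S2(1)]])
    fix L1 L2 assume L: "L1 \<in> duals" "L2 \<in> duals" "L1 \<subseteq> S1" "S2 \<subseteq> L2"
    note LG = duals_subs[OF L(1)] duals_subs[OF L(2)]
    have "continuous_map (subtopology (gtop G L2 L1) U2) (gtop G U2 U1) (\<lambda>x. x)"
      by (rule gtop_restrict[OF G LG(1) UV(1,2) LG(2)]) (use L S1 S2 UV in blast)+
    moreover have "continuous_map (subtopology (gtop G L2 L1) ?M2) (gtop G ?M2 ?M1) (\<lambda>x. x)"
      by (rule gtop_restrict[OF G LG(1) M(1,2) LG(2)]) (use L S1 S2 M in blast)+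
    ultimately have "continuous_map (prod_topology (subtopology (gtop G L2 L1) U2) (subtopology (gtop G L2 L1) ?M2)) ?Y (\<lambda>(x, y). (x, y))"
      unfolding continuous_map_prod_top by blast
    then have "continuous_map (subtopology (sqtop L2 L1) (U2 \<times> ?M2)) ?Y (\<lambda>p. p)"
      by (simp add: subtopology_Times case_prod_unfold)
    \<comment> \<open>An open set of the subspace extends to an open set \<open>E1\<close> of the
      larger square. This suffices because the coordinates of \<open>W2\<close> stay inside the
      subspace.\<close>
    from openin_continuous_map_preimage[OF this E0]
    obtain E1 where E1: "openin (sqtop L2 L1) E1"
      "{p \<in> topspace (subtopology (sqtop L2 L1) (U2 \<times> ?M2)). p \<in> E0} = E1 \<inter> (U2 \<times> ?M2)"
      unfolding openin_subtopology by blast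
    have L12: "L1 \<subseteq> L2" "U2 \<subseteq> L2" "?M2 \<subseteq> L2" using L S1 S2 UV by blast+
    have t: "topspace (subtopology (sqtop L2 L1) (U2 \<times> ?M2)) = U2 \<times> ?M2" "topspace ?Y = U2 \<times> ?M2"
      using topspace_gtop[OF G LG L12(1)] topspace_gtop[OF G UV(1,2,5)] topspace_gtop[OF G M] L12 by auto
    have "W1 #>\<^bsub>P\<^esub> w \<in> Q \<longleftrightarrow> coords w \<in> E1" if w: "w \<in> W2" for w
    proof -
      have cw: "coords w \<in> U2 \<times> ?M2" using w UV(8) by (auto simp: coords_def)
      have "snd w \<in> carrier H" using w assms(2) by (auto simp: lca2_prod_simps)
      then have "?f (coords w) = (U1 #> fst w, V1 #>\<^bsub>H\<^esub> snd w)" by (simp add: coords_def)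
      then have "W1 #>\<^bsub>P\<^esub> w \<in> Q \<longleftrightarrow> ?f (coords w) \<in> E" using Q w by auto
      also have "\<dots> \<longleftrightarrow> coords w \<in> E0" using cw t(2) by (auto simp: E0_def)
      also have "\<dots> \<longleftrightarrow> coords w \<in> E1 \<inter> (U2 \<times> ?M2)" unfolding E1(2)[symmetric] t(1) using cw by simp
      also have "\<dots> \<longleftrightarrow> coords w \<in> E1" using cw by simp
      finally show ?thesis .
    qed
    then show "\<exists>E. openin (sqtop L2 L1) E \<and> (\<forall>w\<in>W2. W1 #>\<^bsub>P\<^esub> w \<in> Q \<longleftrightarrow> coords w \<in> E)" using E1(1) by blast
  qed
qed

text \<open>The set of all cosets is itself a generator, with the full square
  \<open>L2 \<times> L2\<close> as its open set.\<close>

lemma topspace_qtop_P: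
  assumes "W1 \<in> subs P" "W2 \<in> subs P" "W1 \<subseteq> W2"
  shows "topspace (qtop P W2 W1) = (\<lambda>w. W1 #>\<^bsub>P\<^esub> w) ` W2"
    and "(\<lambda>w. W1 #>\<^bsub>P\<^esub> w) ` W2 \<in> prod_gens G H W2 W1"
proof -
  obtain L2 where L2: "L2 \<in> duals" "W2 \<subseteq> rect L2" using large_ex[OF large_rect[OF assms(2)]] by blast
  obtain L1 where L1: "L1 \<in> duals" "L1 \<subseteq> L2" "rect L1 \<subseteq> W1"
    using small_ex[OF small_conj[OF small_subset[OF duals_subs[OF L2(1)]] small_rect[OF assms(1)]]] by blast
  note LG = duals_subs[OF L1(1)] duals_subs[OF L2(1)]
  have "coords w \<in> L2 \<times> L2" if "w \<in> W2" for w
    using coords_in_square[OF subs_subset[OF LG(2)] subs_P_subset[OF assms(2)] L2(2) that] .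
  moreover have "openin (sqtop L2 L1) (L2 \<times> L2)"
    using openin_topspace[of "sqtop L2 L1"] by (simp add: topspace_gtop[OF G LG L1(2)])
  ultimately show gen: "(\<lambda>w. W1 #>\<^bsub>P\<^esub> w) ` W2 \<in> prod_gens G H W2 W1"
    by (intro prod_gensI[OF L1(1) L2(1) L1(2,3) L2(2), where E = "L2 \<times> L2"]) auto
  have "Q \<subseteq> (\<lambda>w. W1 #>\<^bsub>P\<^esub> w) ` W2" if "Q \<in> prod_gens G H W2 W1" for Q
    using that unfolding prod_gens_def by (rule CollectE) (rule conjunct1)
  then show "topspace (qtop P W2 W1) = (\<lambda>w. W1 #>\<^bsub>P\<^esub> w) ` W2"
    unfolding qtop_lca2_prod topology_generated_by_topspace using gen
    by (intro equalityI Union_least Union_upper) blast+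
qed

text \<open>The common tool for continuity on quotients of the phase space: a map of cosets has to
  be matched only with a continuous function \<open>k\<close> of the coordinates.\<close>

lemma openin_preimage_qtop_P:
  assumes W: "W1 \<in> subs P" "W2 \<in> subs P" "W1 \<subseteq> W2"
    and L: "L1 \<in> duals" "L2 \<in> duals" "L1 \<subseteq> L2" "rect L1 \<subseteq> W1" "W2 \<subseteq> rect L2"
    and k: "continuous_map (sqtop L2 L1) Z k" "openin Z D"
    and F: "\<And>w. w \<in> W2 \<Longrightarrow> F (W1 #>\<^bsub>P\<^esub> w) \<in> Q \<longleftrightarrow> k (coords w) \<in> D"
  shows "openin (qtop P W2 W1) {X \<in> topspace (qtop P W2 W1). F X \<in> Q}"
proof -
  note LG = duals_subs[OF L(1)] duals_subs[OF L(2)]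
  have c: "coords w \<in> topspace (sqtop L2 L1)" if "w \<in> W2" for w
    using coords_in_square[OF subs_subset[OF LG(2)] subs_P_subset[OF W(2)] L(5) that]
    by (simp add: topspace_gtop[OF G LG L(3)])
  have "{X \<in> topspace (qtop P W2 W1). F X \<in> Q} \<in> prod_gens G H W2 W1"
    by (rule prod_gensI[OF L _ openin_continuous_map_preimage[OF k]])
       (use F c topspace_qtop_P(1)[OF W] in auto)
  then show ?thesis unfolding qtop_lca2_prod by (rule topology_generated_by_Basis)
qed

subsection \<open>Continuity on the phase space\<close>

lemma mat_act_continuous:
  assumes "L1 \<in> subs G" "L2 \<in> subs G" "L1 \<subseteq> L2"
  shows "continuous_map (sqtop L2 L1) (sqtop L2 L1) (mat_act A)"
proof -
  have c: "continuous_map (sqtop L2 L1) (gtop G L2 L1) (\<lambda>p. fst p [^] (m::int) \<otimes> snd p [^] (n::int))" for m n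
  proof -
    have "continuous_map (sqtop L2 L1) (gtop G L2 L1) (\<lambda>p. fst p [^] m)"
         "continuous_map (sqtop L2 L1) (gtop G L2 L1) (\<lambda>p. snd p [^] n)"
      using continuous_map_compose[OF continuous_map_fst gtop_int_pow[OF G assms]]
        continuous_map_compose[OF continuous_map_snd gtop_int_pow[OF G assms]] by (simp_all add: o_def)
    then have "continuous_map (sqtop L2 L1) (gtop G L2 L1) ((\<lambda>(x, y). x \<otimes> y) \<circ> (\<lambda>p. (fst p [^] m, snd p [^] n)))"
      by (intro continuous_map_compose[OF _ gtop_mult[OF G assms]] continuous_map_pairedI)
    then show ?thesis by (simp add: o_def)
  qed
  show ?thesis
    unfolding mat_act_def case_prod_unfold by (intro continuous_map_pairedI c)
qed

text \<open>Read off from continuity with \<open>L\<close> as both bounds, since a continuous map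
  respects the underlying spaces.\<close>

lemma mat_act_square:
  assumes "L \<in> subs G" "p \<in> L \<times> L"
  shows "mat_act A p \<in> L \<times> L"
  using continuous_map_image_subset_topspace[OF mat_act_continuous[OF assms(1) assms(1) order_refl, of A]]
    topspace_gtop[OF G assms(1) assms(1)] assms(2) by auto

text \<open>Pairs for which \<open>h\<close> descends to \<open>L2 / L1\<close>; its polarization
  and all multipliers then descend to pairs of cosets.\<close>

definition good :: "'a set \<Rightarrow> 'a set \<Rightarrow> bool" where
  "good L1 L2 \<longleftrightarrow> L1 \<in> duals \<and> L2 \<in> duals \<and> L1 \<subseteq> L2 \<and> (\<forall>u\<in>L2. \<forall>v\<in>L1. h (u \<otimes> v) = h u)"

lemma subs_nonempty: "subs G \<noteq> {}"
  using G by (simp add: lca2_group_def)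

lemma quad_invariant: "U \<in> subs G \<Longrightarrow> \<exists>V\<in>subs G. \<forall>u\<in>U. \<forall>v\<in>V. h (u \<otimes> v) = h u"
  using quad unfolding quadratic_character_def by (elim conjE) (erule bspec)

lemma quad_continuous:
  assumes "U \<in> subs G" "V \<in> subs G" "V \<subseteq> U" "\<forall>u\<in>U. \<forall>v\<in>V. h (u \<otimes> v) = h u"
  shows "continuous_map (qtop G U V) circle_top (\<lambda>X. the_elem (h ` X))"
proof -
  have "\<forall>U\<in>subs G. \<forall>V\<in>subs G. V \<subseteq> U \<longrightarrow> (\<forall>u\<in>U. \<forall>v\<in>V. h (u \<otimes> v) = h u) \<longrightarrow>
        continuous_map (qtop G U V) circle_top (\<lambda>X. the_elem (h ` X))"
    using quad unfolding quadratic_character_def by (elim conjE)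
  then show ?thesis using assms by simp
qed

text \<open>The order of choice matters: \<open>L2\<close> is taken large first, the invariance of
  \<open>h\<close> on it then supplies \<open>V\<close>, and \<open>L1\<close> is taken inside
  \<open>V\<close> and \<open>L2\<close>.\<close>

lemma good_exists:
  assumes "large R" "small R'"
  shows "\<exists>L1 L2. good L1 L2 \<and> R L2 \<and> R' L1"
proof -
  obtain L2 where L2: "L2 \<in> duals" "R L2" using large_ex[OF assms(1)] by blast
  note L2G = duals_subs[OF L2(1)]
  obtain V where V: "V \<in> subs G" "\<forall>u\<in>L2. \<forall>v\<in>V. h (u \<otimes> v) = h u"
    using quad_invariant[OF L2G] by blast
  obtain L1 where "L1 \<in> duals" "R' L1" "L1 \<subseteq> V" "L1 \<subseteq> L2"
    using small_ex[OF small_conj[OF assms(2) small_conj[OF small_subset[OF V(1)] small_subset[OF L2G]]]] by blast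
  then have "good L1 L2" using L2(1) V(2) unfolding good_def by blast
  then show ?thesis using L2(2) \<open>R' L1\<close> by blast
qed

lemma goodD:
  assumes "good L1 L2"
  shows "L1 \<in> duals" "L2 \<in> duals" "L1 \<subseteq> L2" "L1 \<in> subs G" "L2 \<in> subs G" "L1 \<subseteq> carrier G" "L2 \<subseteq> carrier G"
    "u \<in> L2 \<Longrightarrow> v \<in> L1 \<Longrightarrow> h (u \<otimes> v) = h u"
  using assms duals_subs subs_subset by (auto simp: good_def)

text \<open>Invariance at the identity gives \<open>h v = 1\<close>, so all three factors of the
  polarization cancel.\<close>

lemma good_\<beta>:
  assumes "good L1 L2" "u \<in> L2" "v \<in> L1"
  shows "\<beta> u v = 1" "\<beta> v u = 1"
proof -
  note D = goodD[OF assms(1)]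
  have "\<one> \<in> L2" using subgroup.one_closed[OF subgroup_subs[OF D(5)]] .
  moreover have uv: "u \<in> carrier G" "v \<in> carrier G" using D assms by auto
  ultimately have "h v = 1" using D(8)[of \<one> v] assms(3) h_one by simp
  then show "\<beta> u v = 1" using D(8)[OF assms(2,3)] h_nonzero[OF uv(1)] by (simp add: polarization_def)
  then show "\<beta> v u = 1" using \<beta>_sym uv by simp
qed

lemma h_continuous:
  assumes "good L1 L2"
  shows "continuous_map (gtop G L2 L1) circle_top h"
proof -
  note D = goodD[OF assms]
  have "continuous_map (qtop G L2 L1) circle_top (\<lambda>X. the_elem (h ` X))"
    using quad_continuous[OF D(5,4,3)] D(8) by blast
  then have "continuous_map (gtop G L2 L1) circle_top ((\<lambda>X. the_elem (h ` X)) \<circ> (\<lambda>x. L1 #> x))"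
    by (rule continuous_map_compose[OF continuous_map_gtop_coset])
  then show ?thesis
  proof (rule continuous_map_eq)
    fix x assume "x \<in> topspace (gtop G L2 L1)"
    then have x: "x \<in> L2" using topspace_gtop_subset[of G L2 L1] by blast
    have "h (v \<otimes> x) = h x" if "v \<in> L1" for v
    proof -
      have "v \<otimes> x = x \<otimes> v" using m_comm D(6,7) x that by blast
      then show ?thesis using D(8)[OF x that] by simp
    qed
    then have "h ` (L1 #> x) = (\<lambda>_. h x) ` L1" by (auto simp: r_coset_def image_iff)
    also have "\<dots> = {h x}" using subgroup.one_closed[OF subgroup_subs[OF D(4)]] by auto
    finally show "((\<lambda>X. the_elem (h ` X)) \<circ> (\<lambda>x. L1 #> x)) x = h x" by simp
  qed
qed

lemma cocycle_continuous:
  assumes "good L1 L2"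
  shows "continuous_map (sqtop L2 L1) circle_top (cocycle A)"
proof -
  note D = goodD[OF assms] and hc = h_continuous[OF assms]
  \<comment> \<open>A bicharacter is continuous in each variable separately. Joint continuity of
    \<open>\<beta>\<close> is obtained by expressing it through \<open>h\<close>, with the third
    argument standing for \<open>h\<close> at the product.\<close>
  define F :: "complex \<times> complex \<times> complex \<Rightarrow> complex" where
    "F = (\<lambda>(u, v, w). u powi (A$1$1 * A$1$2) * v powi (A$2$1 * A$2$2) * (w * inverse u * inverse v) powi (A$1$2 * A$2$1))"
  have "continuous_map (sqtop L2 L1) circle_top (h \<circ> fst)" "continuous_map (sqtop L2 L1) circle_top (h \<circ> snd)"
    "continuous_map (sqtop L2 L1) circle_top (h \<circ> (\<lambda>(x, y). x \<otimes> y))"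
    using continuous_map_compose[OF continuous_map_fst hc] continuous_map_compose[OF continuous_map_snd hc]
      continuous_map_compose[OF gtop_mult[OF G D(4,5,3)] hc] by blast+
  moreover have "continuous_on (sphere 0 1 \<times> sphere 0 1 \<times> sphere 0 1) F"
    unfolding F_def case_prod_unfold by (intro continuous_intros) auto
  moreover have "F ` (sphere 0 1 \<times> sphere 0 1 \<times> sphere 0 1) \<subseteq> sphere 0 1"
    by (auto simp: F_def norm_mult norm_power_int norm_inverse)
  ultimately have "continuous_map (sqtop L2 L1) circle_top
      (\<lambda>p. F ((h \<circ> fst) p, (h \<circ> snd) p, (h \<circ> (\<lambda>(x, y). x \<otimes> y)) p))"
    by (rule circle_combine)
  then show ?thesis by (simp add: F_def cocycle_def polarization_def case_prod_unfold)
qed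

lemma cocycle_rect:
  assumes "good L1 L2" "p \<in> L2 \<times> L2" "q \<in> L1 \<times> L1"
  shows "cocycle A (fst p \<otimes> fst q, snd p \<otimes> snd q) = cocycle A p"
proof -
  note D = goodD[OF assms(1)]
  obtain x y x' y' where p: "p = (x, y)" "q = (x', y')" "x \<in> L2" "y \<in> L2" "x' \<in> L1" "y' \<in> L1" using assms by auto
  then have c: "x \<in> carrier G" "y \<in> carrier G" "x' \<in> carrier G" "y' \<in> carrier G" "y \<otimes> y' \<in> carrier G" using D by auto
  have "\<beta> (x \<otimes> x') (y \<otimes> y') = \<beta> x y"
    using c p good_\<beta>[OF assms(1)] D(3) by (simp add: \<beta>_mult_left \<beta>_mult_right subsetD)
  then show ?thesis using p D(8) by (simp add: cocycle_def)
qed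

text \<open>These are the characters that arise when one argument of the polarization of a
  multiplier is fixed. Prescribing \<open>k\<close> on the carrier only covers every function that
  agrees there.\<close>

lemma character_of_phase_space:
  assumes z: "z1 \<in> carrier G" "z2 \<in> carrier G"
    and k: "\<And>w. w \<in> carrier P \<Longrightarrow> k w = \<beta> (fst (coords w)) z1 * \<beta> (snd (coords w)) z2"
  shows "lca2_mor P lca2_circle k"
proof -
  define k' where "k' = (\<lambda>p. \<beta> (fst p) z1 * \<beta> (snd p) z2)"
  have kk': "k w = k' (coords w)" if "w \<in> carrier P" for w using k[OF that] by (simp add: k'_def)
  have cl: "w \<otimes>\<^bsub>P\<^esub> w' \<in> carrier P" if "w \<in> carrier P" "w' \<in> carrier P" for w w'
    using group_P that by (simp add: group.is_monoid monoid.m_closed)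
  have hom: "k \<in> hom P lca2_circle"
  proof (rule homI)
    show "k w \<in> carrier lca2_circle" if "w \<in> carrier P" for w
      using coords_closed[OF that] z by (auto simp: k[OF that] norm_mult \<beta>_norm)
    show "k (w \<otimes>\<^bsub>P\<^esub> w') = k w \<otimes>\<^bsub>lca2_circle\<^esub> k w'" if "w \<in> carrier P" "w' \<in> carrier P" for w w'
      using coords_closed[OF that(1)] coords_closed[OF that(2)] z
      by (auto simp: k that cl coords_mult \<beta>_mult_left)
  qed
  \<comment> \<open>\<open>good_\<beta>\<close> gives triviality on \<open>L1\<close> for parameters
    in \<open>L2\<close>, so \<open>L2\<close> is made to contain both \<open>z1\<close> and
    \<open>z2\<close>.\<close>
  have zl: "large (\<lambda>L. z1 \<in> L \<and> z2 \<in> L)" by (intro large_conj large_mem z)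
  have one: "k w = 1" if "good L1 L2" "z1 \<in> L2" "z2 \<in> L2" "w \<in> rect L1" "w \<in> carrier P" for L1 L2 w
    using coords_rect[OF goodD(6)[OF that(1)] that(5)] that good_\<beta>(2)[OF that(1)] by (auto simp: k)
  have cont: "continuous_map (sqtop L2 L1) circle_top k'" if L: "good L1 L2" "z1 \<in> L2" "z2 \<in> L2" for L1 L2
  proof -
    note D = goodD[OF L(1)]
    have b: "continuous_map (gtop G L2 L1) circle_top (\<lambda>x. \<beta> x z)" if "z \<in> L2" for z
      using character_continuous_gtop[OF G \<beta>_mor(1) D(4,5,3)] that D(7) good_\<beta>(2)[OF L(1) that] by blast
    have "continuous_map (sqtop L2 L1) circle_top ((\<lambda>x. \<beta> x z1) \<circ> fst)"
      "continuous_map (sqtop L2 L1) circle_top ((\<lambda>x. \<beta> x z2) \<circ> snd)"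
      using continuous_map_compose[OF continuous_map_fst b[OF L(2)]] continuous_map_compose[OF continuous_map_snd b[OF L(3)]]
      by blast+
    \<comment> \<open>\<open>circle_combine\<close> takes three functions; the second is repeated,
      and \<open>u * v\<close> ignores the copy.\<close>
    moreover from this(2) have "continuous_map (sqtop L2 L1) circle_top ((\<lambda>x. \<beta> x z2) \<circ> snd)" .
    moreover have "continuous_on (sphere 0 1 \<times> sphere 0 1 \<times> sphere 0 1) (\<lambda>(u, v, w). u * v :: complex)"
      unfolding case_prod_unfold by (intro continuous_intros)
    moreover have "(\<lambda>(u, v, w). u * v :: complex) ` (sphere 0 1 \<times> sphere 0 1 \<times> sphere 0 1) \<subseteq> sphere 0 1"
      by (auto simp: norm_mult)
    ultimately have "continuous_map (sqtop L2 L1) circle_top (\<lambda>p. (\<lambda>(u, v, w). u * v)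
        (((\<lambda>x. \<beta> x z1) \<circ> fst) p, ((\<lambda>x. \<beta> x z2) \<circ> snd) p, ((\<lambda>x. \<beta> x z2) \<circ> snd) p))"
      by (rule circle_combine)
    then show ?thesis by (simp add: k'_def)
  qed
  show ?thesis
    unfolding lca2_mor_def
  proof (intro conjI ballI impI hom)
    fix S' assume S': "S' \<in> subs lca2_circle"
    obtain S where "S \<in> subs G" using subs_nonempty by blast
    then obtain L1 L2 where L: "good L1 L2" "z1 \<in> L2 \<and> z2 \<in> L2"
      using good_exists[OF zl small_subset] by metis
    have "rect L1 \<in> subs P" using rect_subs goodD(1)[OF L(1)] .
    moreover have "1 \<in> S'" using subgroup.one_closed[OF subgroup_circle[OF S']] by simp
    ultimately show "\<exists>S\<in>subs P. k ` S \<subseteq> S'"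
      using one[OF L(1)] L(2) subs_P_subset[OF \<open>rect L1 \<in> subs P\<close>] by (intro bexI[of _ "rect L1"]) (auto simp: subset_iff)
  next
    fix S assume S: "S \<in> subs P"
    have "k ` S \<subseteq> sphere 0 1" using hom subs_P_subset[OF S] by (auto simp: hom_def)
    then show "\<exists>S'\<in>subs lca2_circle. k ` S \<subseteq> S'" using subs_circle(2) by blast
  next
    fix S1 S2 S1' S2'
    assume S: "S1 \<in> subs P" "S2 \<in> subs P" "S1' \<in> subs lca2_circle" "S2' \<in> subs lca2_circle"
      "S1 \<subseteq> S2" "S1' \<subseteq> S2'" "k ` S1 \<subseteq> S1'" "k ` S2 \<subseteq> S2'"
    let ?q = "qtop P S2 S1" and ?F = "\<lambda>X. S1' <#>\<^bsub>lca2_circle\<^esub> k ` X" and ?A = "circle_group\<lparr>carrier := S2'\<rparr>"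
    have S2c: "S2' \<subseteq> sphere 0 1" using subgroup.subset[OF subgroup_circle[OF S(4)]] by simp
    have cos: "S1' #>\<^bsub>lca2_circle\<^esub> z = S1' #>\<^bsub>?A\<^esub> z" for z by (simp add: r_coset_def)
    have F: "?F (S1 #>\<^bsub>P\<^esub> w) = S1' #>\<^bsub>?A\<^esub> k w" if "w \<in> S2" for w
      using hom_image_coset[OF group_P group_circle(2) hom subs_P_subgroup[OF S(1)] subgroup_circle[OF S(3)] S(7)]
        that subs_P_subset[OF S(2)] cos by blast
    have qt: "qtop lca2_circle S2' S1' = coset_topology ?A (subtopology circle_top S2') S1'"
      by (simp add: lca2_circle_def lca2_of_lca_def)
    \<comment> \<open>The target is a quotient of arbitrary closed subgroups of the circle, so the
      coset map of \<open>S2'\<close> modulo \<open>S1'\<close> is composed after the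
      character.\<close>
    have "quotient_map (subtopology circle_top S2') (qtop lca2_circle S2' S1') (\<lambda>x. S1' #>\<^bsub>?A\<^esub> x)"
      unfolding qt by (rule quotient_map_coset_topology) (use S2c in auto)
    then have qm: "continuous_map (subtopology circle_top S2') (qtop lca2_circle S2' S1') (\<lambda>x. S1' #>\<^bsub>?A\<^esub> x)"
      by (rule quotient_imp_continuous_map)
    have tS2': "topspace (subtopology circle_top S2') = S2'" using S2c by auto
    obtain L1 L2 where L: "good L1 L2" "(z1 \<in> L2 \<and> z2 \<in> L2) \<and> S2 \<subseteq> rect L2" "rect L1 \<subseteq> S1"
      using good_exists[OF large_conj[OF zl large_rect[OF S(2)]] small_rect[OF S(1)]] by blast
    note D = goodD[OF L(1)]
    show "continuous_map ?q (qtop lca2_circle S2' S1') ?F"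
      unfolding continuous_map
    proof (intro conjI allI impI)
      show "?F ` topspace ?q \<subseteq> topspace (qtop lca2_circle S2' S1')"
      proof -
        have "?F (S1 #>\<^bsub>P\<^esub> w) \<in> topspace (qtop lca2_circle S2' S1')" if w: "w \<in> S2" for w
        proof -
          have "k w \<in> S2'" using S(8) w by blast
          then show ?thesis
            unfolding F[OF w] using continuous_map_image_subset_topspace[OF qm] unfolding tS2' by blast
        qed
        then show ?thesis unfolding topspace_qtop_P(1)[OF S(1,2,5)] by blast
      qed
    next
      fix Q assume "openin (qtop lca2_circle S2' S1') Q"
      from openin_continuous_map_preimage[OF qm this]
      obtain D where D': "openin circle_top D" "{x \<in> S2'. S1' #>\<^bsub>?A\<^esub> x \<in> Q} = D \<inter> S2'"
        unfolding tS2' openin_subtopology by blast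
      have "?F (S1 #>\<^bsub>P\<^esub> w) \<in> Q \<longleftrightarrow> k' (coords w) \<in> D" if w: "w \<in> S2" for w
      proof -
        have "k w \<in> S2'" using S(8) w by blast
        then have "S1' #>\<^bsub>?A\<^esub> k w \<in> Q \<longleftrightarrow> k w \<in> D" using D'(2) by blast
        then show ?thesis unfolding F[OF w] kk'[OF subsetD[OF subs_P_subset[OF S(2)] w]] .
      qed
      then show "openin ?q {X \<in> topspace ?q. ?F X \<in> Q}"
        using L D by (intro openin_preimage_qtop_P[OF S(1,2,5) _ _ _ _ _ cont D'(1)]) auto
    qed
  qed
qed

section \<open>The action and its multiplier carried over to the phase space\<close>

definition phase_cocycle :: "int ^ 2 ^ 2 \<Rightarrow> 'a \<times> ('a \<Rightarrow> complex) \<Rightarrow> complex" where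
  "phase_cocycle A w = cocycle A (coords w)"

definition phase_act :: "int ^ 2 ^ 2 \<Rightarrow> 'a \<times> ('a \<Rightarrow> complex) \<Rightarrow> 'a \<times> ('a \<Rightarrow> complex)" where
  "phase_act A w = uncoords (mat_act A (coords w))"

lemma phase_act_closed: "w \<in> carrier P \<Longrightarrow> phase_act A w \<in> carrier P"
  unfolding phase_act_def by (intro uncoords_closed mat_act_closed coords_closed)

lemma coords_phase_act: "w \<in> carrier P \<Longrightarrow> coords (phase_act A w) = mat_act A (coords w)"
  unfolding phase_act_def by (intro coords_uncoords mat_act_closed coords_closed)

lemma phase_act_comp: "w \<in> carrier P \<Longrightarrow> phase_act B (phase_act A w) = phase_act (A ** B) w"
  using coords_phase_act[of w A] mat_act_comp[OF coords_closed] by (simp add: phase_act_def[of B] phase_act_def[of "A ** B"])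

lemma phase_act_one: "w \<in> carrier P \<Longrightarrow> phase_act (mat 1) w = w"
  by (simp add: phase_act_def mat_act_one coords_closed)

lemma phase_act_mult:
  assumes "w \<in> carrier P" "w' \<in> carrier P"
  shows "phase_act A (w \<otimes>\<^bsub>P\<^esub> w') = phase_act A w \<otimes>\<^bsub>P\<^esub> phase_act A w'"
proof -
  obtain x y x' y' where c: "coords w = (x, y)" "coords w' = (x', y')"
    "x \<in> carrier G" "y \<in> carrier G" "x' \<in> carrier G" "y' \<in> carrier G"
    using coords_closed[OF assms(1)] coords_closed[OF assms(2)] by (metis mem_Sigma_iff surj_pair)
  have m: "mat_act A (x, y) \<in> carrier G \<times> carrier G" "mat_act A (x', y') \<in> carrier G \<times> carrier G"
    using mat_act_closed c by auto
  then show ?thesis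
    unfolding phase_act_def coords_mult[OF assms] c fst_conv snd_conv mat_act_mult[OF c(3-6)]
    by (subst uncoords_mult) auto
qed

lemma phase_act_hom: "phase_act A \<in> hom P P"
  by (intro homI phase_act_closed phase_act_mult)

lemma phase_act_rect:
  assumes "L \<in> duals" shows "phase_act A ` rect L \<subseteq> rect L"
proof
  fix v assume "v \<in> phase_act A ` rect L"
  then obtain w where w: "w \<in> rect L" "v = phase_act A w" by blast
  note LG = duals_subs[OF assms] subs_subset[OF duals_subs[OF assms]]
  have wP: "w \<in> carrier P" using w(1) subs_P_subset[OF rect_subs[OF assms]] by blast
  have "coords w \<in> L \<times> L" using coords_rect[OF LG(2) wP] w(1) by blast
  then have "coords v \<in> L \<times> L" using mat_act_square[OF LG(1)] coords_phase_act[OF wP] w(2) by simp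
  then show "v \<in> rect L" using coords_rect[OF LG(2) phase_act_closed[OF wP, of A]] w(2) by simp
qed

lemma phase_act_mor: "lca2_mor P P (phase_act A)"
  unfolding lca2_mor_def
proof (intro conjI ballI impI phase_act_hom)
  fix S' assume "S' \<in> subs P"
  then obtain L where "L \<in> duals" "rect L \<subseteq> S'" using small_ex[OF small_rect] by blast
  then show "\<exists>S\<in>subs P. phase_act A ` S \<subseteq> S'" using rect_subs phase_act_rect by (meson subset_trans)
next
  fix S assume "S \<in> subs P"
  then obtain L where "L \<in> duals" "S \<subseteq> rect L" using large_ex[OF large_rect] by blast
  then show "\<exists>S'\<in>subs P. phase_act A ` S \<subseteq> S'" using rect_subs phase_act_rect by (meson subset_trans image_mono)
next
  fix S1 S2 S1' S2'
  assume S: "S1 \<in> subs P" "S2 \<in> subs P" "S1' \<in> subs P" "S2' \<in> subs P"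
    "S1 \<subseteq> S2" "S1' \<subseteq> S2'" "phase_act A ` S1 \<subseteq> S1'" "phase_act A ` S2 \<subseteq> S2'"
  let ?q = "qtop P S2 S1" and ?F = "\<lambda>X. S1' <#>\<^bsub>P\<^esub> phase_act A ` X"
  have F: "?F (S1 #>\<^bsub>P\<^esub> w) = S1' #>\<^bsub>P\<^esub> phase_act A w" if "w \<in> S2" for w
    using hom_image_coset[OF group_P group_P phase_act_hom subs_P_subgroup[OF S(1)] subs_P_subgroup[OF S(3)] S(7)]
      that subs_P_subset[OF S(2)] by blast
  show "continuous_map ?q (qtop P S2' S1') ?F"
    unfolding qtop_lca2_prod[of _ _ S2']
  proof (rule continuous_on_generated_topo)
    have "?F ` topspace ?q \<subseteq> (\<lambda>w. S1' #>\<^bsub>P\<^esub> w) ` S2'"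
      unfolding topspace_qtop_P(1)[OF S(1,2,5)] using F S(8) by auto
    then show "?F ` topspace ?q \<subseteq> \<Union> (prod_gens G H S2' S1')"
      using topspace_qtop_P(2)[OF S(3,4,6)] by blast
  next
    \<comment> \<open>One pair \<open>L1\<close>, \<open>L2\<close> has to satisfy two demands at
      once: to bracket \<open>S1\<close> and \<open>S2\<close> in the source, and to lie beyond the
      thresholds \<open>R1\<close>, \<open>R2\<close> of the generator in the target.\<close>
    fix Q assume Q: "Q \<in> prod_gens G H S2' S1'"
    obtain R1 R2 where R: "R1 \<in> subs G" "R2 \<in> subs G"
      "\<And>L1 L2. L1 \<in> duals \<Longrightarrow> L2 \<in> duals \<Longrightarrow> L1 \<subseteq> R1 \<Longrightarrow> R2 \<subseteq> L2 \<Longrightarrow>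
        \<exists>E. openin (sqtop L2 L1) E \<and> (\<forall>w\<in>S2'. S1' #>\<^bsub>P\<^esub> w \<in> Q \<longleftrightarrow> coords w \<in> E)"
      using prod_gensE[OF Q subs_P_subset[OF S(4)]] by blast
    obtain L1 L2 where L: "good L1 L2" "S2 \<subseteq> rect L2 \<and> R2 \<subseteq> L2" "rect L1 \<subseteq> S1 \<and> L1 \<subseteq> R1"
      using good_exists[OF large_conj[OF large_rect[OF S(2)] large_superset[OF R(2)]]
          small_conj[OF small_rect[OF S(1)] small_subset[OF R(1)]]] by blast
    note D = goodD[OF L(1)]
    obtain E where E: "openin (sqtop L2 L1) E" "\<forall>w\<in>S2'. S1' #>\<^bsub>P\<^esub> w \<in> Q \<longleftrightarrow> coords w \<in> E"
      using R(3)[OF D(1,2)] L by blast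
    have FQ: "?F (S1 #>\<^bsub>P\<^esub> w) \<in> Q \<longleftrightarrow> mat_act A (coords w) \<in> E" if w: "w \<in> S2" for w
    proof -
      have "phase_act A w \<in> S2'" using S(8) w by blast
      then have "?F (S1 #>\<^bsub>P\<^esub> w) \<in> Q \<longleftrightarrow> coords (phase_act A w) \<in> E" using E(2) F[OF w] by simp
      then show ?thesis using coords_phase_act[of w A] w subs_P_subset[OF S(2)] by auto
    qed
    have "openin ?q {X \<in> topspace ?q. ?F X \<in> Q}"
      by (rule openin_preimage_qtop_P[OF S(1,2,5) D(1-3) _ _ mat_act_continuous[OF D(4,5,3)] E(1) FQ])
         (use L in auto)
    moreover have "?F -` Q \<inter> topspace ?q = {X \<in> topspace ?q. ?F X \<in> Q}" by blast
    ultimately show "openin ?q (?F -` Q \<inter> topspace ?q)" by simp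
  qed
qed

lemma phase_act_iso:
  assumes "det A = 1"
  shows "lca2_iso P P (phase_act A)"
proof -
  obtain B where B: "A ** B = mat 1" "B ** A = mat 1" using SL2_inverse[OF assms] by blast
  show ?thesis unfolding lca2_iso_def
    by (intro conjI phase_act_mor exI[of _ "phase_act B"] ballI) (simp_all add: phase_act_comp B phase_act_one)
qed

text \<open>The cross terms are grouped by the first vector; their exponents form the symmetric
  matrix with rows \<open>a b, b c\<close> and \<open>b c, c d\<close>. With the second vector fixed
  this is a character of the first.\<close>

lemma cocycle_add:
  assumes "x \<in> carrier G" "y \<in> carrier G" "x' \<in> carrier G" "y' \<in> carrier G"
  shows "cocycle A (x \<otimes> x', y \<otimes> y') = cocycle A (x, y) * cocycle A (x', y') *
    (\<beta> x (x' [^] (A$1$1 * A$1$2) \<otimes> y' [^] (A$1$2 * A$2$1)) * \<beta> y (x' [^] (A$1$2 * A$2$1) \<otimes> y' [^] (A$2$1 * A$2$2)))"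
  using assms
  by (simp add: cocycle_def h_mult \<beta>_mult_left \<beta>_mult_right \<beta>_int_pow_right power_int_mult_distrib \<beta>_sym[OF assms(3,2)] mult_ac)

lemma cocycle_nonzero: "p \<in> carrier G \<times> carrier G \<Longrightarrow> cocycle A p \<noteq> 0"
  using cocycle_norm[of p A] by fastforce

lemma polarization_phase_cocycle:
  assumes "w \<in> carrier P" "w' \<in> carrier P" "coords w' = (x', y')"
  shows "polarization P (phase_cocycle A) w w' =
    \<beta> (fst (coords w)) (x' [^] (A$1$1 * A$1$2) \<otimes> y' [^] (A$1$2 * A$2$1)) *
    \<beta> (snd (coords w)) (x' [^] (A$1$2 * A$2$1) \<otimes> y' [^] (A$2$1 * A$2$2))"
proof -
  obtain x y where xy: "coords w = (x, y)" by fastforce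
  have c: "x \<in> carrier G" "y \<in> carrier G" "x' \<in> carrier G" "y' \<in> carrier G"
    using coords_closed[OF assms(1)] coords_closed[OF assms(2)] assms(3) xy by auto
  have "cocycle A (x, y) \<noteq> 0" "cocycle A (x', y') \<noteq> 0" using cocycle_nonzero c by auto
  then show ?thesis
    unfolding polarization_def[of P] phase_cocycle_def coords_mult[OF assms(1,2)] xy assms(3) fst_conv snd_conv cocycle_add[OF c]
    by (simp add: field_simps)
qed

lemma polarization_phase_cocycle_sym:
  assumes "w \<in> carrier P" "w' \<in> carrier P"
  shows "polarization P (phase_cocycle A) w w' = polarization P (phase_cocycle A) w' w"
proof -
  have "coords (w \<otimes>\<^bsub>P\<^esub> w') = coords (w' \<otimes>\<^bsub>P\<^esub> w)"
    unfolding coords_mult[OF assms] coords_mult[OF assms(2,1)]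
    using coords_closed[OF assms(1)] coords_closed[OF assms(2)] by (auto simp: m_comm)
  then show ?thesis by (simp add: polarization_def phase_cocycle_def mult_ac)
qed

lemma phase_cocycle_invariant:
  assumes "good L1 L2" "u \<in> rect L2" "v \<in> rect L1"
  shows "phase_cocycle A (u \<otimes>\<^bsub>P\<^esub> v) = phase_cocycle A u"
proof -
  note D = goodD[OF assms(1)]
  have uv: "u \<in> carrier P" "v \<in> carrier P"
    using assms subs_P_subset[OF rect_subs[OF D(1)]] subs_P_subset[OF rect_subs[OF D(2)]] by blast+
  have "coords u \<in> L2 \<times> L2" "coords v \<in> L1 \<times> L1"
    using coords_rect[OF D(7) uv(1)] coords_rect[OF D(6) uv(2)] assms by blast+
  then show ?thesis
    unfolding phase_cocycle_def coords_mult[OF uv] by (rule cocycle_rect[OF assms(1)])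
qed

text \<open>Each condition is reduced to a square containing the given member: on a
  \<open>good\<close> pair the multiplier is invariant, and its polarization is a product of two
  characters of \<open>G\<close> in the coordinates.\<close>

lemma phase_cocycle_quadratic: "quadratic_character P (phase_cocycle A)"
proof -
  let ?f = "phase_cocycle A" and ?b = "polarization P (phase_cocycle A)"
  obtain S0 where S0: "S0 \<in> subs G" using subs_nonempty by blast
  have good_rect: "\<exists>L1 L2. good L1 L2 \<and> U \<subseteq> rect L2" if "U \<in> subs P" for U
    using good_exists[OF large_rect[OF that] small_subset[OF S0]] by blast
  have inv: "\<exists>V\<in>subs P. \<forall>u\<in>U. \<forall>v\<in>V. ?f (u \<otimes>\<^bsub>P\<^esub> v) = ?f u" if U: "U \<in> subs P" for U
  proof -
    obtain L1 L2 where L: "good L1 L2" "U \<subseteq> rect L2" using good_rect[OF U] by blast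
    have "?f (u \<otimes>\<^bsub>P\<^esub> v) = ?f u" if "u \<in> U" "v \<in> rect L1" for u v
      using phase_cocycle_invariant[OF L(1) subsetD[OF L(2) that(1)] that(2)] .
    then show ?thesis using rect_subs[OF goodD(1)[OF L(1)]] by (intro bexI[of _ "rect L1"] ballI)
  qed
  have nz: "?f w \<noteq> 0" if "w \<in> carrier P" for w
    using cocycle_nonzero[OF coords_closed[OF that]] by (simp add: phase_cocycle_def)
  \<comment> \<open>Stated for any \<open>k\<close> that agrees with the polarization on the
    carrier, so that symmetry, valid only there, also gives the character in the second
    variable.\<close>
  have mor: "lca2_mor P lca2_circle k"
    if w': "w' \<in> carrier P" and k: "\<And>w. w \<in> carrier P \<Longrightarrow> k w = ?b w w'" for k w'
  proof -
    obtain x' y' where xy: "coords w' = (x', y')" by fastforce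
    then have c: "x' \<in> carrier G" "y' \<in> carrier G" using coords_closed[OF w'] by auto
    show ?thesis
      by (rule character_of_phase_space[where ?z1.0 = "x' [^] (A$1$1 * A$1$2) \<otimes> y' [^] (A$1$2 * A$2$1)"
            and ?z2.0 = "x' [^] (A$1$2 * A$2$1) \<otimes> y' [^] (A$2$1 * A$2$2)"])
         (simp_all add: c k polarization_phase_cocycle[OF _ w' xy])
  qed
  \<comment> \<open>Invariance at the identity makes \<open>?f\<close> equal to \<open>1\<close> on
    the small square. Recording both orders settles both triviality conditions of a
    bicharacter.\<close>
  have triv: "\<exists>V\<in>subs P. \<forall>u\<in>U. \<forall>v\<in>V. ?b u v = 1 \<and> ?b v u = 1" if U: "U \<in> subs P" for U
  proof -
    obtain L1 L2 where L: "good L1 L2" "U \<subseteq> rect L2" using good_rect[OF U] by blast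
    note D = goodD[OF L(1)]
    have R1: "rect L1 \<in> subs P" "rect L2 \<in> subs P" using rect_subs D by auto
    have one: "\<one>\<^bsub>P\<^esub> \<in> rect L2" using subgroup.one_closed[OF subs_P_subgroup[OF R1(2)]] .
    have 1: "?b u v = 1" if "u \<in> U" "v \<in> rect L1" for u v
    proof -
      have uv: "u \<in> carrier P" "v \<in> carrier P"
        by (rule subsetD[OF subs_P_subset[OF U] that(1)], rule subsetD[OF subs_P_subset[OF R1(1)] that(2)])
      have f1: "?f \<one>\<^bsub>P\<^esub> = 1"
      proof -
        have "g \<one>\<^bsub>H\<^esub> = \<one>" using g_\<rho>[OF one_closed] unfolding \<rho>_one .
        then have "coords \<one>\<^bsub>P\<^esub> = (\<one>, \<one>)" by (simp add: coords_def lca2_prod_simps)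
        then show ?thesis by (simp add: phase_cocycle_def cocycle_def h_one \<beta>_one)
      qed
      have "?f v = ?f (\<one>\<^bsub>P\<^esub> \<otimes>\<^bsub>P\<^esub> v)" using uv group_P by (simp add: group.is_monoid monoid.l_one)
      also have "\<dots> = 1" using phase_cocycle_invariant[OF L(1) one that(2)] f1 by simp
      finally have "?f v = 1" .
      moreover have "?f (u \<otimes>\<^bsub>P\<^esub> v) = ?f u" using phase_cocycle_invariant[OF L(1) _ that(2)] that(1) L(2) by blast
      ultimately show ?thesis using nz[OF uv(1)] by (simp add: polarization_def)
    qed
    have "?b v u = 1" if "u \<in> U" "v \<in> rect L1" for u v
      using 1[OF that] polarization_phase_cocycle_sym[OF subsetD[OF subs_P_subset[OF U] that(1)]
          subsetD[OF subs_P_subset[OF R1(1)] that(2)]] by simp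
    then show ?thesis using 1 R1(1) by (intro bexI[of _ "rect L1"] ballI conjI)
  qed
  show ?thesis
    unfolding quadratic_character_def bicharacter_def
  proof (intro conjI ballI impI inv)
    show "?f \<in> carrier P \<rightarrow> carrier lca2_circle"
      using cocycle_norm[OF coords_closed] by (auto simp: phase_cocycle_def)
    show "lca2_mor P lca2_circle (\<lambda>x. ?b x y)" if "y \<in> carrier P" for y
      using mor[OF that] by simp
    show "lca2_mor P lca2_circle (\<lambda>y. ?b x y)" if "x \<in> carrier P" for x
      using mor[OF that] polarization_phase_cocycle_sym[OF that] by simp
    show "\<exists>V\<in>subs P. \<forall>u\<in>U. \<forall>v\<in>V. ?b u v = 1" if "U \<in> subs P" for U
      using triv[OF that] by blast
    show "\<exists>U\<in>subs P. \<forall>u\<in>U. \<forall>v\<in>V. ?b u v = 1" if "V \<in> subs P" for V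
      using triv[OF that] by blast
  next
    \<comment> \<open>\<open>U\<close> and \<open>V\<close> are arbitrary members here; the squares
      chosen below only bracket them.\<close>
    fix U V assume UV: "U \<in> subs P" "V \<in> subs P" "V \<subseteq> U" "\<forall>u\<in>U. \<forall>v\<in>V. ?f (u \<otimes>\<^bsub>P\<^esub> v) = ?f u"
    let ?q = "qtop P U V" and ?F = "\<lambda>X. the_elem (?f ` X)"
    have Vne: "V \<noteq> {}" using subgroup.one_closed[OF subs_P_subgroup[OF UV(2)]] by blast
    have F: "?F (V #>\<^bsub>P\<^esub> w) = cocycle A (coords w)" if w: "w \<in> U" for w
    proof -
      have "?f (v \<otimes>\<^bsub>P\<^esub> w) = ?f w" if v: "v \<in> V" for v
      proof -
        have vw: "v \<in> carrier P" "w \<in> carrier P" using v w subs_P_subset UV by blast+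
        have "coords (v \<otimes>\<^bsub>P\<^esub> w) = coords (w \<otimes>\<^bsub>P\<^esub> v)"
          unfolding coords_mult[OF vw] coords_mult[OF vw(2,1)]
          using coords_closed[OF vw(1)] coords_closed[OF vw(2)] by (auto simp: m_comm)
        then show ?thesis using UV(4) w v by (simp add: phase_cocycle_def)
      qed
      then have "(\<lambda>v. ?f (v \<otimes>\<^bsub>P\<^esub> w)) ` V = (\<lambda>_. ?f w) ` V" by (rule image_cong[OF refl])
      moreover have "V #>\<^bsub>P\<^esub> w = (\<lambda>v. v \<otimes>\<^bsub>P\<^esub> w) ` V" by (auto simp: r_coset_def)
      ultimately have "?f ` (V #>\<^bsub>P\<^esub> w) = (\<lambda>_. ?f w) ` V" by (simp only: image_image)
      then have "?f ` (V #>\<^bsub>P\<^esub> w) = {?f w}" using Vne by (simp add: image_constant_conv)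
      then show ?thesis by (simp add: phase_cocycle_def)
    qed
    obtain L1 L2 where L: "good L1 L2" "U \<subseteq> rect L2" "rect L1 \<subseteq> V"
      using good_exists[OF large_rect[OF UV(1)] small_rect[OF UV(2)]] by blast
    note D = goodD[OF L(1)]
    show "continuous_map ?q circle_top ?F"
      unfolding continuous_map
    proof (intro conjI allI impI)
      show "?F ` topspace ?q \<subseteq> topspace circle_top"
        unfolding topspace_qtop_P(1)[OF UV(2,1,3)]
        using F cocycle_norm[OF coords_closed] subs_P_subset[OF UV(1)] by (auto simp: subset_iff)
      fix Q assume Q: "openin circle_top Q"
      have "?F (V #>\<^bsub>P\<^esub> w) \<in> Q \<longleftrightarrow> cocycle A (coords w) \<in> Q" if "w \<in> U" for w
        unfolding F[OF that] ..
      then show "openin ?q {X \<in> topspace ?q. ?F X \<in> Q}"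
        by (rule openin_preimage_qtop_P[OF UV(2,1,3) D(1-3) L(3,2) cocycle_continuous[OF L(1), of A] Q])
    qed
  qed
qed

end

section \<open>The representation of the modular group\<close>

lemma carrier_heisenberg: "carrier (heisenberg G) = carrier (phase_space G) \<times> sphere 0 1"
  by (simp add: heisenberg_def)

lemma mult_heisenberg [simp]:
  "(w1, t1) \<otimes>\<^bsub>heisenberg G\<^esub> (w2, t2) = (w1 \<otimes>\<^bsub>phase_space G\<^esub> w2, snd w2 (fst w1) * t1 * t2)"
  by (simp add: heisenberg_def)

lemma heis_map_cong:
  assumes "\<And>w. w \<in> carrier (phase_space G) \<Longrightarrow> \<sigma> w = \<sigma>' w \<and> f w = f' w"
  shows "heis_map G \<sigma> f = heis_map G \<sigma>' f'"
  unfolding heis_map_def by (rule restrict_ext) (use assms in \<open>auto simp: carrier_heisenberg\<close>)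

context even_quadratic
begin

definition modular_rep ::
    "int ^ 2 ^ 2 \<Rightarrow> ('a \<times> ('a \<Rightarrow> complex)) \<times> complex \<Rightarrow> ('a \<times> ('a \<Rightarrow> complex)) \<times> complex" where
  "modular_rep A = heis_map G (phase_act A) (phase_cocycle A)"

lemma modular_rep_apply:
  "w \<in> carrier P \<Longrightarrow> norm t = 1 \<Longrightarrow> modular_rep A (w, t) = (phase_act A w, phase_cocycle A w * t)"
  by (simp add: modular_rep_def heis_map_def carrier_heisenberg)

lemma norm_phase_cocycle: "w \<in> carrier P \<Longrightarrow> norm (phase_cocycle A w) = 1"
  unfolding phase_cocycle_def by (intro cocycle_norm coords_closed)

lemma modular_rep_closed: "z \<in> carrier (heisenberg G) \<Longrightarrow> modular_rep A z \<in> carrier (heisenberg G)"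
  by (cases z) (auto simp: carrier_heisenberg modular_rep_apply phase_act_closed norm_mult norm_phase_cocycle)

text \<open>Identifies the Heisenberg factor \<open>F\<close> with \<open>\<beta>\<close>, so that
  \<open>cocycle_polarization\<close> becomes the homomorphism property.\<close>

lemma pairing_coords:
  assumes "w \<in> carrier P" "w' \<in> carrier P"
  shows "snd w' (fst w) = \<beta> (fst (coords w)) (snd (coords w'))"
proof -
  have w: "fst w \<in> carrier G" "snd w' \<in> carrier H" using assms by (auto simp: lca2_prod_simps)
  then show ?thesis using \<rho>_apply[OF w(1), of "g (snd w')"] by (simp add: coords_def)
qed

lemma modular_rep_hom:
  assumes "det A = 1"
  shows "modular_rep A \<in> hom (heisenberg G) (heisenberg G)"
proof (rule homI[OF modular_rep_closed])
  fix z z' assume "z \<in> carrier (heisenberg G)" "z' \<in> carrier (heisenberg G)"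
  then obtain w t w' t' where z: "z = (w, t)" "z' = (w', t')" "w \<in> carrier P" "w' \<in> carrier P" "norm t = 1" "norm t' = 1"
    by (cases z; cases z') (auto simp: carrier_heisenberg)
  obtain x y x' y' where c: "coords w = (x, y)" "coords w' = (x', y')" by fastforce
  have xy: "x \<in> carrier G" "y \<in> carrier G" "x' \<in> carrier G" "y' \<in> carrier G"
    using coords_closed[OF z(3)] coords_closed[OF z(4)] c by auto
  have p: "snd w' (fst w) = \<beta> x y'" using pairing_coords[OF z(3,4)] c by simp
  have p': "snd (phase_act A w') (fst (phase_act A w)) = \<beta> (fst (mat_act A (x, y))) (snd (mat_act A (x', y')))"
    using pairing_coords[OF phase_act_closed[OF z(3)] phase_act_closed[OF z(4)]] coords_phase_act z(3,4) c by simp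
  have ww: "w \<otimes>\<^bsub>P\<^esub> w' \<in> carrier P" using z(3,4) group_P by (simp add: group.is_monoid monoid.m_closed)
  have n: "norm (\<beta> x y' * t * t') = 1" using z \<beta>_norm xy by (simp add: norm_mult)
  have "phase_cocycle A (w \<otimes>\<^bsub>P\<^esub> w') * \<beta> x y' =
      \<beta> (fst (mat_act A (x, y))) (snd (mat_act A (x', y'))) * phase_cocycle A w * phase_cocycle A w'"
    unfolding phase_cocycle_def coords_mult[OF z(3,4)] c fst_conv snd_conv by (rule cocycle_polarization[OF xy assms])
  then have "phase_cocycle A (w \<otimes>\<^bsub>P\<^esub> w') * (\<beta> x y' * t * t') =
      \<beta> (fst (mat_act A (x, y))) (snd (mat_act A (x', y'))) * (phase_cocycle A w * t) * (phase_cocycle A w' * t')"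
    by (simp add: mult_ac)
  then show "modular_rep A (z \<otimes>\<^bsub>heisenberg G\<^esub> z') = modular_rep A z \<otimes>\<^bsub>heisenberg G\<^esub> modular_rep A z'"
    unfolding z(1,2) mult_heisenberg p modular_rep_apply[OF ww n] modular_rep_apply[OF z(3,5)]
      modular_rep_apply[OF z(4,6)] p' phase_act_mult[OF z(3,4)] by simp
qed

lemma modular_rep_mult:
  assumes "det B = 1"
  shows "modular_rep A \<otimes>\<^bsub>B0 G\<^esub> modular_rep B = modular_rep (A ** B)"
proof -
  have "modular_rep A \<otimes>\<^bsub>B0 G\<^esub> modular_rep B =
      heis_map G (\<lambda>w. phase_act B (phase_act A w)) (\<lambda>w. phase_cocycle A w * phase_cocycle B (phase_act A w))"
    unfolding modular_rep_def
    by (rule B0_mult_heis_map) (use phase_act_closed norm_phase_cocycle in auto)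
  also have "\<dots> = modular_rep (A ** B)"
    unfolding modular_rep_def
  proof (rule heis_map_cong, rule conjI)
    fix w assume w: "w \<in> carrier P"
    show "phase_act B (phase_act A w) = phase_act (A ** B) w" by (rule phase_act_comp[OF w])
    show "phase_cocycle A w * phase_cocycle B (phase_act A w) = phase_cocycle (A ** B) w"
      unfolding phase_cocycle_def coords_phase_act[OF w] by (rule cocycle_mult[OF coords_closed[OF w] assms])
  qed
  finally show ?thesis .
qed

lemma modular_rep_inverse:
  assumes "A ** B = mat 1" "det B = 1" "z \<in> carrier (heisenberg G)"
  shows "modular_rep B (modular_rep A z) = z"
proof -
  have "modular_rep B (modular_rep A z) = (modular_rep A \<otimes>\<^bsub>B0 G\<^esub> modular_rep B) z"
    using assms(3) by (simp add: B0_def compose_def)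
  also have "\<dots> = modular_rep (mat 1) z" by (simp add: modular_rep_mult assms)
  also have "\<dots> = z"
    using assms(3) by (cases z) (simp add: carrier_heisenberg modular_rep_apply phase_act_one phase_cocycle_def cocycle_one)
  finally show ?thesis .
qed

text \<open>Bijectivity comes from the inverse matrix, whose map is a two-sided inverse on the
  Heisenberg group.\<close>

lemma modular_rep_B0:
  assumes "det A = 1"
  shows "modular_rep A \<in> carrier (B0 G)"
proof -
  obtain B where B: "A ** B = mat 1" "B ** A = mat 1" "det B = 1" using SL2_inverse[OF assms] by blast
  have "bij_betw (modular_rep A) (carrier (heisenberg G)) (carrier (heisenberg G))"
    by (rule bij_betw_byWitness[where f' = "modular_rep B"])
       (use modular_rep_inverse[OF B(1,3)] modular_rep_inverse[OF B(2) assms] modular_rep_closed in auto)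
  moreover have "modular_rep A \<in> extensional (carrier (heisenberg G))"
    by (simp add: modular_rep_def heis_map_def)
  ultimately have "modular_rep A \<in> auto (heisenberg G)"
    using modular_rep_hom[OF assms] by (simp add: auto_def Bij_def)
  then show ?thesis
    using phase_act_iso[OF assms] phase_cocycle_quadratic modular_rep_def unfolding B0_def by auto
qed

text \<open>The exponents \<open>a b\<close>, \<open>c d\<close>, \<open>b c\<close> are 1, 0, 0,
  which leaves \<open>h x\<close>.\<close>

lemma modular_rep_t0: "modular_rep (vector [vector [1, 1], vector [0, 1]]) = t0 G h"
  unfolding modular_rep_def t0_def
proof (rule heis_map_cong)
  fix w assume w: "w \<in> carrier P"
  obtain x \<xi> where x: "w = (x, \<xi>)" "x \<in> carrier G" "\<xi> \<in> carrier H" using w by (auto simp: lca2_prod_simps)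
  then have "g \<xi> \<in> carrier G" using g_closed by blast
  then show "phase_act (vector [vector [1, 1], vector [0, 1]]) w =
      matrix_map G (\<lambda>x. x) \<rho> (\<lambda>\<xi>. \<one>) (\<lambda>\<xi>. \<xi>) w \<and>
      phase_cocycle (vector [vector [1, 1], vector [0, 1]]) w = (case w of (x, \<xi>) \<Rightarrow> h x)"
    using x by (simp add: phase_act_def phase_cocycle_def cocycle_def mat_act_def coords_def uncoords_def matrix_map_def)
qed

text \<open>The exponents \<open>a b\<close>, \<open>c d\<close>, \<open>b c\<close> are 0, 0, -1.
  What remains is the inverse of \<open>\<beta> x (g \<xi>)\<close>, that is, the inverse character
  of \<open>\<xi>\<close> evaluated at \<open>x\<close>.\<close>

lemma modular_rep_d0': "modular_rep (vector [vector [0, -1], vector [1, 0]]) = d0'_inv G \<rho>"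
  unfolding modular_rep_def d0'_inv_def
proof (rule heis_map_cong)
  fix w assume w: "w \<in> carrier P"
  obtain x \<xi> where x: "w = (x, \<xi>)" "x \<in> carrier G" "\<xi> \<in> carrier H" using w by (auto simp: lca2_prod_simps)
  then have y: "g \<xi> \<in> carrier G" using g_closed by blast
  have "inv\<^bsub>H\<^esub> \<xi> = \<rho> (inv (g \<xi>))" using \<rho>.hom_inv[OF y] x(3) by simp
  then have "(inv\<^bsub>H\<^esub> \<xi>) x = \<beta> x (inv (g \<xi>))" by (simp only: \<rho>_apply[OF x(2)])
  also have "\<dots> = \<beta> x (g \<xi>) powi (-1)"
    using \<beta>_int_pow_right[OF x(2) y, of "-1"] y by (simp add: int_pow_neg)
  finally show "phase_act (vector [vector [0, -1], vector [1, 0]]) w =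
      matrix_map G (\<lambda>x. \<one>) (\<lambda>x. inv\<^bsub>H\<^esub> (\<rho> x)) g (\<lambda>\<xi>. \<one>\<^bsub>H\<^esub>) w \<and>
      phase_cocycle (vector [vector [0, -1], vector [1, 0]]) w = (case w of (x, \<xi>) \<Rightarrow> (inv\<^bsub>H\<^esub> \<xi>) x)"
    using x y by (simp add: phase_act_def phase_cocycle_def cocycle_def mat_act_def coords_def uncoords_def matrix_map_def int_pow_neg)
qed

end

theorem theorem4p2:
  fixes G :: "'a lca2" and h :: "'a \<Rightarrow> complex"
  assumes "lca2_group G"
    and "nondegenerate_quadratic_character G h"
    and "\<And>x. x \<in> carrier G \<Longrightarrow> h x = h (inv\<^bsub>G\<^esub> x)"
  shows "\<exists>\<phi> \<in> hom SL2Z (B0 G).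
           \<phi> (vector [vector [1, 1], vector [0, 1]]) = t0 G h \<and>
           \<phi> (vector [vector [0, -1], vector [1, 0]]) = d0'_inv G (quad_rho G h)"
proof -
  have "comm_group G" using assms(1) by (simp add: lca2_group_def)
  then interpret even_quadratic G h
    using assms by (intro even_quadratic.intro even_quadratic_axioms.intro)
  have "modular_rep \<in> hom SL2Z (B0 G)"
    by (rule homI) (auto simp: SL2Z_def modular_rep_B0 modular_rep_mult)
  then show ?thesis using modular_rep_t0 modular_rep_d0' by blast
qed

end
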